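(* Let $p$ be a prime and $k$ an algebraically closed field of characteristic $p$. Let $\mathcal{F}$ be a constrained fusion system on a finite $p$-group $P$, let $\mathfrak{M}$ be a model for $\mathcal{F}$, let $G=\mathrm{Park}(\mathcal{F},\mathfrak{M})$, and let $\iota:\mathfrak{M}\hookrightarrow G$ be Park's embedding of $\mathfrak{M}$ into $G$. Then $\mathrm{Sc}(G,\iota P)=\mathrm{Ind}_{\iota\mathfrak{M}}^{G}(k)$ (as $kG$-modules, up to isomorphism).
   Context: Modules are finitely generated left modules; $k$ also denotes the trivial module. For a finite group $X$ and a $p$-subgroup $P\le X$, $\mathcal{F}_P(X)$ is the category whose objects are the subgroups of $P$ and whose morphisms are the homomorphisms induced by conjugation by elements of $X$. For a saturated fusion system $\mathcal{F}$ on $P$, $O_p(\mathcal{F})$ is the largest subgroup of $P$ normal in $\mathcal{F}$ (a subgroup $Q\trianglelefteq P$ is normal in $\mathcal{F}$ if every morphism $R\to S$ of $\mathcal{F}$ extends to a morphism $RQ\to SQ$ of $\mathcal{F}$ mapping $Q$ onto $Q$). A saturated fusion system $\mathcal{F}$ on $P$ is constrained if $C_P(O_p(\mathcal{F}))\le O_p(\mathcal{F})$. A finite group $X$ is strictly $p$-constrained if $O_{p'}(X)=1$ and $C_X(O_p(X))\le O_p(X)$. A model for a constrained fusion system $\mathcal{F}$ on $P$ is a strictly $p$-constrained finite group $\mathfrak{M}$ containing $P$ as a Sylow $p$-subgroup with $\mathcal{F}=\mathcal{F}_P(\mathfrak{M})$. Park's group: $\mathrm{Park}(\mathcal{F},\mathfrak{M})$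 is the group (under composition) of all bijections $f:\mathfrak{M}\to\mathfrak{M}$ with $f(mu)=f(m)u$ for all $m\in\mathfrak{M}$, $u\in P$. The embedding $\iota:\mathfrak{M}\to G$ is left multiplication, $\iota(x)=(m\mapsto xm)$; its restriction to $P$ is Park's embedding of $P$, with image $\iota P$. Scott module: for $H\le G$, $\mathrm{Sc}(G,H)$ is the (unique up to isomorphism) indecomposable direct summand of $\mathrm{Ind}_H^G(k)$ having the trivial module $k_G$ in its socle. *)

theory Defs
  imports "HOL-Algebra.Algebra"
begin

section \<open>Finite groups\<close>

definition p_group :: "nat \<Rightarrow> ('a, 'm) monoid_scheme \<Rightarrow> bool" where
  "p_group p G \<longleftrightarrow> group G \<and> (\<exists>n. order G = p ^ n)"

definition sylow_subgroup :: "nat \<Rightarrow> 'a set \<Rightarrow> ('a, 'm) monoid_scheme \<Rightarrow> bool" where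
  "sylow_subgroup p P G \<longleftrightarrow> subgroup P G \<and> card P = p ^ multiplicity p (order G)"

definition centralizer :: "('a, 'm) monoid_scheme \<Rightarrow> 'a set \<Rightarrow> 'a set" where
  "centralizer G S = {g \<in> carrier G. \<forall>s\<in>S. g \<otimes>\<^bsub>G\<^esub> s = s \<otimes>\<^bsub>G\<^esub> g}"

text \<open>
  \<open>O\<^sub>p(G)\<close> and \<open>O\<^sub>p\<^sub>'(G)\<close>. Here and in \<open>fusion_p_core\<close> below, \<open>GREATEST\<close> refers to the inclusion
  order; the greatest elements exist for finite \<open>G\<close> and for saturated \<open>F\<close>.
  In \<open>p'_core\<close> the condition \<open>\<not> p dvd card N\<close> forces \<open>N\<close> to be finite.
\<close>

definition p_core :: "nat \<Rightarrow> 'a monoid \<Rightarrow> 'a set" where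
  "p_core p G = (GREATEST N. N \<lhd> G \<and> p_group p (G\<lparr>carrier := N\<rparr>))"

definition p'_core :: "nat \<Rightarrow> 'a monoid \<Rightarrow> 'a set" where
  "p'_core p G = (GREATEST N. N \<lhd> G \<and> \<not> p dvd card N)"

definition strictly_p_constrained :: "nat \<Rightarrow> 'a monoid \<Rightarrow> bool" where
  "strictly_p_constrained p G \<longleftrightarrow>
     group G \<and> finite (carrier G) \<and>
     p'_core p G = {\<one>\<^bsub>G\<^esub>} \<and> centralizer G (p_core p G) \<subseteq> p_core p G"


section \<open>Fusion systems\<close>

text \<open>
  A category whose objects are subgroups of \<open>P\<close> and whose morphisms are maps is given by its
  morphism sets: \<open>F Q R\<close> is the set of morphisms from \<open>Q\<close> to \<open>R\<close>, encoded as functions that are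
  extensional on \<open>Q\<close>, and \<open>F Q R = {}\<close> unless \<open>Q\<close> and \<open>R\<close> are subgroups of \<open>P\<close>. With this
  convention equality of categories is equality of the functions \<open>F\<close>.
\<close>

type_synonym 'a fusion = "'a set \<Rightarrow> 'a set \<Rightarrow> ('a \<Rightarrow> 'a) set"

definition conj_by :: "('a, 'm) monoid_scheme \<Rightarrow> 'a \<Rightarrow> 'a \<Rightarrow> 'a" where
  "conj_by G x y = x \<otimes>\<^bsub>G\<^esub> y \<otimes>\<^bsub>G\<^esub> inv\<^bsub>G\<^esub> x"

definition group_fusion :: "'a monoid \<Rightarrow> 'a set \<Rightarrow> 'a fusion" where
  "group_fusion G P Q R =
     {restrict (conj_by G x) Q | x.
        subgroup Q G \<and> Q \<subseteq> P \<and> subgroup R G \<and> R \<subseteq> P \<and> x \<in> carrier G \<and> conj_by G x ` Q \<subseteq> R}"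

locale fusion_system = group P for P :: "'a monoid" (structure) and F :: "'a fusion" +
  assumes objects: "\<phi> \<in> F Q R \<Longrightarrow> subgroup Q P \<and> subgroup R P"
    and injective_homs: "\<phi> \<in> F Q R \<Longrightarrow>
      \<phi> \<in> hom (P\<lparr>carrier := Q\<rparr>) (P\<lparr>carrier := R\<rparr>) \<and> inj_on \<phi> Q \<and> \<phi> \<in> extensional Q"
    and conjugations: "group_fusion P (carrier P) Q R \<subseteq> F Q R"
    and composition: "\<phi> \<in> F Q R \<Longrightarrow> \<psi> \<in> F R S \<Longrightarrow> compose Q \<psi> \<phi> \<in> F Q S"
    and corestriction: "\<phi> \<in> F Q R \<Longrightarrow> \<phi> \<in> F Q (\<phi> ` Q)"
    and inverse: "\<phi> \<in> F Q R \<Longrightarrow> restrict (inv_into Q \<phi>) (\<phi> ` Q) \<in> F (\<phi> ` Q) Q"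

text \<open>The \<open>F\<close>-conjugates of \<open>Q\<close> are the images of the morphisms from \<open>Q\<close> to \<open>P\<close>.\<close>

definition fully_normalized :: "'a monoid \<Rightarrow> 'a fusion \<Rightarrow> 'a set \<Rightarrow> bool" where
  "fully_normalized P F Q \<longleftrightarrow>
     (\<forall>\<phi> \<in> F Q (carrier P). card (normalizer P (\<phi> ` Q)) \<le> card (normalizer P Q))"

definition fully_centralized :: "'a monoid \<Rightarrow> 'a fusion \<Rightarrow> 'a set \<Rightarrow> bool" where
  "fully_centralized P F Q \<longleftrightarrow>
     (\<forall>\<phi> \<in> F Q (carrier P). card (centralizer P (\<phi> ` Q)) \<le> card (centralizer P Q))"

definition fusion_aut :: "'a fusion \<Rightarrow> 'a set \<Rightarrow> ('a \<Rightarrow> 'a) monoid" where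
  "fusion_aut F Q = BijGroup Q\<lparr>carrier := F Q Q\<rparr>"

text \<open>
  \<open>N\<^sub>\<phi>\<close>: the elements \<open>x\<close> of \<open>N\<^sub>P(Q)\<close> for which \<open>\<phi> \<circ> c\<^sub>x \<circ> \<phi>\<^sup>-\<^sup>1\<close> agrees with conjugation by some
  \<open>y\<close> in \<open>N\<^sub>P(\<phi>(Q))\<close>.
\<close>

definition extension_domain :: "'a monoid \<Rightarrow> 'a set \<Rightarrow> ('a \<Rightarrow> 'a) \<Rightarrow> 'a set" where
  "extension_domain P Q \<phi> =
     {x \<in> normalizer P Q.
        \<exists>y \<in> normalizer P (\<phi> ` Q). \<forall>q\<in>Q. \<phi> (conj_by P x q) = conj_by P y (\<phi> q)}"

text \<open>The saturation axioms of Broto, Levi and Oliver.\<close>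

locale saturated_fusion_system = fusion_system P F
  for p :: nat and P :: "'a monoid" (structure) and F :: "'a fusion" +
  assumes p_group: "p_group p P"
    and sylow_axiom: "subgroup Q P \<Longrightarrow> fully_normalized P F Q \<Longrightarrow>
      fully_centralized P F Q \<and>
      sylow_subgroup p (group_fusion P (carrier P) Q Q) (fusion_aut F Q)"
    and extension_axiom: "\<phi> \<in> F Q (carrier P) \<Longrightarrow> fully_centralized P F (\<phi> ` Q) \<Longrightarrow>
      \<exists>\<psi> \<in> F (extension_domain P Q \<phi>) (carrier P). \<forall>q\<in>Q. \<psi> q = \<phi> q"

definition normal_in_fusion :: "'a monoid \<Rightarrow> 'a fusion \<Rightarrow> 'a set \<Rightarrow> bool" where
  "normal_in_fusion P F Q \<longleftrightarrow>
     Q \<lhd> P \<and>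
     (\<forall>R S. \<forall>\<phi> \<in> F R S.
        \<exists>\<psi> \<in> F (R <#>\<^bsub>P\<^esub> Q) (S <#>\<^bsub>P\<^esub> Q). (\<forall>r\<in>R. \<psi> r = \<phi> r) \<and> \<psi> ` Q = Q)"

definition fusion_p_core :: "'a monoid \<Rightarrow> 'a fusion \<Rightarrow> 'a set" where
  "fusion_p_core P F = (GREATEST Q. normal_in_fusion P F Q)"

locale constrained_fusion_system = saturated_fusion_system +
  assumes constrained: "centralizer P (fusion_p_core P F) \<subseteq> fusion_p_core P F"

text \<open>
  That the group \<open>P\<close> is a subgroup of \<open>M\<close> is expressed by \<open>P = M\<lparr>carrier := carrier P\<rparr>\<close> together
  with the condition that its carrier is a subgroup.
\<close>

definition fusion_model :: "nat \<Rightarrow> 'a monoid \<Rightarrow> 'a fusion \<Rightarrow> 'a monoid \<Rightarrow> bool" where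
  "fusion_model p P F M \<longleftrightarrow>
     strictly_p_constrained p M \<and>
     P = M\<lparr>carrier := carrier P\<rparr> \<and> sylow_subgroup p (carrier P) M \<and>
     F = group_fusion M (carrier P)"


section \<open>Park's group\<close>

definition park_group :: "'a monoid \<Rightarrow> 'a monoid \<Rightarrow> ('a \<Rightarrow> 'a) monoid" where
  "park_group P M = BijGroup (carrier M)
     \<lparr>carrier := {f \<in> Bij (carrier M).
        \<forall>m \<in> carrier M. \<forall>u \<in> carrier P. f (m \<otimes>\<^bsub>M\<^esub> u) = f m \<otimes>\<^bsub>M\<^esub> u}\<rparr>"

definition park_embedding :: "'a monoid \<Rightarrow> 'a \<Rightarrow> 'a \<Rightarrow> 'a" where
  "park_embedding M x = (\<lambda>m \<in> carrier M. x \<otimes>\<^bsub>M\<^esub> m)"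


section \<open>Modules over group algebras\<close>

definition ring_char :: "('k, 'm) ring_scheme \<Rightarrow> nat" where
  "ring_char R =
     (if \<exists>n::nat. 0 < n \<and> [n] \<cdot>\<^bsub>R\<^esub> \<one>\<^bsub>R\<^esub> = \<zero>\<^bsub>R\<^esub>
      then (LEAST n. 0 < n \<and> [n] \<cdot>\<^bsub>R\<^esub> \<one>\<^bsub>R\<^esub> = \<zero>\<^bsub>R\<^esub>) else 0)"

text \<open>
  A left module over the group algebra of \<open>G\<close> over the field \<open>K\<close> is given as a vector space over
  \<open>K\<close> together with a linear action of \<open>G\<close>. The fields \<open>mult\<close> and \<open>one\<close> inherited from the record
  type of rings carry no information.
\<close>

record ('k, 'g, 'v) gmodule = "('k, 'v) module" +
  act :: "'g \<Rightarrow> 'v \<Rightarrow> 'v"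

definition kG_submodule ::
  "'k ring \<Rightarrow> 'g monoid \<Rightarrow> ('k, 'g, 'v) gmodule \<Rightarrow> 'v set \<Rightarrow> bool" where
  "kG_submodule K G V N \<longleftrightarrow>
     submodule N K V \<and> (\<forall>g \<in> carrier G. \<forall>v\<in>N. act V g v \<in> N)"

locale kG_module = K?: field K + G?: group G + V?: module K V
  for K :: "'k ring" and G :: "'g monoid" and V :: "('k, 'g, 'v) gmodule" +
  assumes act_closed: "g \<in> carrier G \<Longrightarrow> v \<in> carrier V \<Longrightarrow> act V g v \<in> carrier V"
    and act_one: "v \<in> carrier V \<Longrightarrow> act V \<one>\<^bsub>G\<^esub> v = v"
    and act_mult: "g \<in> carrier G \<Longrightarrow> h \<in> carrier G \<Longrightarrow> v \<in> carrier V \<Longrightarrow>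
      act V (g \<otimes>\<^bsub>G\<^esub> h) v = act V g (act V h v)"
    and act_add: "g \<in> carrier G \<Longrightarrow> v \<in> carrier V \<Longrightarrow> w \<in> carrier V \<Longrightarrow>
      act V g (v \<oplus>\<^bsub>V\<^esub> w) = act V g v \<oplus>\<^bsub>V\<^esub> act V g w"
    and act_smult: "g \<in> carrier G \<Longrightarrow> a \<in> carrier K \<Longrightarrow> v \<in> carrier V \<Longrightarrow>
      act V g (a \<odot>\<^bsub>V\<^esub> v) = a \<odot>\<^bsub>V\<^esub> act V g v"
    and finitely_generated: "\<exists>A. finite A \<and> A \<subseteq> carrier V \<and>
      (\<forall>N. kG_submodule K G V N \<and> A \<subseteq> N \<longrightarrow> N = carrier V)"

definition kG_hom ::
  "'k ring \<Rightarrow> 'g monoid \<Rightarrow> ('k, 'g, 'v) gmodule \<Rightarrow> ('k, 'g, 'w) gmodule \<Rightarrow> ('v \<Rightarrow> 'w) set" where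
  "kG_hom K G V W =
     {f \<in> hom (add_monoid V) (add_monoid W).
        (\<forall>a \<in> carrier K. \<forall>v \<in> carrier V. f (a \<odot>\<^bsub>V\<^esub> v) = a \<odot>\<^bsub>W\<^esub> f v) \<and>
        (\<forall>g \<in> carrier G. \<forall>v \<in> carrier V. f (act V g v) = act W g (f v))}"

definition kG_isomorphic ::
  "'k ring \<Rightarrow> 'g monoid \<Rightarrow> ('k, 'g, 'v) gmodule \<Rightarrow> ('k, 'g, 'w) gmodule \<Rightarrow> bool" where
  "kG_isomorphic K G V W \<longleftrightarrow>
     kG_module K G V \<and> kG_module K G W \<and>
     (\<exists>f \<in> kG_hom K G V W. bij_betw f (carrier V) (carrier W))"

definition kG_direct_sum ::
  "'k ring \<Rightarrow> 'g monoid \<Rightarrow> ('k, 'g, 'v) gmodule \<Rightarrow> 'v set \<Rightarrow> 'v set \<Rightarrow> bool" where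
  "kG_direct_sum K G V S T \<longleftrightarrow>
     kG_submodule K G V S \<and> kG_submodule K G V T \<and>
     S <+>\<^bsub>V\<^esub> T = carrier V \<and> S \<inter> T = {\<zero>\<^bsub>V\<^esub>}"

definition kG_summand ::
  "'k ring \<Rightarrow> 'g monoid \<Rightarrow> ('k, 'g, 'v) gmodule \<Rightarrow> 'v set \<Rightarrow> bool" where
  "kG_summand K G V S \<longleftrightarrow> (\<exists>T. kG_direct_sum K G V S T)"

definition kG_indecomposable ::
  "'k ring \<Rightarrow> 'g monoid \<Rightarrow> ('k, 'g, 'v) gmodule \<Rightarrow> bool" where
  "kG_indecomposable K G V \<longleftrightarrow>
     kG_module K G V \<and> carrier V \<noteq> {\<zero>\<^bsub>V\<^esub>} \<and>
     (\<forall>S T. kG_direct_sum K G V S T \<longrightarrow> S = {\<zero>\<^bsub>V\<^esub>} \<or> T = {\<zero>\<^bsub>V\<^esub>})"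

definition kG_simple :: "'k ring \<Rightarrow> 'g monoid \<Rightarrow> ('k, 'g, 'v) gmodule \<Rightarrow> bool" where
  "kG_simple K G V \<longleftrightarrow>
     kG_module K G V \<and> carrier V \<noteq> {\<zero>\<^bsub>V\<^esub>} \<and>
     (\<forall>N. kG_submodule K G V N \<longrightarrow> N = {\<zero>\<^bsub>V\<^esub>} \<or> N = carrier V)"

text \<open>The socle is the sum, i.e. the least upper bound, of the simple submodules.\<close>

definition kG_socle :: "'k ring \<Rightarrow> 'g monoid \<Rightarrow> ('k, 'g, 'v) gmodule \<Rightarrow> 'v set" where
  "kG_socle K G V =
     \<Inter> {N. kG_submodule K G V N \<and>
        (\<forall>S. kG_submodule K G V S \<and> kG_simple K G (V\<lparr>carrier := S\<rparr>) \<longrightarrow> S \<subseteq> N)}"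

definition trivial_gmodule :: "'k ring \<Rightarrow> ('k, 'g, 'k) gmodule" where
  "trivial_gmodule K =
     \<lparr>carrier = carrier K, monoid.mult = monoid.mult K, one = \<one>\<^bsub>K\<^esub>, ring.zero = \<zero>\<^bsub>K\<^esub>, add = add K,
      smult = monoid.mult K, act = \<lambda>g v. v\<rparr>"

definition trivial_in_socle :: "'k ring \<Rightarrow> 'g monoid \<Rightarrow> ('k, 'g, 'v) gmodule \<Rightarrow> bool" where
  "trivial_in_socle K G V \<longleftrightarrow>
     (\<exists>N. kG_submodule K G V N \<and> N \<subseteq> kG_socle K G V \<and>
        kG_isomorphic K G (V\<lparr>carrier := N\<rparr>) (trivial_gmodule K))"


section \<open>Induction and Scott modules\<close>

text \<open>
  For finite \<open>G\<close>, the tensor product over \<open>K\<close> of the group algebra with a vector space \<open>V\<close>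
  consists of the functions from \<open>G\<close> to \<open>V\<close>; the pure tensor \<open>x \<otimes> v\<close>, for \<open>x\<close> in \<open>G\<close>, is the
  function supported at \<open>x\<close> with value \<open>v\<close>, and \<open>G\<close> acts by \<open>g(x \<otimes> v) = gx \<otimes> v\<close>.
\<close>

definition group_algebra_tensor ::
  "'g monoid \<Rightarrow> ('k, 'g, 'v) gmodule \<Rightarrow> ('k, 'g, 'g \<Rightarrow> 'v) gmodule" where
  "group_algebra_tensor G V =
     \<lparr>carrier = carrier G \<rightarrow>\<^sub>E carrier V, monoid.mult = undefined, one = undefined,
      ring.zero = (\<lambda>x \<in> carrier G. \<zero>\<^bsub>V\<^esub>),
      add = (\<lambda>f f'. \<lambda>x \<in> carrier G. f x \<oplus>\<^bsub>V\<^esub> f' x),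
      smult = (\<lambda>a f. \<lambda>x \<in> carrier G. a \<odot>\<^bsub>V\<^esub> f x),
      act = (\<lambda>g f. \<lambda>x \<in> carrier G. f (inv\<^bsub>G\<^esub> g \<otimes>\<^bsub>G\<^esub> x))\<rparr>"

definition pure_tensor :: "'g monoid \<Rightarrow> ('k, 'g, 'v) gmodule \<Rightarrow> 'g \<Rightarrow> 'v \<Rightarrow> 'g \<Rightarrow> 'v" where
  "pure_tensor G V x v = (\<lambda>y \<in> carrier G. if y = x then v else \<zero>\<^bsub>V\<^esub>)"

text \<open>The subspace spanned by the elements \<open>xh \<otimes> v - x \<otimes> hv\<close> with \<open>h\<close> in \<open>H\<close>.\<close>

definition balancing_subspace ::
  "'k ring \<Rightarrow> 'g monoid \<Rightarrow> 'g set \<Rightarrow> ('k, 'g, 'v) gmodule \<Rightarrow> ('g \<Rightarrow> 'v) set" where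
  "balancing_subspace K G H V =
     \<Inter> {N. submodule N K (group_algebra_tensor G V) \<and>
        (\<forall>x \<in> carrier G. \<forall>h\<in>H. \<forall>v \<in> carrier V.
           pure_tensor G V (x \<otimes>\<^bsub>G\<^esub> h) v
             \<ominus>\<^bsub>group_algebra_tensor G V\<^esub> pure_tensor G V x (act V h v) \<in> N)}"

definition gmodule_quotient ::
  "('k, 'g, 'v) gmodule \<Rightarrow> 'v set \<Rightarrow> ('k, 'g, 'v set) gmodule" where
  "gmodule_quotient V N =
     \<lparr>carrier = a_rcosets\<^bsub>V\<^esub> N, monoid.mult = undefined, one = undefined,
      ring.zero = N, add = set_add V,
      smult = (\<lambda>a C. N <+>\<^bsub>V\<^esub> (\<lambda>v. a \<odot>\<^bsub>V\<^esub> v) ` C),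
      act = (\<lambda>g C. N <+>\<^bsub>V\<^esub> act V g ` C)\<rparr>"

text \<open>
  For a subgroup \<open>H\<close> of a finite group \<open>G\<close> and a module \<open>V\<close> over \<open>KH\<close>, this is the tensor product
  of \<open>KG\<close> with \<open>V\<close> over \<open>KH\<close>.
\<close>

definition induced_module ::
  "'k ring \<Rightarrow> 'g monoid \<Rightarrow> 'g set \<Rightarrow> ('k, 'g, 'v) gmodule \<Rightarrow> ('k, 'g, ('g \<Rightarrow> 'v) set) gmodule" where
  "induced_module K G H V =
     gmodule_quotient (group_algebra_tensor G V) (balancing_subspace K G H V)"

text \<open>
  \<open>Sc(G,H)\<close> is well defined only up to isomorphism; the following is an arbitrary choice of a
  direct summand with the defining properties.
\<close>

definition scott_module ::
  "'k ring \<Rightarrow> 'g monoid \<Rightarrow> 'g set \<Rightarrow> ('k, 'g, ('g \<Rightarrow> 'k) set) gmodule" where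
  "scott_module K G H =
     (let I = induced_module K G H (trivial_gmodule K)
      in I\<lparr>carrier := SOME S. kG_summand K G I S \<and>
             kG_indecomposable K G (I\<lparr>carrier := S\<rparr>) \<and>
             trivial_in_socle K G (I\<lparr>carrier := S\<rparr>)\<rparr>)"

end

theory Submission
  imports Defs
begin

text \<open>
  Write \<open>W\<close> for the module induced from \<open>\<iota>M\<close> to \<open>G\<close>, that is, the permutation module on the cosets of
  \<open>\<iota>M\<close>. Since \<open>P\<close> is a Sylow subgroup of \<open>M\<close>, averaging over the cosets of \<open>P\<close> in \<open>M\<close> makes \<open>W\<close> a
  direct summand of the module \<open>I\<close> induced from \<open>\<iota>P\<close>. The fixed vectors of \<open>G\<close> in \<open>I\<close> form a line,
  which lies in \<open>W\<close> and in every summand that has the trivial module in its socle. Hence the theorem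
  follows once \<open>W\<close> is rigid: every endomorphism of \<open>W\<close> that fixes the fixed line pointwise is
  bijective. Rigidity shows that \<open>W\<close> is indecomposable, and that for any other candidate \<open>S\<close> the
  projections between \<open>S\<close> and \<open>W\<close> are isomorphisms; this is the content of the locale
  \<open>rigid_retract\<close>.

  Rigidity comes from the normal \<open>p\<close>-subgroup \<open>B\<close> of \<open>G\<close> of those bijections that map every coset
  \<open>mP\<close> to itself. Its intersection with \<open>\<iota>M\<close> is the image of \<open>Q = O\<^sub>p(M)\<close>, the intersection of the
  conjugates of \<open>P\<close>. For an endomorphism \<open>\<phi>\<close> the value of \<open>\<phi>(f)\<close> at \<open>1\<close> is a sum over the cosets \<open>A\<close>
  of \<open>M\<close> of terms \<open>f(A) d(A)\<close>, where \<open>d\<close> is invariant under left multiplication by \<open>M\<close>. If \<open>f\<close> is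
  fixed by \<open>B\<close>, then \<open>Q\<close> permutes these terms, and as \<open>Q\<close> is a \<open>p\<close>-group only the cosets fixed by \<open>Q\<close>
  contribute. All of them lie in the \<open>B\<close>-orbit of the coset \<open>M\<close>, so \<open>f\<close> has the value \<open>f(1)\<close> on them.
  Comparison with the constant function \<open>1\<close>, which \<open>\<phi>\<close> fixes, shows that \<open>\<phi>\<close> is the identity on the
  vectors fixed by \<open>B\<close> (\<open>endomorphism_fixes_B_fixed\<close>). As a nonzero kernel would contain a nonzero
  vector fixed by the \<open>p\<close>-group \<open>B\<close>, \<open>\<phi>\<close> is injective, hence bijective.

  That the cosets fixed by \<open>Q\<close> lie in one \<open>B\<close>-orbit is where the constraint on \<open>M\<close> enters
  (\<open>base_controls\<close>). If \<open>g\<close> conjugates \<open>Q\<close> into \<open>M\<close>, then up to left multiplication by an element of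
  \<open>M\<close> it commutes with left multiplication by \<open>Q\<close>. As \<open>g\<close> also commutes with right multiplication by
  \<open>P\<close>, and thus by \<open>Q\<close>, each \<open>g(x) x\<^sup>-\<^sup>1\<close> centralizes \<open>Q\<close>, hence lies in \<open>Q\<close>, and \<open>g(x)\<close> is in \<open>xP\<close>.
\<close>

section \<open>Finite p-groups\<close>

text \<open>
  A prime \<open>q\<close> dividing the order yields, by Sylow's theorem, an element \<open>x \<noteq> 1\<close> of \<open>q\<close>-power order;
  this is impossible for \<open>q \<noteq> p\<close>.
\<close>
lemma (in group) order_is_prime_power:
  assumes fin: "finite (carrier G)" and p: "Factorial_Ring.prime (p::nat)"
    and pow: "\<And>x. x \<in> carrier G \<Longrightarrow> x [^] (p ^ a) = \<one>"
  shows "\<exists>n. order G = p ^ n"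
proof -
  have ord0: "order G > 0" using fin order_gt_0_iff_finite by blast
  have *: "q = p" if q: "Factorial_Ring.prime q" and qd: "q dvd order G" for q
  proof (rule ccontr)
    assume "q \<noteq> p"
    define m where "m = multiplicity q (order G)"
    have "order G = q ^ m * (order G div q ^ m)"
      unfolding m_def by (simp add: multiplicity_dvd)
    then obtain H where H: "subgroup H G" "card H = q ^ m"
      using sylow_thm[OF q is_group _ fin] by blast
    have "m > 0" unfolding m_def using q qd ord0 by (simp add: prime_multiplicity_gt_zero_iff)
    then have "card H > 1" using H(2) prime_gt_1_nat[OF q] by (metis one_less_power)
    then have "\<not> H \<subseteq> {\<one>}" using card_mono[of "{\<one>}" H] by auto
    then obtain x where x: "x \<in> H" "x \<noteq> \<one>" by blast
    have xG: "x \<in> carrier G" using H(1) x(1) by (rule subgroup.mem_carrier)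
    have "group (G\<lparr>carrier := H\<rparr>)" using H(1) subgroup.subgroup_is_group is_group by blast
    then have "x [^]\<^bsub>G\<lparr>carrier := H\<rparr>\<^esub> order (G\<lparr>carrier := H\<rparr>) = \<one>\<^bsub>G\<lparr>carrier := H\<rparr>\<^esub>"
      using group.pow_order_eq_1 x(1) by fastforce
    then have "x [^] (q ^ m) = \<one>"
      by (simp add: order_def H(2) flip: nat_pow_consistent)
    then have "ord x dvd q ^ m" "ord x dvd p ^ a" using pow_eq_id[OF xG] pow[OF xG] by auto
    moreover have "coprime (q ^ m) (p ^ a)" using primes_coprime[OF q p \<open>q \<noteq> p\<close>] by simp
    ultimately have "ord x = 1" by (metis coprime_common_divisor_nat)
    then show False using ord_eq_1[OF xG] x(2) by simp
  qed
  obtain k where k: "order G = p ^ multiplicity p (order G) * k" "\<not> p dvd k"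
    using multiplicity_decompose'[of "order G" p] ord0 p by (metis less_not_refl not_prime_unit)
  have "k = 1"
  proof (rule ccontr)
    assume "k \<noteq> 1"
    then obtain q where "Factorial_Ring.prime q" "q dvd k" using prime_factor_nat by blast
    then show False using k *[of q] by (metis dvd_mult)
  qed
  then have "order G = p ^ multiplicity p (order G)" using k(1) by simp
  then show ?thesis by blast
qed

text \<open>Adding a generator \<open>x\<close> to \<open>S\<close> multiplies the generated subgroup by the finitely many powers of \<open>x\<close>.\<close>
lemma (in comm_group) finite_generate:
  assumes "finite S" "S \<subseteq> carrier G" and p: "p > (0::nat)" and "\<And>x. x \<in> S \<Longrightarrow> x [^] p = \<one>"
  shows "finite (generate G S)"
  using assms(1,2,4)
proof (induction rule: finite_induct)
  case empty
  then show ?case by (simp add: generate_empty)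
next
  case (insert x S)
  have x: "x \<in> carrier G" "x [^] p = \<one>" and S: "S \<subseteq> carrier G" using insert.prems by auto
  have gS: "generate G S \<subseteq> carrier G" using S generate_incl by blast
  have gsub: "subgroup (generate G S) G" using S generate_is_subgroup by blast
  let ?A = "(\<lambda>(i, y). x [^] (i::nat) \<otimes> y) ` ({..<p} \<times> generate G S)"
  have mem: "x [^] (i::nat) \<otimes> y \<in> ?A" if "y \<in> generate G S" for i y
  proof -
    have "x [^] i = x [^] (i mod p)"
    proof -
      have "x [^] i = x [^] (p * (i div p) + i mod p)" by simp
      also have "\<dots> = (x [^] p) [^] (i div p) \<otimes> x [^] (i mod p)"
        using x by (simp only: nat_pow_mult[symmetric] nat_pow_pow[symmetric] nat_pow_closed)
      finally show ?thesis using x by simp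
    qed
    then show ?thesis using that p by (auto intro!: image_eqI[of _ _ "(i mod p, y)"])
  qed
  have gen1: "\<one> \<in> generate G S" by (rule generate.one)
  have xA: "x [^] (i::nat) \<in> ?A" for i using mem[OF gen1, of i] x by simp
  have x1: "x \<in> ?A" using xA[of 1] x(1) by (simp only: nat_pow_eone)
  have yA: "y \<in> ?A" if "y \<in> generate G S" for y 
  proof -
    have "y \<in> carrier G" using that gS by blast
    then show ?thesis using mem[OF that, of 0] by simp
  qed
  have "z \<in> ?A" if "z \<in> generate G (insert x S)" for z
    using that
  proof (induction rule: generate.induct)
    case one
    then show ?case using yA gen1 by blast
  next
    case (incl h)
    then show ?case using x1 yA[OF generate.incl, of h] by blast
  next
    case (inv h)
    have "inv x = x [^] (p - 1)"
    proof (rule inv_equality)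
      show "x [^] (p - 1) \<otimes> x = \<one>"
        using x p nat_pow_Suc[of x "p - 1"] by simp
    qed (use x in auto)
    then show ?case using inv xA[of "p - 1"] yA[OF generate.inv, of h] by (metis insert_iff)
  next
    case (eng h1 h2)
    then obtain i y j z where h: "h1 = x [^] (i::nat) \<otimes> y" "h2 = x [^] (j::nat) \<otimes> z"
      "y \<in> generate G S" "z \<in> generate G S" by auto
    then have yz: "y \<in> carrier G" "z \<in> carrier G" using gS by auto
    have "h1 \<otimes> h2 = x [^] (i + j) \<otimes> (y \<otimes> z)"
      using x yz by (simp add: h(1,2) m_ac flip: nat_pow_mult)
    then show ?case using mem[OF generate.eng[OF h(3,4)], of "i + j"] by simp
  qed
  then have "generate G (insert x S) \<subseteq> ?A" by blast
  moreover have "finite ?A" using insert by auto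
  ultimately show ?case using finite_subset by blast
qed

locale prime_char_field = field K for p :: nat and K :: "'k ring" (structure) +
  assumes prime: "Factorial_Ring.prime p" and char: "ring_char K = p"
begin

lemma add_pow_one_eq_zero_iff:
  fixes n :: nat
  shows "[n] \<cdot>\<^bsub>K\<^esub> \<one> = \<zero> \<longleftrightarrow> p dvd n"
proof -
  let ?P = "\<lambda>n::nat. 0 < n \<and> [n] \<cdot>\<^bsub>K\<^esub> \<one> = \<zero>"
  have "p \<noteq> 0" using prime by auto
  then have ex: "\<exists>n. ?P n" using char by (auto simp: ring_char_def split: if_splits)
  then have p: "p = (LEAST n. ?P n)" using char by (simp add: ring_char_def)
  have p0: "[p] \<cdot>\<^bsub>K\<^esub> \<one> = \<zero>" using LeastI_ex[OF ex] p by simp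
  have least: "\<not> ?P m" if "m < p" for m using that p not_less_Least by auto
  have mult: "[(p * k)] \<cdot>\<^bsub>K\<^esub> \<one> = \<zero>" for k :: nat
    using p0 by (metis add.nat_pow_one add.nat_pow_pow one_closed)
  have "[n] \<cdot>\<^bsub>K\<^esub> \<one> = [(p * (n div p) + n mod p)] \<cdot>\<^bsub>K\<^esub> \<one>" by simp
  also have "\<dots> = [(p * (n div p))] \<cdot>\<^bsub>K\<^esub> \<one> \<oplus> [(n mod p)] \<cdot>\<^bsub>K\<^esub> \<one>"
    by (simp only: add.nat_pow_mult[symmetric] one_closed)
  also have "\<dots> = [(n mod p)] \<cdot>\<^bsub>K\<^esub> \<one>" using mult by simp
  finally have *: "[n] \<cdot>\<^bsub>K\<^esub> \<one> = [(n mod p)] \<cdot>\<^bsub>K\<^esub> \<one>" .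
  have "[(n mod p)] \<cdot>\<^bsub>K\<^esub> \<one> = \<zero> \<longleftrightarrow> n mod p = 0"
    using least[of "n mod p"] \<open>p \<noteq> 0\<close> by auto
  then show ?thesis using * by (simp add: dvd_eq_mod_eq_0)
qed

lemma finsum_const:
  assumes "finite A" "\<And>x. x \<in> A \<Longrightarrow> h x = c" "c \<in> carrier K"
  shows "finsum K h A = [(card A)] \<cdot>\<^bsub>K\<^esub> \<one> \<otimes> c"
proof -
  have "finsum K h A = finsum K (\<lambda>_. c) A" using assms by (intro add.finprod_cong') auto
  also have "\<dots> = [(card A)] \<cdot>\<^bsub>K\<^esub> c" using assms by (intro add.finprod_const) auto
  finally show ?thesis using assms(3) by (simp add: add_pow_ldistr)
qed

text \<open>
  An orbit that is not a single point has length divisible by \<open>p\<close>. As \<open>h\<close> is constant on it, its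
  contribution vanishes in characteristic \<open>p\<close>. The constant function \<open>1\<close> gives the usual congruence
  for the number of fixed points.
\<close>
lemma finsum_fixed_points:
  assumes Q: "group Q" "order Q = p ^ n" and E: "finite E"
    and cl: "\<And>g x. g \<in> carrier Q \<Longrightarrow> x \<in> E \<Longrightarrow> a g x \<in> E"
    and one: "\<And>x. x \<in> E \<Longrightarrow> a \<one>\<^bsub>Q\<^esub> x = x"
    and mul: "\<And>g h x. g \<in> carrier Q \<Longrightarrow> h \<in> carrier Q \<Longrightarrow> x \<in> E \<Longrightarrow> a (g \<otimes>\<^bsub>Q\<^esub> h) x = a g (a h x)"
    and h: "\<And>x. x \<in> E \<Longrightarrow> h x \<in> carrier K"
    and inv: "\<And>g x. g \<in> carrier Q \<Longrightarrow> x \<in> E \<Longrightarrow> h (a g x) = h x"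
  shows "finsum K h E = finsum K h {x \<in> E. \<forall>g \<in> carrier Q. a g x = x}"
  using E cl one mul h inv
proof (induction E rule: finite_psubset_induct)
  case (psubset E)
  interpret Q: group Q by fact
  have finQ: "finite (carrier Q)"
    using Q(2) prime Q.order_gt_0_iff_finite by (simp add: prime_gt_0_nat)
  let ?Fix = "\<lambda>E. {x \<in> E. \<forall>g \<in> carrier Q. a g x = x}"
  show ?case
  proof (cases "?Fix E = E")
    case True then show ?thesis by simp
  next
    case False
    then obtain x g0 where x: "x \<in> E" "g0 \<in> carrier Q" "a g0 x \<noteq> x" by blast
    define Orb where "Orb = (\<lambda>g. a g x) ` carrier Q"
    have OX: "Orb \<subseteq> E" using psubset.prems(1) x by (auto simp: Orb_def)
    have xO: "x \<in> Orb" using psubset.prems(2)[OF x(1)] by (force simp: Orb_def)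
    have Ocl: "a g y \<in> Orb" if gy: "g \<in> carrier Q" "y \<in> Orb" for g y
    proof -
      obtain h where h: "h \<in> carrier Q" "y = a h x" using gy(2) by (auto simp: Orb_def)
      then have "a g y = a (g \<otimes>\<^bsub>Q\<^esub> h) x" using psubset.prems(3)[OF gy(1) h(1) x(1)] by simp
      then show ?thesis unfolding Orb_def using gy(1) h(1) by blast
    qed
    have cancel: "a (inv\<^bsub>Q\<^esub> g) (a g y) = y" if "g \<in> carrier Q" "y \<in> E" for g y
      using psubset.prems(3)[of "inv\<^bsub>Q\<^esub> g" g y] psubset.prems(2)[of y] that by simp
    have cancel': "a g (a (inv\<^bsub>Q\<^esub> g) y) = y" if "g \<in> carrier Q" "y \<in> E" for g y
      using psubset.prems(3)[of g "inv\<^bsub>Q\<^esub> g" y] psubset.prems(2)[of y] that by simp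
    have Bij: "restrict (a g) E \<in> Bij E" if g: "g \<in> carrier Q" for g
    proof -
      have "bij_betw (a g) E E"
        by (rule bij_betwI[where g = "a (inv\<^bsub>Q\<^esub> g)"])
          (use g cancel cancel' psubset.prems(1) in auto)
      then show ?thesis by (simp add: Bij_def bij_betw_restrict_eq)
    qed
    \<comment> \<open>orbit-stabiliser: the length of the orbit is a power of \<open>p\<close>, and not 1\<close>
    have act: "group_action Q E (\<lambda>g. restrict (a g) E)"
      unfolding group_action_def group_hom_def group_hom_axioms_def
    proof (intro conjI Q.is_group group_BijGroup homI)
      fix g assume g: "g \<in> carrier Q"
      then show "restrict (a g) E \<in> carrier (BijGroup E)" using Bij by (simp add: BijGroup_def)
    next
      fix g h assume gh: "g \<in> carrier Q" "h \<in> carrier Q"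
      have "restrict (a (g \<otimes>\<^bsub>Q\<^esub> h)) E = compose E (restrict (a g) E) (restrict (a h) E)"
        by (rule ext) (simp add: compose_def restrict_def psubset.prems(1)[OF gh(2)] psubset.prems(3)[OF gh])
      then show "restrict (a (g \<otimes>\<^bsub>Q\<^esub> h)) E = restrict (a g) E \<otimes>\<^bsub>BijGroup E\<^esub> restrict (a h) E"
        using gh Bij by (simp add: BijGroup_def)
    qed
    have "orbit Q (\<lambda>g. restrict (a g) E) x = Orb" using x(1) by (auto simp: orbit_def Orb_def)
    then have "card Orb dvd p ^ n"
      using group_action.orbit_stabilizer_theorem[OF act x(1)] Q(2) by (metis dvd_triv_left)
    then obtain k where k: "card Orb = p ^ k" using prime divides_primepow_nat by blast
    have finO: "finite Orb" using finQ by (simp add: Orb_def)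
    have "card Orb \<noteq> 1" using xO x(3) Ocl[OF x(2) xO] by (auto simp: card_1_singleton_iff)
    then have "p dvd card Orb" using k by (cases k) auto
    moreover have "finsum K h Orb = [(card Orb)] \<cdot>\<^bsub>K\<^esub> \<one> \<otimes> h x"
    proof (rule finsum_const[OF finO _ psubset.prems(4)[OF x(1)]])
      fix y assume "y \<in> Orb"
      then obtain g where "g \<in> carrier Q" "y = a g x" by (auto simp: Orb_def)
      then show "h y = h x" using psubset.prems(5) x(1) by simp
    qed
    moreover have "[(card Orb)] \<cdot>\<^bsub>K\<^esub> \<one> = \<zero>" if "p dvd card Orb"
      using add_pow_one_eq_zero_iff that by blast
    ultimately have zero: "finsum K h Orb = \<zero>"
      using psubset.prems(4)[OF x(1)] by (metis l_null)
    have Ccl: "a g y \<in> E - Orb" if gy: "g \<in> carrier Q" "y \<in> E - Orb" for g y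
    proof -
      have "y \<in> Orb" if "a g y \<in> Orb"
        using Ocl[of "inv\<^bsub>Q\<^esub> g" "a g y"] cancel[of g y] that gy by simp
      then show ?thesis using gy psubset.prems(1)[of g y] by blast
    qed
    have IH: "finsum K h (E - Orb) = finsum K h (?Fix (E - Orb))"
    proof (rule psubset.IH)
      show "E - Orb \<subset> E" using xO x(1) by blast
    qed (use Ccl psubset.prems(2-5) in \<open>simp_all\<close>)
    have "\<exists>g \<in> carrier Q. a g y \<noteq> y" if y: "y \<in> Orb" for y
    proof (rule ccontr)
      assume fixed: "\<not> ?thesis"
      obtain g where g: "g \<in> carrier Q" "y = a g x" using y by (auto simp: Orb_def)
      then have "y = x" using fixed cancel[OF g(1) x(1)] g by force
      then show False using fixed x by blast
    qed
    then have "?Fix E = ?Fix (E - Orb)" by auto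
    moreover have "finsum K h E = finsum K h Orb \<oplus> finsum K h (E - Orb)"
    proof -
      have "finsum K h (Orb \<union> (E - Orb)) = finsum K h Orb \<oplus> finsum K h (E - Orb)"
      proof (rule finsum_Un_disjoint[OF finO])
        show "finite (E - Orb)" using psubset.hyps by simp
      qed (use OX psubset.prems(4) in blast)+
      moreover have "Orb \<union> (E - Orb) = E" using OX by blast
      ultimately show ?thesis by simp
    qed
    moreover have "finsum K h (E - Orb) \<in> carrier K" using psubset.prems(4) by (intro finsum_closed) blast
    ultimately show ?thesis using zero IH by simp
  qed
qed

lemma card_fixed_points:
  assumes Q: "group Q" "order Q = p ^ n" and E: "finite E"
    and cl: "\<And>g x. g \<in> carrier Q \<Longrightarrow> x \<in> E \<Longrightarrow> a g x \<in> E"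
    and one: "\<And>x. x \<in> E \<Longrightarrow> a \<one>\<^bsub>Q\<^esub> x = x"
    and mul: "\<And>g h x. g \<in> carrier Q \<Longrightarrow> h \<in> carrier Q \<Longrightarrow> x \<in> E \<Longrightarrow> a (g \<otimes>\<^bsub>Q\<^esub> h) x = a g (a h x)"
  shows "p dvd card E \<longleftrightarrow> p dvd card {x \<in> E. \<forall>g \<in> carrier Q. a g x = x}"
proof -
  let ?F = "{x \<in> E. \<forall>g \<in> carrier Q. a g x = x}"
  have "finsum K (\<lambda>_. \<one>) E = finsum K (\<lambda>_. \<one>) ?F"
  proof (rule finsum_fixed_points[where h = "\<lambda>_. \<one>" and a = a, OF Q E])
    show "a g x \<in> E" if "g \<in> carrier Q" "x \<in> E" for g x using cl that .
    show "a \<one>\<^bsub>Q\<^esub> x = x" if "x \<in> E" for x using one that .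
    show "a (g \<otimes>\<^bsub>Q\<^esub> h) x = a g (a h x)" if "g \<in> carrier Q" "h \<in> carrier Q" "x \<in> E" for g h x
      using mul that .
    show "\<one> \<in> carrier K" by (rule one_closed)
    show "\<one> = \<one>" by (rule refl)
  qed
  moreover have "finsum K (\<lambda>_. \<one>) E = [(card E)] \<cdot>\<^bsub>K\<^esub> \<one> \<otimes> \<one>"
    by (rule finsum_const[OF E refl one_closed])
  moreover have "finsum K (\<lambda>_. \<one>) ?F = [(card ?F)] \<cdot>\<^bsub>K\<^esub> \<one> \<otimes> \<one>"
    by (rule finsum_const[OF _ refl one_closed]) (simp add: E)
  ultimately have "[(card E)] \<cdot>\<^bsub>K\<^esub> \<one> = [(card ?F)] \<cdot>\<^bsub>K\<^esub> \<one>" by simp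
  then show ?thesis using add_pow_one_eq_zero_iff[of "card E"] add_pow_one_eq_zero_iff[of "card ?F"]
    by simp
qed

end

section \<open>Linear systems\<close>

text \<open>
  A homogeneous system with more unknowns than equations has a nontrivial solution, by Gaussian
  elimination. It takes the place of dimension theory when injective endomorphisms of permutation
  modules are shown to be surjective.
\<close>
lemma (in field) underdetermined_system:
  assumes "finite A" "finite B" "card A < card B"
    and "\<And>x y. x \<in> A \<Longrightarrow> y \<in> B \<Longrightarrow> c x y \<in> carrier R"
  shows "\<exists>v. (\<forall>y\<in>B. v y \<in> carrier R) \<and> (\<exists>y\<in>B. v y \<noteq> \<zero>) \<and>
    (\<forall>x\<in>A. finsum R (\<lambda>y. c x y \<otimes> v y) B = \<zero>)"
  using assms
proof (induction A arbitrary: B c rule: finite_induct)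
  case empty
  then obtain y where "y \<in> B" by fastforce
  then show ?case by (intro exI[of _ "\<lambda>_. \<one>"]) auto
next
  case (insert x A)
  note cc = insert.prems(3)
  show ?case
  proof (cases "\<forall>y\<in>B. c x y = \<zero>")
    case True
    from insert.IH[OF insert.prems(1), of c] insert.prems insert.hyps
    obtain v where v: "\<forall>y\<in>B. v y \<in> carrier R" "\<exists>y\<in>B. v y \<noteq> \<zero>"
      "\<forall>x\<in>A. finsum R (\<lambda>y. c x y \<otimes> v y) B = \<zero>" by auto
    have "finsum R (\<lambda>y. c x y \<otimes> v y) B = finsum R (\<lambda>_. \<zero>) B"
      by (intro finsum_cong') (use True v in auto)
    then show ?thesis using v by (intro exI[of _ v]) auto
  next
    case False
    then obtain z where z: "z \<in> B" "c x z \<noteq> \<zero>" by blast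
    define u where "u = inv (c x z)"
    have cz: "c x z \<in> carrier R" using cc z by blast
    have u: "u \<in> carrier R" "c x z \<otimes> u = \<one>"
      unfolding u_def using cz z(2) field_Units by auto
    let ?B = "B - {z}"
    have finB: "finite ?B" using insert.prems by simp
    have cB: "card A < card ?B" using insert.prems insert.hyps z by simp
    let ?c = "\<lambda>x' y. c x' y \<ominus> c x' z \<otimes> u \<otimes> c x y"
    have ccl: "?c x' y \<in> carrier R" if "x' \<in> A" "y \<in> ?B" for x' y
      using that cc u z by auto
    obtain v where v: "\<forall>y\<in>?B. v y \<in> carrier R" "\<exists>y\<in>?B. v y \<noteq> \<zero>"
      "\<forall>x\<in>A. finsum R (\<lambda>y. ?c x y \<otimes> v y) ?B = \<zero>"
      using insert.IH[OF finB cB, of ?c] ccl by blast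
    define s where "s = finsum R (\<lambda>y. c x y \<otimes> v y) ?B"
    have s: "s \<in> carrier R" unfolding s_def by (intro finsum_closed) (use cc v in auto)
    define w where "w = v(z := \<ominus> (u \<otimes> s))"
    have split: "finsum R (\<lambda>y. c x' y \<otimes> w y) B =
        c x' z \<otimes> \<ominus> (u \<otimes> s) \<oplus> finsum R (\<lambda>y. c x' y \<otimes> v y) ?B" if "x' \<in> insert x A" for x'
    proof -
      have "finsum R (\<lambda>y. c x' y \<otimes> w y) (insert z ?B) =
          c x' z \<otimes> w z \<oplus> finsum R (\<lambda>y. c x' y \<otimes> w y) ?B"
        by (intro finsum_insert finB) (use cc v u s that z in \<open>auto simp: w_def\<close>)
      moreover have "finsum R (\<lambda>y. c x' y \<otimes> w y) ?B = finsum R (\<lambda>y. c x' y \<otimes> v y) ?B"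
        by (intro finsum_cong') (use cc v that in \<open>auto simp: w_def\<close>)
      moreover have "insert z ?B = B" using z by auto
      ultimately show ?thesis by (simp add: w_def)
    qed
    have "finsum R (\<lambda>y. c x' y \<otimes> w y) B = \<zero>" if x': "x' \<in> insert x A" for x'
    proof (cases "x' = x")
      case True
      have "c x z \<otimes> \<ominus> (u \<otimes> s) = \<ominus> s" using cz u s by (simp add: r_minus m_assoc[symmetric])
      then show ?thesis using split[OF x'] True s by (simp add: s_def[symmetric] l_neg)
    next
      case False
      then have x'A: "x' \<in> A" using x' by blast
      have cxz: "c x' z \<in> carrier R" using cc z x' by blast
      define q where "q = c x' z \<otimes> u"
      have q: "q \<in> carrier R" using cxz u by (simp add: q_def)
      define r where "r = finsum R (\<lambda>y. c x' y \<otimes> v y) ?B"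
      have r: "r \<in> carrier R" unfolding r_def by (intro finsum_closed) (use cc v x' in auto)
      have "\<zero> = finsum R (\<lambda>y. ?c x' y \<otimes> v y) ?B" using v(3) x'A by simp
      also have "\<dots> = finsum R (\<lambda>y. c x' y \<otimes> v y \<oplus> (\<ominus> q) \<otimes> (c x y \<otimes> v y)) ?B"
      proof (rule finsum_cong'[OF refl])
        show "(\<lambda>y. c x' y \<otimes> v y \<oplus> (\<ominus> q) \<otimes> (c x y \<otimes> v y)) \<in> ?B \<rightarrow> carrier R"
          using cc v x' q by auto
        fix y assume y: "y \<in> ?B"
        have "c x y \<in> carrier R" "c x' y \<in> carrier R" "v y \<in> carrier R" using y cc x' v by auto
        then show "?c x' y \<otimes> v y = c x' y \<otimes> v y \<oplus> (\<ominus> q) \<otimes> (c x y \<otimes> v y)"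
          using q unfolding q_def[symmetric] by algebra
      qed
      also have "\<dots> = r \<oplus> finsum R (\<lambda>y. (\<ominus> q) \<otimes> (c x y \<otimes> v y)) ?B"
        unfolding r_def by (intro finsum_addf) (use cc v x' q in auto)
      also have "finsum R (\<lambda>y. (\<ominus> q) \<otimes> (c x y \<otimes> v y)) ?B = (\<ominus> q) \<otimes> s"
        unfolding s_def by (intro finsum_rdistr[symmetric]) (use cc v q finB in auto)
      finally have "r \<oplus> (\<ominus> q) \<otimes> s = \<zero>" by simp
      moreover have "c x' z \<otimes> \<ominus> (u \<otimes> s) = (\<ominus> q) \<otimes> s"
        using cxz u s by (simp add: q_def r_minus l_minus m_assoc)
      ultimately show ?thesis using split[OF x'] r q s by (simp add: r_def[symmetric] a_comm)
    qed
    then show ?thesis using v z u s by (intro exI[of _ w]) (auto simp: w_def)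
  qed
qed

section \<open>Homomorphisms, submodules and direct summands\<close>

lemma kG_homI:
  assumes "\<And>v. v \<in> carrier V \<Longrightarrow> f v \<in> carrier W"
    and "\<And>v w. v \<in> carrier V \<Longrightarrow> w \<in> carrier V \<Longrightarrow> f (v \<oplus>\<^bsub>V\<^esub> w) = f v \<oplus>\<^bsub>W\<^esub> f w"
    and "\<And>a v. a \<in> carrier K \<Longrightarrow> v \<in> carrier V \<Longrightarrow> f (a \<odot>\<^bsub>V\<^esub> v) = a \<odot>\<^bsub>W\<^esub> f v"
    and "\<And>g v. g \<in> carrier G \<Longrightarrow> v \<in> carrier V \<Longrightarrow> f (act V g v) = act W g (f v)"
  shows "f \<in> kG_hom K G V W"
  using assms by (auto simp: kG_hom_def hom_def)

lemma kG_homE: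
  assumes "f \<in> kG_hom K G V W"
  shows "v \<in> carrier V \<Longrightarrow> f v \<in> carrier W"
    and "v \<in> carrier V \<Longrightarrow> w \<in> carrier V \<Longrightarrow> f (v \<oplus>\<^bsub>V\<^esub> w) = f v \<oplus>\<^bsub>W\<^esub> f w"
    and "a \<in> carrier K \<Longrightarrow> v \<in> carrier V \<Longrightarrow> f (a \<odot>\<^bsub>V\<^esub> v) = a \<odot>\<^bsub>W\<^esub> f v"
    and "g \<in> carrier G \<Longrightarrow> v \<in> carrier V \<Longrightarrow> f (act V g v) = act W g (f v)"
  using assms by (auto simp: kG_hom_def hom_def)

lemma kG_hom_comp:
  assumes "f \<in> kG_hom K G U V" "g \<in> kG_hom K G V W"
  shows "(\<lambda>u. g (f u)) \<in> kG_hom K G U W"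
  using kG_homE[OF assms(1)] kG_homE[OF assms(2)] by (intro kG_homI) auto

lemma kG_hom_restrict_domain:
  assumes "f \<in> kG_hom K G V W" "S \<subseteq> carrier V"
  shows "f \<in> kG_hom K G (V\<lparr>carrier := S\<rparr>) W"
  using kG_homE[OF assms(1)] assms(2) by (intro kG_homI) (simp_all add: subset_iff)

lemma kG_hom_restrict_codomain:
  assumes "f \<in> kG_hom K G V W" "\<And>v. v \<in> carrier V \<Longrightarrow> f v \<in> S"
  shows "f \<in> kG_hom K G V (W\<lparr>carrier := S\<rparr>)"
  using kG_homE[OF assms(1)] assms(2) by (intro kG_homI) simp_all

context kG_module
begin

lemma kG_submodule_iff:
  "kG_submodule K G V N \<longleftrightarrow> N \<subseteq> carrier V \<and> \<zero>\<^bsub>V\<^esub> \<in> N \<and> (\<forall>v\<in>N. \<forall>w\<in>N. v \<oplus>\<^bsub>V\<^esub> w \<in> N) \<and>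
    (\<forall>a \<in> carrier K. \<forall>v\<in>N. a \<odot>\<^bsub>V\<^esub> v \<in> N) \<and> (\<forall>g \<in> carrier G. \<forall>v\<in>N. act V g v \<in> N)"
  (is "_ \<longleftrightarrow> ?R")
proof
  assume N: "kG_submodule K G V N"
  then have s: "submodule N K V" by (simp add: kG_submodule_def)
  have "\<zero>\<^bsub>V\<^esub> \<in> N" using subgroup.one_closed[OF submodule.axioms(1)[OF s]] by simp
  then show ?R using submoduleE[OF s] N by (auto simp: kG_submodule_def)
next
  assume R: ?R
  have "\<ominus>\<^bsub>V\<^esub> v \<in> N" if "v \<in> N" for v
  proof -
    have "\<ominus>\<^bsub>V\<^esub> v = (\<ominus>\<^bsub>K\<^esub> \<one>\<^bsub>K\<^esub>) \<odot>\<^bsub>V\<^esub> v" using R that smult_l_minus[of "\<one>\<^bsub>K\<^esub>" v] by auto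
    then show ?thesis using R that by auto
  qed
  then have "submodule N K V" using R by (intro submoduleI) auto
  then show "kG_submodule K G V N" using R by (auto simp: kG_submodule_def)
qed

lemma minus_in_submodule:
  assumes "kG_submodule K G V N" "v \<in> N" shows "\<ominus>\<^bsub>V\<^esub> v \<in> N"
  using assms submoduleE(3) by (auto simp: kG_submodule_def)

lemma hom_zero:
  assumes "kG_module K G W" "f \<in> kG_hom K G V W" shows "f \<zero>\<^bsub>V\<^esub> = \<zero>\<^bsub>W\<^esub>"
proof -
  interpret W: kG_module K G W by fact
  have "f \<zero>\<^bsub>V\<^esub> = f (\<zero>\<^bsub>K\<^esub> \<odot>\<^bsub>V\<^esub> \<zero>\<^bsub>V\<^esub>)" by simp
  also have "\<dots> = \<zero>\<^bsub>K\<^esub> \<odot>\<^bsub>W\<^esub> f \<zero>\<^bsub>V\<^esub>" by (rule kG_homE(3)[OF assms(2)]) simp_all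
  also have "\<dots> = \<zero>\<^bsub>W\<^esub>" using kG_homE(1)[OF assms(2)] by simp
  finally show ?thesis .
qed

lemma minus_eq_zero [simp]:
  assumes "v \<in> carrier V" "w \<in> carrier V"
  shows "v \<ominus>\<^bsub>V\<^esub> w = \<zero>\<^bsub>V\<^esub> \<longleftrightarrow> v = w"
proof
  assume "v \<ominus>\<^bsub>V\<^esub> w = \<zero>\<^bsub>V\<^esub>"
  then have "\<ominus>\<^bsub>V\<^esub> (\<ominus>\<^bsub>V\<^esub> w) = v" using assms by (intro M.minus_equality) (auto simp: M.minus_eq)
  then show "v = w" using assms by simp
qed (use assms in \<open>simp add: M.minus_eq M.r_neg\<close>)

lemma hom_minus:
  assumes "kG_module K G W" "f \<in> kG_hom K G V W" "v \<in> carrier V" "w \<in> carrier V"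
  shows "f (v \<ominus>\<^bsub>V\<^esub> w) = f v \<ominus>\<^bsub>W\<^esub> f w"
proof -
  interpret W: kG_module K G W by fact
  note f = kG_homE[OF assms(2)]
  have "f ((\<ominus>\<^bsub>K\<^esub> \<one>\<^bsub>K\<^esub>) \<odot>\<^bsub>V\<^esub> w) = (\<ominus>\<^bsub>K\<^esub> \<one>\<^bsub>K\<^esub>) \<odot>\<^bsub>W\<^esub> f w" using f(3) assms by simp
  then have "f (\<ominus>\<^bsub>V\<^esub> w) = \<ominus>\<^bsub>W\<^esub> f w"
    using assms f(1) smult_l_minus[of "\<one>\<^bsub>K\<^esub>" w] W.smult_l_minus[of "\<one>\<^bsub>K\<^esub>" "f w"] by simp
  then show ?thesis using f(2) assms by (simp add: a_minus_def)
qed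

lemma kernel_submodule:
  assumes "kG_module K G W" "f \<in> kG_hom K G V W"
  shows "kG_submodule K G V {v \<in> carrier V. f v = \<zero>\<^bsub>W\<^esub>}"
proof -
  interpret W: kG_module K G W by fact
  note f = kG_homE[OF assms(2)]
  have "act W g \<zero>\<^bsub>W\<^esub> = \<zero>\<^bsub>W\<^esub>" if "g \<in> carrier G" for g
    using W.act_smult[OF that, of "\<zero>\<^bsub>K\<^esub>" "\<zero>\<^bsub>W\<^esub>"] W.act_closed[OF that] by simp
  then show ?thesis unfolding kG_submodule_iff
    using f hom_zero[OF assms] act_closed by auto
qed

lemma hom_injective_if_trivial_kernel:
  assumes "kG_module K G W" "f \<in> kG_hom K G V W"
    and ker: "\<And>v. v \<in> carrier V \<Longrightarrow> f v = \<zero>\<^bsub>W\<^esub> \<Longrightarrow> v = \<zero>\<^bsub>V\<^esub>"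
  shows "inj_on f (carrier V)"
proof (rule inj_onI)
  fix v w assume vw: "v \<in> carrier V" "w \<in> carrier V" "f v = f w"
  interpret W: kG_module K G W by fact
  have "f (v \<ominus>\<^bsub>V\<^esub> w) = \<zero>\<^bsub>W\<^esub>"
    using hom_minus[OF assms(1,2) vw(1,2)] vw kG_homE(1)[OF assms(2)] by (simp add: W.minus_eq W.r_neg)
  then have "v \<ominus>\<^bsub>V\<^esub> w = \<zero>\<^bsub>V\<^esub>" using ker vw by simp
  then show "v = w" using vw by simp
qed

lemma image_submodule:
  assumes "kG_module K G W" "f \<in> kG_hom K G V W"
  shows "kG_submodule K G W (f ` carrier V)"
proof -
  interpret W: kG_module K G W by fact
  note f = kG_homE[OF assms(2)]
  show ?thesis unfolding W.kG_submodule_iff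
  proof (intro conjI ballI)
    show "\<zero>\<^bsub>W\<^esub> \<in> f ` carrier V" using hom_zero[OF assms] by (metis imageI M.zero_closed)
    show "f ` carrier V \<subseteq> carrier W" using f by auto
  next
    fix x y assume "x \<in> f ` carrier V" "y \<in> f ` carrier V"
    then show "x \<oplus>\<^bsub>W\<^esub> y \<in> f ` carrier V" using f(2)[symmetric] by auto
  next
    fix a x assume "a \<in> carrier K" "x \<in> f ` carrier V"
    then show "a \<odot>\<^bsub>W\<^esub> x \<in> f ` carrier V" using f(3)[symmetric] by auto
  next
    fix g x assume "g \<in> carrier G" "x \<in> f ` carrier V"
    then show "act W g x \<in> f ` carrier V" using f(4)[symmetric] act_closed by auto
  qed
qed

lemma kG_hom_inv_into:
  assumes f: "f \<in> kG_hom K G V W" and b: "bij_betw f (carrier V) (carrier W)"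
  shows "inv_into (carrier V) f \<in> kG_hom K G W V"
proof (rule kG_homI)
  note F = kG_homE[OF f]
  let ?g = "inv_into (carrier V) f"
  have g: "?g w \<in> carrier V" "f (?g w) = w" if "w \<in> carrier W" for w
    using b that by (auto simp: bij_betw_def inv_into_into f_inv_into_f)
  have gf: "?g (f v) = v" if "v \<in> carrier V" for v
    using b that by (auto simp: bij_betw_def)
  show "?g w \<in> carrier V" if "w \<in> carrier W" for w using g that by blast
  show "?g (v \<oplus>\<^bsub>W\<^esub> w) = ?g v \<oplus>\<^bsub>V\<^esub> ?g w" if "v \<in> carrier W" "w \<in> carrier W" for v w
    using gf[of "?g v \<oplus>\<^bsub>V\<^esub> ?g w"] F(2)[of "?g v" "?g w"] g that by simp
  show "?g (a \<odot>\<^bsub>W\<^esub> w) = a \<odot>\<^bsub>V\<^esub> ?g w" if "a \<in> carrier K" "w \<in> carrier W" for a w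
    using gf[of "a \<odot>\<^bsub>V\<^esub> ?g w"] F(3)[of a "?g w"] g that by simp
  show "?g (act W h w) = act V h (?g w)" if "h \<in> carrier G" "w \<in> carrier W" for h w
    using gf[of "act V h (?g w)"] F(4)[of h "?g w"] g that act_closed by simp
qed

text \<open>
  Structure transport: a bijection that respects the operations carries the module axioms over, so
  that quotients and images need not be checked axiom by axiom. The value at \<open>0\<close> has to be
  prescribed because the zero of \<open>W\<close> is a record field with no properties yet.
\<close>
lemma kG_module_transport:
  assumes b: "bij_betw f (carrier V) (carrier W)" and f: "f \<in> kG_hom K G V W"
    and z: "f \<zero>\<^bsub>V\<^esub> = \<zero>\<^bsub>W\<^esub>"
  shows "kG_module K G W"
proof -
  note F = kG_homE[OF f]
  have Wi: "carrier W = f ` carrier V" using b by (simp add: bij_betw_def)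
  have pre: "\<exists>v \<in> carrier V. x = f v" if "x \<in> carrier W" for x using that Wi by blast
  note add = F(2)[symmetric] and smul = F(3)[symmetric] and act = F(4)[symmetric]
  have ab: "abelian_group W"
  proof (rule abelian_groupI)
    show "\<zero>\<^bsub>W\<^esub> \<in> carrier W" using F(1)[OF M.zero_closed] z by simp
    show "x \<oplus>\<^bsub>W\<^esub> y \<in> carrier W" if "x \<in> carrier W" "y \<in> carrier W" for x y
      using pre[OF that(1)] pre[OF that(2)] F(1) add by force
    show "x \<oplus>\<^bsub>W\<^esub> y \<oplus>\<^bsub>W\<^esub> w = x \<oplus>\<^bsub>W\<^esub> (y \<oplus>\<^bsub>W\<^esub> w)"
      if xyw: "x \<in> carrier W" "y \<in> carrier W" "w \<in> carrier W" for x y w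
    proof -
      obtain u v t where "u \<in> carrier V" "v \<in> carrier V" "t \<in> carrier V" "x = f u" "y = f v" "w = f t"
        using pre[OF xyw(1)] pre[OF xyw(2)] pre[OF xyw(3)] by blast
      then show ?thesis by (simp add: add a_assoc)
    qed
    show "x \<oplus>\<^bsub>W\<^esub> y = y \<oplus>\<^bsub>W\<^esub> x" if xy: "x \<in> carrier W" "y \<in> carrier W" for x y
    proof -
      obtain u v where "u \<in> carrier V" "v \<in> carrier V" "x = f u" "y = f v"
        using pre[OF xy(1)] pre[OF xy(2)] by blast
      then show ?thesis using add[of u v] add[of v u] a_comm[of u v] by simp
    qed
    show "\<zero>\<^bsub>W\<^esub> \<oplus>\<^bsub>W\<^esub> x = x" if x: "x \<in> carrier W" for x
      using pre[OF x] add[OF M.zero_closed] z by auto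
    show "\<exists>y\<in>carrier W. y \<oplus>\<^bsub>W\<^esub> x = \<zero>\<^bsub>W\<^esub>" if x: "x \<in> carrier W" for x
    proof -
      obtain v where v: "v \<in> carrier V" "x = f v" using pre[OF x] by blast
      then have "f (\<ominus>\<^bsub>V\<^esub> v) \<oplus>\<^bsub>W\<^esub> x = \<zero>\<^bsub>W\<^esub>" using z by (simp add: l_neg add)
      then show ?thesis using F(1) v by blast
    qed
  qed
  have mod: "module K W"
  proof (rule moduleI[OF _ ab])
    show "cring K" by (rule is_cring)
    show "a \<odot>\<^bsub>W\<^esub> x \<in> carrier W" if "a \<in> carrier K" "x \<in> carrier W" for a x
      using pre[OF that(2)] F(1) smul that(1) by force
    show "(a \<oplus>\<^bsub>K\<^esub> c) \<odot>\<^bsub>W\<^esub> x = a \<odot>\<^bsub>W\<^esub> x \<oplus>\<^bsub>W\<^esub> c \<odot>\<^bsub>W\<^esub> x"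
      if "a \<in> carrier K" "c \<in> carrier K" "x \<in> carrier W" for a c x
      using pre[OF that(3)] that(1,2) by (auto simp: add smul smult_l_distr)
    show "a \<odot>\<^bsub>W\<^esub> (x \<oplus>\<^bsub>W\<^esub> y) = a \<odot>\<^bsub>W\<^esub> x \<oplus>\<^bsub>W\<^esub> a \<odot>\<^bsub>W\<^esub> y"
      if "a \<in> carrier K" "x \<in> carrier W" "y \<in> carrier W" for a x y
      using pre[OF that(2)] pre[OF that(3)] that(1) by (auto simp: add smul smult_r_distr)
    show "(a \<otimes>\<^bsub>K\<^esub> c) \<odot>\<^bsub>W\<^esub> x = a \<odot>\<^bsub>W\<^esub> (c \<odot>\<^bsub>W\<^esub> x)"
      if "a \<in> carrier K" "c \<in> carrier K" "x \<in> carrier W" for a c x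
      using pre[OF that(3)] that(1,2) by (auto simp: smul smult_assoc1)
    show "\<one>\<^bsub>K\<^esub> \<odot>\<^bsub>W\<^esub> x = x" if x: "x \<in> carrier W" for x
      using pre[OF x] by (auto simp: smul)
  qed
  obtain A where A: "finite A" "A \<subseteq> carrier V"
    "\<And>N. kG_submodule K G V N \<Longrightarrow> A \<subseteq> N \<Longrightarrow> N = carrier V"
    using finitely_generated by blast
  have "N = carrier W" if N: "kG_submodule K G W N" "f ` A \<subseteq> N" for N
  proof -
    interpret W: module K W by fact
    have s: "submodule N K W" using N by (simp add: kG_submodule_def)
    have zN: "\<zero>\<^bsub>W\<^esub> \<in> N" using subgroup.one_closed[OF submodule.axioms(1)[OF s]] by simp
    have "kG_submodule K G V {v \<in> carrier V. f v \<in> N}"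
      unfolding kG_submodule_iff using F act_closed z zN W.submoduleE[OF s] N
      by (auto simp: kG_submodule_def)
    moreover have "A \<subseteq> {v \<in> carrier V. f v \<in> N}" using A N by auto
    ultimately have "{v \<in> carrier V. f v \<in> N} = carrier V" by (rule A(3))
    then have "carrier W \<subseteq> N" unfolding Wi by blast
    then show ?thesis using W.submoduleE(1)[OF s] by blast
  qed
  moreover have "finite (f ` A)" "f ` A \<subseteq> carrier W" using A F by auto
  ultimately have fg: "\<exists>A. finite A \<and> A \<subseteq> carrier W \<and> (\<forall>N. kG_submodule K G W N \<and> A \<subseteq> N \<longrightarrow> N = carrier W)"
    by blast
  show ?thesis
  proof (intro kG_module.intro kG_module_axioms.intro)
    show "field K" by unfold_locales
    show "group G" by unfold_locales
    show "module K W" by (fact mod)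
    show "act W g x \<in> carrier W" if "g \<in> carrier G" "x \<in> carrier W" for g x
      using pre[OF that(2)] act[OF that(1)] F(1) act_closed[OF that(1)] by force
    show "act W \<one>\<^bsub>G\<^esub> x = x" if x: "x \<in> carrier W" for x
      using pre[OF x] by (auto simp: act act_one)
    show "act W (g \<otimes>\<^bsub>G\<^esub> h) x = act W g (act W h x)"
      if "g \<in> carrier G" "h \<in> carrier G" "x \<in> carrier W" for g h x
      using pre[OF that(3)] that(1,2) by (auto simp: act act_closed act_mult)
    show "act W g (x \<oplus>\<^bsub>W\<^esub> y) = act W g x \<oplus>\<^bsub>W\<^esub> act W g y"
      if "g \<in> carrier G" "x \<in> carrier W" "y \<in> carrier W" for g x y
      using pre[OF that(2)] pre[OF that(3)] that(1) by (auto simp: act add act_closed act_add)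
    show "act W g (a \<odot>\<^bsub>W\<^esub> x) = a \<odot>\<^bsub>W\<^esub> act W g x"
      if "g \<in> carrier G" "a \<in> carrier K" "x \<in> carrier W" for g a x
      using pre[OF that(3)] that(1,2) by (auto simp: act smul act_closed act_smult)
  qed (fact fg)
qed

text \<open>The decomposition is \<open>v = j(r(v)) + (v - j(r(v)))\<close>.\<close>
lemma retract_direct_sum:
  assumes W: "kG_module K G W" and j: "j \<in> kG_hom K G W V" and r: "r \<in> kG_hom K G V W"
    and rj: "\<And>w. w \<in> carrier W \<Longrightarrow> r (j w) = w"
  shows "kG_direct_sum K G V (j ` carrier W) {v \<in> carrier V. r v = \<zero>\<^bsub>W\<^esub>}"
proof -
  interpret W: kG_module K G W by fact
  have V: "kG_module K G V" by unfold_locales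
  note J = kG_homE[OF j] and R = kG_homE[OF r]
  have "\<exists>s \<in> j ` carrier W. \<exists>t \<in> {v \<in> carrier V. r v = \<zero>\<^bsub>W\<^esub>}. v = s \<oplus>\<^bsub>V\<^esub> t" if v: "v \<in> carrier V" for v
  proof (intro bexI)
    show "v = j (r v) \<oplus>\<^bsub>V\<^esub> (v \<ominus>\<^bsub>V\<^esub> j (r v))" using v J R by (simp add: minus_eq a_lcomm r_neg)
    show "v \<ominus>\<^bsub>V\<^esub> j (r v) \<in> {v \<in> carrier V. r v = \<zero>\<^bsub>W\<^esub>}"
      using v J R rj hom_minus[OF W r, of v "j (r v)"] by (simp add: W.minus_eq W.r_neg)
  qed (use v R in auto)
  then have "j ` carrier W <+>\<^bsub>V\<^esub> {v \<in> carrier V. r v = \<zero>\<^bsub>W\<^esub>} = carrier V"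
    using J by (auto simp: set_add_def' )
  moreover have "j ` carrier W \<inter> {v \<in> carrier V. r v = \<zero>\<^bsub>W\<^esub>} = {\<zero>\<^bsub>V\<^esub>}"
  proof -
    have "\<zero>\<^bsub>V\<^esub> \<in> j ` carrier W" using W.hom_zero[OF V j] by (metis imageI W.M.zero_closed)
    moreover have "j w = \<zero>\<^bsub>V\<^esub>" if "w \<in> carrier W" "r (j w) = \<zero>\<^bsub>W\<^esub>" for w
      using rj[OF that(1)] that(2) W.hom_zero[OF V j] by simp
    ultimately show ?thesis using hom_zero[OF W r] by blast
  qed
  ultimately show ?thesis
    unfolding kG_direct_sum_def using W.image_submodule[OF V j] kernel_submodule[OF W r] by blast
qed

lemma direct_sum_sym: "kG_direct_sum K G V S T \<Longrightarrow> kG_direct_sum K G V T S"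
proof -
  assume d: "kG_direct_sum K G V S T"
  then have "S \<subseteq> carrier V" "T \<subseteq> carrier V" by (auto simp: kG_direct_sum_def kG_submodule_iff)
  then have "S <+>\<^bsub>V\<^esub> T = T <+>\<^bsub>V\<^esub> S"
    unfolding set_add_def' by (auto simp: a_comm subset_eq) (metis a_comm)+
  then show ?thesis using d by (auto simp: kG_direct_sum_def)
qed

text \<open>The components of a vector are unique because the two summands meet in \<open>0\<close>.\<close>
lemma direct_sum_projection:
  assumes d: "kG_direct_sum K G V S T"
  obtains e where "e \<in> kG_hom K G V V" "\<And>v. v \<in> carrier V \<Longrightarrow> e v \<in> S" "\<And>s. s \<in> S \<Longrightarrow> e s = s"
    "\<And>t. t \<in> T \<Longrightarrow> e t = \<zero>\<^bsub>V\<^esub>"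
proof -
  have S: "kG_submodule K G V S" and T: "kG_submodule K G V T"
    and sum: "S <+>\<^bsub>V\<^esub> T = carrier V" and int: "S \<inter> T = {\<zero>\<^bsub>V\<^esub>}"
    using d by (auto simp: kG_direct_sum_def)
  note S' = S[unfolded kG_submodule_iff] and T' = T[unfolded kG_submodule_iff]
  have dec: "\<exists>s\<in>S. \<exists>t\<in>T. v = s \<oplus>\<^bsub>V\<^esub> t" if "v \<in> carrier V" for v
  proof -
    have "v \<in> S <+>\<^bsub>V\<^esub> T" using that sum by simp
    then show ?thesis by (auto simp: set_add_def')
  qed
  have uni: "s = s'" if st: "s \<in> S" "t \<in> T" "s' \<in> S" "t' \<in> T" "s \<oplus>\<^bsub>V\<^esub> t = s' \<oplus>\<^bsub>V\<^esub> t'" for s t s' t'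
  proof -
    have c: "s \<in> carrier V" "t \<in> carrier V" "s' \<in> carrier V" "t' \<in> carrier V" using st S' T' by auto
    have "s \<ominus>\<^bsub>V\<^esub> s' = (s \<oplus>\<^bsub>V\<^esub> t) \<ominus>\<^bsub>V\<^esub> (s' \<oplus>\<^bsub>V\<^esub> t)"
      using c by (simp add: minus_eq minus_add a_ac r_neg r_neg1 r_neg2)
    also have "\<dots> = t' \<ominus>\<^bsub>V\<^esub> t"
      unfolding st(5) using c
      by (simp add: minus_eq minus_add a_assoc a_lcomm[of t' "\<ominus>\<^bsub>V\<^esub> s'"] r_neg2)
    finally have eq: "s \<ominus>\<^bsub>V\<^esub> s' = t' \<ominus>\<^bsub>V\<^esub> t" .
    have "s \<ominus>\<^bsub>V\<^esub> s' \<in> S" using S' st minus_in_submodule[OF S] by (simp add: minus_eq)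
    moreover have "t' \<ominus>\<^bsub>V\<^esub> t \<in> T" using T' st minus_in_submodule[OF T] by (simp add: minus_eq)
    ultimately have "s \<ominus>\<^bsub>V\<^esub> s' = \<zero>\<^bsub>V\<^esub>" using eq int by auto
    then show ?thesis using c by simp
  qed
  define e where "e v = (SOME s. s \<in> S \<and> (\<exists>t\<in>T. v = s \<oplus>\<^bsub>V\<^esub> t))" for v
  have e1: "e v \<in> S \<and> (\<exists>t\<in>T. v = e v \<oplus>\<^bsub>V\<^esub> t)" if "v \<in> carrier V" for v
    unfolding e_def by (rule someI_ex) (use dec[OF that] in blast)
  have e: "e (s \<oplus>\<^bsub>V\<^esub> t) = s" if "s \<in> S" "t \<in> T" for s t
  proof -
    have "s \<oplus>\<^bsub>V\<^esub> t \<in> carrier V" using that S' T' by auto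
    from e1[OF this] obtain t' where "e (s \<oplus>\<^bsub>V\<^esub> t) \<in> S" "t' \<in> T" "s \<oplus>\<^bsub>V\<^esub> t = e (s \<oplus>\<^bsub>V\<^esub> t) \<oplus>\<^bsub>V\<^esub> t'"
      by blast
    then show ?thesis using uni that by metis
  qed
  show thesis
  proof
    show "e v \<in> S" if "v \<in> carrier V" for v using e1 that by blast
    show "e s = s" if "s \<in> S" for s using e[OF that, of "\<zero>\<^bsub>V\<^esub>"] that S' T' by auto
    show "e t = \<zero>\<^bsub>V\<^esub>" if "t \<in> T" for t using e[of "\<zero>\<^bsub>V\<^esub>" t] that S' T' by auto
    show "e \<in> kG_hom K G V V"
    proof (rule kG_homI)
      show "e v \<in> carrier V" if "v \<in> carrier V" for v using e1[OF that] S' by blast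
    next
      fix v w assume "v \<in> carrier V" "w \<in> carrier V"
      then obtain s t s' t' where st: "s \<in> S" "t \<in> T" "s' \<in> S" "t' \<in> T"
        "v = s \<oplus>\<^bsub>V\<^esub> t" "w = s' \<oplus>\<^bsub>V\<^esub> t'" using dec by metis
      then have c: "s \<in> carrier V" "t \<in> carrier V" "s' \<in> carrier V" "t' \<in> carrier V" using S' T' by auto
      have "v \<oplus>\<^bsub>V\<^esub> w = (s \<oplus>\<^bsub>V\<^esub> s') \<oplus>\<^bsub>V\<^esub> (t \<oplus>\<^bsub>V\<^esub> t')" using c st(5,6) by (simp add: a_ac)
      then show "e (v \<oplus>\<^bsub>V\<^esub> w) = e v \<oplus>\<^bsub>V\<^esub> e w" using e st S' T' by simp
    next
      fix a v assume a: "a \<in> carrier K" and "v \<in> carrier V"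
      then obtain s t where st: "s \<in> S" "t \<in> T" "v = s \<oplus>\<^bsub>V\<^esub> t" using dec by metis
      then have c: "s \<in> carrier V" "t \<in> carrier V" using S' T' by auto
      have "a \<odot>\<^bsub>V\<^esub> v = a \<odot>\<^bsub>V\<^esub> s \<oplus>\<^bsub>V\<^esub> a \<odot>\<^bsub>V\<^esub> t" using a c st(3) by (simp add: smult_r_distr)
      then show "e (a \<odot>\<^bsub>V\<^esub> v) = a \<odot>\<^bsub>V\<^esub> e v" using e st S' T' a by simp
    next
      fix g v assume g: "g \<in> carrier G" and "v \<in> carrier V"
      then obtain s t where st: "s \<in> S" "t \<in> T" "v = s \<oplus>\<^bsub>V\<^esub> t" using dec by metis
      then have c: "s \<in> carrier V" "t \<in> carrier V" using S' T' by auto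
      have "act V g v = act V g s \<oplus>\<^bsub>V\<^esub> act V g t" using g c st(3) by (simp add: act_add)
      then show "e (act V g v) = act V g (e v)" using e st S' T' g by simp
    qed
  qed
qed

end

lemma kG_isomorphic_sym: "kG_isomorphic K G V W \<Longrightarrow> kG_isomorphic K G W V"
  unfolding kG_isomorphic_def using kG_module.kG_hom_inv_into bij_betw_inv_into by blast

lemma trivial_kG_module:
  fixes K :: "'k ring" and G :: "'g monoid"
  assumes "field K" "group G"
  shows "kG_module K G (trivial_gmodule K)"
proof -
  interpret field K by fact
  let ?T = "trivial_gmodule K :: ('k, 'g, 'k) gmodule"
  have ab: "abelian_group ?T"
  proof (rule abelian_groupI)
    show "\<exists>y\<in>carrier ?T. y \<oplus>\<^bsub>?T\<^esub> x = \<zero>\<^bsub>?T\<^esub>" if "x \<in> carrier ?T" for x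
      using that l_neg[of x] a_inv_closed[of x] by (auto simp: trivial_gmodule_def)
  qed (simp_all add: trivial_gmodule_def a_ac)
  have mod: "module K ?T"
    by (rule moduleI[OF is_cring ab]) (auto simp: trivial_gmodule_def l_distr r_distr m_assoc)
  have "N = carrier ?T" if N: "kG_submodule K G ?T N" "{\<one>\<^bsub>K\<^esub>} \<subseteq> N" for N
  proof -
    interpret T: module K ?T by fact
    have s: "submodule N K ?T" using N by (simp add: kG_submodule_def)
    have "a \<in> N" if "a \<in> carrier K" for a
      using T.submoduleE(4)[OF s that, of "\<one>\<^bsub>K\<^esub>"] N(2) that by (simp add: trivial_gmodule_def)
    then show ?thesis using T.submoduleE(1)[OF s] by (auto simp: trivial_gmodule_def)
  qed
  then have fg: "\<exists>A. finite A \<and> A \<subseteq> carrier ?T \<and> (\<forall>N. kG_submodule K G ?T N \<and> A \<subseteq> N \<longrightarrow> N = carrier ?T)"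
    by (intro exI[of _ "{\<one>\<^bsub>K\<^esub>}"]) (auto simp: trivial_gmodule_def)
  show ?thesis
    by (intro kG_module.intro kG_module_axioms.intro assms mod fg) (auto simp: trivial_gmodule_def)
qed

section \<open>Scott summands\<close>

definition scott_summand :: "'k ring \<Rightarrow> 'g monoid \<Rightarrow> ('k, 'g, 'v) gmodule \<Rightarrow> 'v set \<Rightarrow> bool" where
  "scott_summand K G V S \<longleftrightarrow> kG_summand K G V S \<and>
     kG_indecomposable K G (V\<lparr>carrier := S\<rparr>) \<and> trivial_in_socle K G (V\<lparr>carrier := S\<rparr>)"

text \<open>
  An abstract criterion for identifying a Scott module: \<open>W\<close> is a retract of \<open>I\<close>, the fixed vectors of
  \<open>I\<close> form the line through the image of \<open>t \<in> W\<close>, and \<open>W\<close> has no non-bijective endomorphisms fixing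
  \<open>t\<close>. For finite-dimensional indecomposable \<open>W\<close> the last condition is Fitting's lemma; here it
  replaces indecomposability and implies it.
\<close>
locale rigid_retract = I: kG_module K G I + W: kG_module K G W
  for K :: "'k ring" and G :: "'g monoid"
    and I :: "('k, 'g, 'v) gmodule" and W :: "('k, 'g, 'w) gmodule" +
  fixes i :: "'w \<Rightarrow> 'v" and r :: "'v \<Rightarrow> 'w" and t :: 'w
  assumes i: "i \<in> kG_hom K G W I" and r: "r \<in> kG_hom K G I W"
    and ri: "w \<in> carrier W \<Longrightarrow> r (i w) = w"
    and t: "t \<in> carrier W" "t \<noteq> \<zero>\<^bsub>W\<^esub>"
    and t_fixed: "g \<in> carrier G \<Longrightarrow> act W g t = t"
    and fixed_line: "v \<in> carrier I \<Longrightarrow> (\<And>g. g \<in> carrier G \<Longrightarrow> act I g v = v) \<Longrightarrow>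
      \<exists>a \<in> carrier K. v = a \<odot>\<^bsub>I\<^esub> i t"
    and rigid: "\<alpha> \<in> kG_hom K G W W \<Longrightarrow> \<alpha> t = t \<Longrightarrow> bij_betw \<alpha> (carrier W) (carrier W)"
begin

lemma module_I: "kG_module K G I" by unfold_locales
lemma module_W: "kG_module K G W" by unfold_locales

lemma it: "i t \<in> carrier I" "i t \<noteq> \<zero>\<^bsub>I\<^esub>" "g \<in> carrier G \<Longrightarrow> act I g (i t) = i t"
  using kG_homE(1)[OF i] kG_homE(4)[OF i, symmetric] t t_fixed ri[OF t(1)] I.hom_zero[OF module_W r]
  by auto

lemma scaled_it_in_submodule:
  assumes N: "kG_submodule K G I N" and a: "a \<in> carrier K" "a \<odot>\<^bsub>I\<^esub> i t \<in> N" "a \<odot>\<^bsub>I\<^esub> i t \<noteq> \<zero>\<^bsub>I\<^esub>"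
  shows "i t \<in> N"
proof -
  have "a \<noteq> \<zero>\<^bsub>K\<^esub>" using a(3) it(1) by auto
  then have u: "inv\<^bsub>K\<^esub> a \<in> carrier K" "inv\<^bsub>K\<^esub> a \<otimes>\<^bsub>K\<^esub> a = \<one>\<^bsub>K\<^esub>" using a(1) I.field_Units by auto
  have "inv\<^bsub>K\<^esub> a \<odot>\<^bsub>I\<^esub> (a \<odot>\<^bsub>I\<^esub> i t) \<in> N" using N u(1) a(2) by (auto simp: I.kG_submodule_iff)
  then show ?thesis using u a(1) it(1) by (simp flip: I.smult_assoc1)
qed

lemma isomorphic_image: "kG_isomorphic K G W (I\<lparr>carrier := i ` carrier W\<rparr>)"
proof -
  have inj: "inj_on i (carrier W)" using ri by (metis inj_onI)
  have b: "bij_betw i (carrier W) (carrier (I\<lparr>carrier := i ` carrier W\<rparr>))"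
    using inj by (simp add: bij_betw_def)
  have h: "i \<in> kG_hom K G W (I\<lparr>carrier := i ` carrier W\<rparr>)"
    by (rule kG_hom_restrict_codomain[OF i]) blast
  have "kG_module K G (I\<lparr>carrier := i ` carrier W\<rparr>)"
    by (rule W.kG_module_transport[OF b h]) (simp add: W.hom_zero[OF module_I i])
  then show ?thesis unfolding kG_isomorphic_def using b h module_W by blast
qed

text \<open>
  If the image of \<open>W\<close> were \<open>A \<oplus> B\<close>, then the components of \<open>t\<close> would be fixed vectors, hence multiples
  of \<open>t\<close>, so that \<open>t\<close> would lie in one of the summands, say in \<open>A\<close>. The projection onto \<open>A\<close> then fixes
  \<open>t\<close>, so it is injective by rigidity; but it kills \<open>B\<close>.
\<close>
lemma scott_summand_image: "scott_summand K G I (i ` carrier W)"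
proof -
  let ?S = "i ` carrier W"
  let ?V = "I\<lparr>carrier := ?S\<rparr>"
  have V: "kG_module K G ?V" using isomorphic_image by (simp add: kG_isomorphic_def)
  interpret V: kG_module K G ?V by fact
  have itS: "i t \<in> ?S" using t by blast
  have sub: "kG_submodule K G I ?S" by (rule W.image_submodule[OF module_I i])
  have subV: "kG_submodule K G I N" if "kG_submodule K G ?V N" for N
    using that kG_module.kG_submodule_iff[OF V] sub unfolding I.kG_submodule_iff by auto
  have half: "B = {\<zero>\<^bsub>?V\<^esub>}" if d: "kG_direct_sum K G ?V A B" and iA: "i t \<in> A" for A B
  proof -
    obtain e where e: "e \<in> kG_hom K G ?V ?V" "\<And>s. s \<in> A \<Longrightarrow> e s = s" "\<And>s. s \<in> B \<Longrightarrow> e s = \<zero>\<^bsub>?V\<^esub>"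
      by (rule V.direct_sum_projection[OF d]) blast
    have iV: "i \<in> kG_hom K G W ?V" by (rule kG_hom_restrict_codomain[OF i]) blast
    have eI: "e \<in> kG_hom K G ?V I"
      using kG_homE[OF e(1)] sub by (intro kG_homI) (simp_all add: I.kG_submodule_iff subset_iff)
    have "(\<lambda>w. r (e (i w))) \<in> kG_hom K G W W" by (rule kG_hom_comp[OF kG_hom_comp[OF iV eI] r])
    moreover have "r (e (i t)) = t" using e(2)[OF iA] ri[OF t(1)] by simp
    ultimately have inj: "inj_on (\<lambda>w. r (e (i w))) (carrier W)" using rigid bij_betw_def by blast
    have B: "B \<subseteq> ?S" "\<zero>\<^bsub>I\<^esub> \<in> B" using d by (auto simp: kG_direct_sum_def V.kG_submodule_iff)
    have "b \<in> {\<zero>\<^bsub>I\<^esub>}" if b: "b \<in> B" for b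
    proof -
      obtain w where w: "w \<in> carrier W" "b = i w" using b B by blast
      have z: "i \<zero>\<^bsub>W\<^esub> = \<zero>\<^bsub>I\<^esub>" by (rule W.hom_zero[OF module_I i])
      have "r (e (i w)) = r (e (i \<zero>\<^bsub>W\<^esub>))" using e(3)[OF b] e(3)[OF B(2)] w z by simp
      then have "w = \<zero>\<^bsub>W\<^esub>" using inj_onD[OF inj] w by simp
      then show ?thesis using w z by simp
    qed
    then have "B = {\<zero>\<^bsub>I\<^esub>}" using B(2) by blast
    then show ?thesis by simp
  qed
  have indec: "kG_indecomposable K G ?V"
    unfolding kG_indecomposable_def
  proof (intro conjI allI impI V)
    show "carrier ?V \<noteq> {\<zero>\<^bsub>?V\<^esub>}" using itS it(2) by auto
    fix A B assume d: "kG_direct_sum K G ?V A B"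
    obtain e where e: "e \<in> kG_hom K G ?V ?V" "\<And>v. v \<in> carrier ?V \<Longrightarrow> e v \<in> A"
      "\<And>s. s \<in> A \<Longrightarrow> e s = s" "\<And>s. s \<in> B \<Longrightarrow> e s = \<zero>\<^bsub>?V\<^esub>"
      by (rule V.direct_sum_projection[OF d]) blast
    have A: "kG_submodule K G ?V A" and B: "kG_submodule K G ?V B"
      using d by (auto simp: kG_direct_sum_def)
    have "i t \<in> A <+>\<^bsub>?V\<^esub> B" using d itS by (simp add: kG_direct_sum_def)
    then obtain u v where uv: "u \<in> A" "v \<in> B" "i t = u \<oplus>\<^bsub>I\<^esub> v" by (auto simp: set_add_def')
    have uvS: "u \<in> ?S" "v \<in> ?S" using uv A B by (auto simp: V.kG_submodule_iff)
    then have uvI: "u \<in> carrier I" "v \<in> carrier I" using sub by (auto simp: I.kG_submodule_iff)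
    have "e (i t) = u"
    proof -
      have "e (u \<oplus>\<^bsub>?V\<^esub> v) = e u \<oplus>\<^bsub>?V\<^esub> e v" by (rule kG_homE(2)[OF e(1)]) (use uvS in auto)
      then show ?thesis using e uv uvI by simp
    qed
    then have "act I g u = u" if "g \<in> carrier G" for g
      using kG_homE(4)[OF e(1) that, of "i t"] it(3)[OF that] itS by simp
    then obtain a where a: "a \<in> carrier K" "u = a \<odot>\<^bsub>I\<^esub> i t" using fixed_line uvI(1) by blast
    show "A = {\<zero>\<^bsub>?V\<^esub>} \<or> B = {\<zero>\<^bsub>?V\<^esub>}"
    proof (cases "u = \<zero>\<^bsub>I\<^esub>")
      case True
      then have "i t \<in> B" using uv uvI by simp
      then show ?thesis using half[OF V.direct_sum_sym[OF d]] by blast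
    next
      case False
      then have "i t \<in> A" using scaled_it_in_submodule[OF subV[OF A] a(1)] a(2) uv(1) by simp
      then show ?thesis using half[OF d] by blast
    qed
  qed
  let ?N = "(\<lambda>a. a \<odot>\<^bsub>I\<^esub> i t) ` carrier K"
  let ?f = "\<lambda>a. a \<odot>\<^bsub>I\<^esub> i t"
  let ?T = "trivial_gmodule K :: ('k, 'g, 'k) gmodule"
  have T: "kG_module K G ?T" by (rule trivial_kG_module) unfold_locales
  have fh: "?f \<in> kG_hom K G ?T (I\<lparr>carrier := ?N\<rparr>)"
    by (rule kG_homI) (auto simp: trivial_gmodule_def it I.smult_l_distr I.smult_assoc1 I.act_smult)
  have fI: "?f \<in> kG_hom K G ?T I"
    by (rule kG_homI) (auto simp: trivial_gmodule_def it I.smult_l_distr I.smult_assoc1 I.act_smult)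
  have "inj_on ?f (carrier ?T)"
  proof (rule kG_module.hom_injective_if_trivial_kernel[OF T module_I fI])
    fix a assume a: "a \<in> carrier ?T" "a \<odot>\<^bsub>I\<^esub> i t = \<zero>\<^bsub>I\<^esub>"
    show "a = \<zero>\<^bsub>?T\<^esub>"
    proof (rule ccontr)
      assume "a \<noteq> \<zero>\<^bsub>?T\<^esub>"
      then have u: "inv\<^bsub>K\<^esub> a \<in> carrier K" "inv\<^bsub>K\<^esub> a \<otimes>\<^bsub>K\<^esub> a = \<one>\<^bsub>K\<^esub>"
        using a(1) I.field_Units by (auto simp: trivial_gmodule_def)
      then have "i t = inv\<^bsub>K\<^esub> a \<odot>\<^bsub>I\<^esub> (a \<odot>\<^bsub>I\<^esub> i t)"
        using a(1) it(1) by (simp add: trivial_gmodule_def flip: I.smult_assoc1)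
      then show False using a(2) u it(2) by simp
    qed
  qed
  then have fb: "bij_betw ?f (carrier ?T) (carrier (I\<lparr>carrier := ?N\<rparr>))"
    by (simp add: bij_betw_def trivial_gmodule_def)
  have N: "kG_module K G (I\<lparr>carrier := ?N\<rparr>)"
    by (rule kG_module.kG_module_transport[OF T fb fh]) (simp add: trivial_gmodule_def it)
  have iso: "kG_isomorphic K G (I\<lparr>carrier := ?N\<rparr>) ?T"
    by (rule kG_isomorphic_sym) (use T N fb fh in \<open>auto simp: kG_isomorphic_def\<close>)
  have NS: "kG_submodule K G ?V ?N"
  proof -
    have "?N \<subseteq> ?S" using sub itS by (auto simp: I.kG_submodule_iff)
    then show ?thesis using kG_module.image_submodule[OF T module_I fI]
      unfolding V.kG_submodule_iff I.kG_submodule_iff by (simp add: trivial_gmodule_def)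
  qed
  have itN: "i t \<in> ?N" using it(1) by (intro image_eqI[of _ _ "\<one>\<^bsub>K\<^esub>"]) auto
  have simple: "kG_simple K G (I\<lparr>carrier := ?N\<rparr>)"
    unfolding kG_simple_def
  proof (intro conjI allI impI N)
    show "carrier (I\<lparr>carrier := ?N\<rparr>) \<noteq> {\<zero>\<^bsub>I\<lparr>carrier := ?N\<rparr>\<^esub>}" using itN it(2) by auto
    fix Y assume "kG_submodule K G (I\<lparr>carrier := ?N\<rparr>) Y"
    then have Y: "Y \<subseteq> ?N" "\<zero>\<^bsub>I\<^esub> \<in> Y" "kG_submodule K G I Y"
      using kG_module.image_submodule[OF T module_I fI]
      unfolding kG_module.kG_submodule_iff[OF N] I.kG_submodule_iff by (auto simp: trivial_gmodule_def)
    show "Y = {\<zero>\<^bsub>I\<lparr>carrier := ?N\<rparr>\<^esub>} \<or> Y = carrier (I\<lparr>carrier := ?N\<rparr>)"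
    proof (cases "Y \<subseteq> {\<zero>\<^bsub>I\<^esub>}")
      case True then show ?thesis using Y by auto
    next
      case False
      then obtain x where x: "x \<in> Y" "x \<noteq> \<zero>\<^bsub>I\<^esub>" by blast
      then obtain a where "a \<in> carrier K" "x = a \<odot>\<^bsub>I\<^esub> i t" using Y(1) by blast
      then have "i t \<in> Y" using scaled_it_in_submodule[OF Y(3)] x by blast
      then have "?N \<subseteq> Y" using Y(3) by (auto simp: I.kG_submodule_iff)
      then show ?thesis using Y(1) by auto
    qed
  qed
  have "?N \<subseteq> kG_socle K G ?V"
    unfolding kG_socle_def using NS simple by auto
  then have "trivial_in_socle K G ?V"
    unfolding trivial_in_socle_def using NS iso by (intro exI[of _ ?N]) simp
  moreover have "kG_summand K G I ?S"
    unfolding kG_summand_def using I.retract_direct_sum[OF module_W i r ri] by blast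
  ultimately show ?thesis using indec by (simp add: scott_summand_def)
qed

text \<open>
  Let \<open>e\<close> be a projection onto \<open>S\<close>. As \<open>S\<close> contains the fixed line, the composition
  \<open>W \<rightarrow> I \<rightarrow> S \<rightarrow> W\<close> fixes \<open>t\<close> and is therefore bijective. Hence \<open>W\<close> is a retract of \<open>S\<close>, and the
  complement of this retract vanishes since \<open>S\<close> is indecomposable.
\<close>
lemma scott_summand_isomorphic:
  assumes S: "scott_summand K G I S"
  shows "kG_isomorphic K G (I\<lparr>carrier := S\<rparr>) W"
proof -
  let ?V = "I\<lparr>carrier := S\<rparr>"
  obtain T where d: "kG_direct_sum K G I S T" using S by (auto simp: scott_summand_def kG_summand_def)
  then have sub: "kG_submodule K G I S" by (simp add: kG_direct_sum_def)
  have indec: "kG_indecomposable K G ?V" using S by (simp add: scott_summand_def)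
  then have V: "kG_module K G ?V" by (simp add: kG_indecomposable_def)
  interpret V: kG_module K G ?V by fact
  obtain e where e: "e \<in> kG_hom K G I I" "\<And>v. v \<in> carrier I \<Longrightarrow> e v \<in> S" "\<And>s. s \<in> S \<Longrightarrow> e s = s"
    using I.direct_sum_projection[OF d] by metis
  have itS: "i t \<in> S"
  proof -
    let ?T = "trivial_gmodule K :: ('k, 'g, 'k) gmodule"
    obtain N where N: "kG_submodule K G ?V N" "kG_isomorphic K G (I\<lparr>carrier := N\<rparr>) ?T"
      using S by (auto simp: scott_summand_def trivial_in_socle_def)
    then obtain f where f: "f \<in> kG_hom K G ?T (I\<lparr>carrier := N\<rparr>)"
      "bij_betw f (carrier ?T) (carrier (I\<lparr>carrier := N\<rparr>))" and T: "kG_module K G ?T"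
      using kG_isomorphic_sym unfolding kG_isomorphic_def by blast
    define v where "v = f \<one>\<^bsub>K\<^esub>"
    have oneT: "\<one>\<^bsub>K\<^esub> \<in> carrier ?T" "\<zero>\<^bsub>K\<^esub> \<in> carrier ?T" by (simp_all add: trivial_gmodule_def)
    have vN: "v \<in> N" using kG_homE(1)[OF f(1) oneT(1)] by (simp add: v_def)
    then have vS: "v \<in> S" "v \<in> carrier I" using N(1) sub by (auto simp: V.kG_submodule_iff I.kG_submodule_iff)
    have NI: "kG_module K G (I\<lparr>carrier := N\<rparr>)" using N(2) by (simp add: kG_isomorphic_def)
    have "f \<zero>\<^bsub>K\<^esub> = \<zero>\<^bsub>I\<^esub>" using kG_module.hom_zero[OF T NI f(1)] by (simp add: trivial_gmodule_def)
    then have v0: "v \<noteq> \<zero>\<^bsub>I\<^esub>"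
      using f(2) oneT I.one_not_zero inj_onD[of f "carrier ?T" "\<one>\<^bsub>K\<^esub>" "\<zero>\<^bsub>K\<^esub>"] by (auto simp: v_def bij_betw_def)
    have "act I g v = v" if "g \<in> carrier G" for g
      using kG_homE(4)[OF f(1) that oneT(1)] by (simp add: v_def trivial_gmodule_def)
    then obtain a where "a \<in> carrier K" "v = a \<odot>\<^bsub>I\<^esub> i t" using fixed_line vS(2) by blast
    then show ?thesis using scaled_it_in_submodule[OF sub] vS(1) v0 by blast
  qed
  define \<alpha> where "\<alpha> = (\<lambda>w. r (e (i w)))"
  have \<alpha>: "\<alpha> \<in> kG_hom K G W W"
    unfolding \<alpha>_def by (rule kG_hom_comp[OF kG_hom_comp[OF i e(1)] r])
  moreover have "\<alpha> t = t" using e(3)[OF itS] ri t by (simp add: \<alpha>_def)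
  ultimately have bij: "bij_betw \<alpha> (carrier W) (carrier W)" by (rule rigid)
  let ?\<beta> = "inv_into (carrier W) \<alpha>"
  have \<beta>: "?\<beta> \<in> kG_hom K G W W" by (rule W.kG_hom_inv_into[OF \<alpha> bij])
  have \<alpha>\<beta>: "\<alpha> (?\<beta> w) = w" if "w \<in> carrier W" for w
    using bij that by (metis bij_betw_imp_surj_on f_inv_into_f)
  define j where "j = (\<lambda>w. e (i (?\<beta> w)))"
  have j: "j \<in> kG_hom K G W ?V"
    unfolding j_def
    by (rule kG_hom_restrict_codomain[OF kG_hom_comp[OF kG_hom_comp[OF \<beta> i] e(1)]])
      (intro e(2) kG_homE(1)[OF kG_hom_comp[OF \<beta> i]])
  have rV: "r \<in> kG_hom K G ?V W"
    using sub by (intro kG_hom_restrict_domain[OF r]) (simp add: I.kG_submodule_iff)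
  have rj: "r (j w) = w" if "w \<in> carrier W" for w using \<alpha>\<beta>[OF that] by (simp add: j_def \<alpha>_def)
  have "kG_direct_sum K G ?V (j ` carrier W) {v \<in> carrier ?V. r v = \<zero>\<^bsub>W\<^esub>}"
    by (rule V.retract_direct_sum[OF module_W j rV rj])
  then have "j ` carrier W = {\<zero>\<^bsub>?V\<^esub>} \<or> {v \<in> carrier ?V. r v = \<zero>\<^bsub>W\<^esub>} = {\<zero>\<^bsub>?V\<^esub>}"
    using indec unfolding kG_indecomposable_def by blast
  moreover have "j ` carrier W \<noteq> {\<zero>\<^bsub>?V\<^esub>}"
  proof
    assume "j ` carrier W = {\<zero>\<^bsub>?V\<^esub>}"
    then have "j t = \<zero>\<^bsub>?V\<^esub>" using t(1) by blast
    then show False using rj[OF t(1)] t(2) V.hom_zero[OF module_W rV] by simp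
  qed
  ultimately have ker: "{v \<in> carrier ?V. r v = \<zero>\<^bsub>W\<^esub>} = {\<zero>\<^bsub>?V\<^esub>}" by blast
  have "inj_on r (carrier ?V)"
    by (rule V.hom_injective_if_trivial_kernel[OF module_W rV]) (use ker in blast)
  moreover have "r ` carrier ?V = carrier W"
    using rj kG_homE(1)[OF j] kG_homE(1)[OF rV] by (force simp: image_iff)
  ultimately show ?thesis
    unfolding kG_isomorphic_def using V module_W rV by (auto simp: bij_betw_def)
qed

end

section \<open>Fixed vectors of p-groups\<close>

text \<open>
  The additive subgroup \<open>A\<close> generated by the orbit of a vector \<open>v \<noteq> 0\<close> is finite, of order divisible by
  \<open>p\<close>, and stable under the \<open>p\<close>-group \<open>B\<close>. So the number of vectors of \<open>A\<close> fixed by \<open>B\<close> is divisible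
  by \<open>p\<close>, and \<open>0\<close> is not the only one.
\<close>
lemma (in prime_char_field) ex_fixed_vector:
  assumes V: "kG_module K G V" and B: "subgroup B G" "card B = p ^ n"
    and N: "kG_submodule K G V N" "N \<noteq> {\<zero>\<^bsub>V\<^esub>}"
  obtains v where "v \<in> N" "v \<noteq> \<zero>\<^bsub>V\<^esub>" "\<And>b. b \<in> B \<Longrightarrow> act V b v = v"
proof -
  interpret V: kG_module K G V by fact
  interpret B: subgroup B G by fact
  note N' = N(1)[unfolded V.kG_submodule_iff]
  have p0: "p > 0" using prime prime_gt_0_nat by blast
  have finB: "finite B" using B(2) p0 by (intro card_ge_0_finite) simp
  obtain v where v: "v \<in> N" "v \<noteq> \<zero>\<^bsub>V\<^esub>" using N' N(2) by blast
  let ?V = "add_monoid V"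
  have exponent: "x [^]\<^bsub>?V\<^esub> p = \<zero>\<^bsub>V\<^esub>" if x: "x \<in> carrier V" for x
  proof -
    have "x [^]\<^bsub>?V\<^esub> m = ([m] \<cdot>\<^bsub>K\<^esub> \<one>) \<odot>\<^bsub>V\<^esub> x" for m :: nat
      by (induction m) (use x in \<open>auto simp: V.smult_l_distr V.a_comm\<close>)
    from this[of p] have "x [^]\<^bsub>?V\<^esub> p = \<zero> \<odot>\<^bsub>V\<^esub> x"
      using add_pow_one_eq_zero_iff[of p] by (metis dvd_refl)
    then show ?thesis using V.smult_l_null[OF x] by (rule trans)
  qed
  define Orb where "Orb = (\<lambda>b. act V b v) ` B"
  have vV: "v \<in> carrier V" using v N' by blast
  have ON: "Orb \<subseteq> N" unfolding Orb_def using N' v B.subset by blast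
  then have OV: "Orb \<subseteq> carrier ?V" using N' by auto
  define A where "A = generate ?V Orb"
  have Asub: "subgroup A ?V" unfolding A_def by (rule group.generate_is_subgroup[OF V.a_group OV])
  have AN: "A \<subseteq> N"
  proof -
    have "subgroup N ?V" using N(1) by (auto simp: kG_submodule_def dest: submodule.axioms(1))
    then show ?thesis unfolding A_def by (rule group.generate_subgroup_incl[OF V.a_group ON])
  qed
  then have AV: "A \<subseteq> carrier V" using N' by blast
  have finA: "finite A"
    unfolding A_def
  proof (rule comm_group.finite_generate[OF V.a_comm_group _ OV p0])
    show "finite Orb" using finB by (simp add: Orb_def)
    show "x [^]\<^bsub>?V\<^esub> p = \<one>\<^bsub>?V\<^esub>" if "x \<in> Orb" for x using exponent[of x] OV that by auto
  qed
  have vA: "v \<in> A"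
  proof -
    have "v \<in> Orb" unfolding Orb_def using V.act_one[OF vV] B.one_closed by (metis imageI)
    then show ?thesis unfolding A_def by (rule generate.incl)
  qed
  have BA: "act V b x \<in> A" if b: "b \<in> B" and x: "x \<in> A" for b x
    using x unfolding A_def
  proof (induction rule: generate.induct)
    case one
    have "act V b \<zero>\<^bsub>V\<^esub> = \<zero>\<^bsub>V\<^esub>"
      using V.act_smult[of b "\<zero>" "\<zero>\<^bsub>V\<^esub>"] V.act_closed[of b "\<zero>\<^bsub>V\<^esub>"] b B.subset by auto
    then show ?case using generate.one[of ?V Orb] by simp
  next
    case (incl h)
    then obtain c where "c \<in> B" "h = act V c v" by (auto simp: Orb_def)
    then have "act V b h = act V (b \<otimes>\<^bsub>G\<^esub> c) v" using V.act_mult[of b c v] b vV B.subset by auto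
    then show ?case using generate.incl[of _ Orb] b \<open>c \<in> B\<close> by (auto simp: Orb_def)
  next
    case (inv h)
    then obtain c where c: "c \<in> B" "h = act V c v" by (auto simp: Orb_def)
    have hV: "h \<in> carrier V" using inv OV by auto
    have bG: "b \<in> carrier G" using b B.subset by blast
    have "act V b h = act V (b \<otimes>\<^bsub>G\<^esub> c) v" using c V.act_mult[of b c v] b vV B.subset by auto
    then have bh: "act V b h \<in> Orb" using b c(1) by (auto simp: Orb_def)
    have "act V b (inv\<^bsub>?V\<^esub> h) = inv\<^bsub>?V\<^esub> (act V b h)"
    proof -
      have "\<ominus>\<^bsub>V\<^esub> h = (\<ominus> \<one>) \<odot>\<^bsub>V\<^esub> h" using hV V.smult_l_minus[of \<one> h] by simp
      then have "act V b (\<ominus>\<^bsub>V\<^esub> h) = (\<ominus> \<one>) \<odot>\<^bsub>V\<^esub> act V b h" using V.act_smult[OF bG _ hV] by simp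
      also have "\<dots> = \<ominus>\<^bsub>V\<^esub> (act V b h)"
        using V.act_closed[OF bG hV] V.smult_l_minus[of \<one> "act V b h"] by simp
      finally show ?thesis by (simp add: a_inv_def)
    qed
    then show ?case using generate.inv[OF bh] by simp
  next
    case (eng h1 h2)
    then have "h1 \<in> carrier V" "h2 \<in> carrier V" using group.generate_incl[OF V.a_group OV] by auto
    then show ?case
      using V.act_add[of b h1 h2] b B.subset generate.eng[OF eng.IH] by auto
  qed
  have "p dvd card A"
  proof -
    have g: "group (?V\<lparr>carrier := A\<rparr>)" using group.subgroup_imp_group[OF V.a_group Asub] .
    interpret gA: group "?V\<lparr>carrier := A\<rparr>" by (rule g)
    have "v [^]\<^bsub>?V\<lparr>carrier := A\<rparr>\<^esub> p = \<one>\<^bsub>?V\<lparr>carrier := A\<rparr>\<^esub>"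
      using exponent[OF vV] monoid.nat_pow_consistent[OF group.is_monoid[OF V.a_group], of v p A] by simp
    then have "gA.ord v dvd p" using gA.pow_eq_id[of v p] vA by simp
    moreover have "gA.ord v \<noteq> 1" using gA.ord_eq_1[of v] vA v(2) by simp
    ultimately have "gA.ord v = p" using prime by (metis prime_nat_iff)
    then show ?thesis using gA.ord_dvd_group_order[of v] vA by (simp add: order_def)
  qed
  moreover have "p dvd card A \<longleftrightarrow> p dvd card {x \<in> A. \<forall>b \<in> carrier (G\<lparr>carrier := B\<rparr>). act V b x = x}"
  proof (rule card_fixed_points[where n = n])
    show "group (G\<lparr>carrier := B\<rparr>)" using V.subgroup_imp_group[OF B(1)] .
    show "order (G\<lparr>carrier := B\<rparr>) = p ^ n" using B(2) by (simp add: order_def)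
  qed (use finA BA V.act_one V.act_mult AV B.subset in auto)
  ultimately have "p dvd card {x \<in> A. \<forall>b \<in> B. act V b x = x}" by simp
  moreover have "\<not> p dvd card {\<zero>\<^bsub>V\<^esub>}" using prime by (auto simp: prime_nat_iff)
  ultimately have ne: "{x \<in> A. \<forall>b \<in> B. act V b x = x} \<noteq> {\<zero>\<^bsub>V\<^esub>}" by metis
  have "\<zero>\<^bsub>V\<^esub> \<in> A" using subgroup.one_closed[OF Asub] by simp
  moreover have "act V b \<zero>\<^bsub>V\<^esub> = \<zero>\<^bsub>V\<^esub>" if "b \<in> B" for b
    using V.act_smult[of b "\<zero>" "\<zero>\<^bsub>V\<^esub>"] V.act_closed[of b "\<zero>\<^bsub>V\<^esub>"] that B.subset by auto
  ultimately obtain x where "x \<in> A" "x \<noteq> \<zero>\<^bsub>V\<^esub>" "\<forall>b \<in> B. act V b x = x" using ne by blast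
  then show thesis using that AN by blast
qed

section \<open>Permutation modules\<close>

text \<open>
  The permutation module on the cosets of \<open>H\<close>, with the coset \<open>xH\<close> represented by its indicator
  function. The elements are functions on \<open>G\<close>, not on the set of cosets, so that for \<open>H \<le> H'\<close> the
  module of \<open>H'\<close> is literally contained in that of \<open>H\<close>. For \<open>H = 1\<close> this is the group algebra.
\<close>
definition invariant_functions :: "'k ring \<Rightarrow> 'g monoid \<Rightarrow> 'g set \<Rightarrow> ('k, 'g, 'g \<Rightarrow> 'k) gmodule" where
  "invariant_functions K G H = group_algebra_tensor G (trivial_gmodule K)
     \<lparr>carrier := {f \<in> carrier G \<rightarrow>\<^sub>E carrier K. \<forall>x \<in> carrier G. \<forall>h\<in>H. f (x \<otimes>\<^bsub>G\<^esub> h) = f x}\<rparr>"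

lemma invariant_functions_simps:
  "carrier (invariant_functions K G H) =
     {f \<in> carrier G \<rightarrow>\<^sub>E carrier K. \<forall>x \<in> carrier G. \<forall>h\<in>H. f (x \<otimes>\<^bsub>G\<^esub> h) = f x}"
  "f \<oplus>\<^bsub>invariant_functions K G H\<^esub> f' = (\<lambda>x \<in> carrier G. f x \<oplus>\<^bsub>K\<^esub> f' x)"
  "\<zero>\<^bsub>invariant_functions K G H\<^esub> = (\<lambda>x \<in> carrier G. \<zero>\<^bsub>K\<^esub>)"
  "a \<odot>\<^bsub>invariant_functions K G H\<^esub> f = (\<lambda>x \<in> carrier G. a \<otimes>\<^bsub>K\<^esub> f x)"
  "act (invariant_functions K G H) g f = (\<lambda>x \<in> carrier G. f (inv\<^bsub>G\<^esub> g \<otimes>\<^bsub>G\<^esub> x))"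
  by (simp_all add: invariant_functions_def group_algebra_tensor_def trivial_gmodule_def)

definition coset_indicator :: "'k ring \<Rightarrow> 'g monoid \<Rightarrow> 'g set \<Rightarrow> 'g \<Rightarrow> 'k" where
  "coset_indicator K G A = (\<lambda>x \<in> carrier G. if x \<in> A then \<one>\<^bsub>K\<^esub> else \<zero>\<^bsub>K\<^esub>)"

definition constant_one :: "'k ring \<Rightarrow> 'g monoid \<Rightarrow> 'g \<Rightarrow> 'k" where
  "constant_one K G = (\<lambda>x \<in> carrier G. \<one>\<^bsub>K\<^esub>)"

definition coset_value :: "('g \<Rightarrow> 'k) \<Rightarrow> 'g set \<Rightarrow> 'k" where
  "coset_value f A = f (SOME x. x \<in> A)"

locale permutation_module = K?: field K + G?: group G
  for K :: "'k ring" and G :: "'g monoid" (structure) and H :: "'g set" +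
  assumes finite_G: "finite (carrier G)" and H: "subgroup H G"
begin

abbreviation "V \<equiv> invariant_functions K G H"
abbreviation "L \<equiv> lcosets\<^bsub>G\<^esub> H"

lemma carrier_V: "f \<in> carrier V \<longleftrightarrow> f \<in> carrier G \<rightarrow>\<^sub>E carrier K \<and> (\<forall>x \<in> carrier G. \<forall>h\<in>H. f (x \<otimes> h) = f x)"
  by (simp add: invariant_functions_simps)

lemma V_in_K: "f \<in> carrier V \<Longrightarrow> x \<in> carrier G \<Longrightarrow> f x \<in> carrier K"
  by (auto simp: carrier_V)

lemma V_eqI:
  assumes "f \<in> carrier V" "f' \<in> carrier V" "\<And>x. x \<in> carrier G \<Longrightarrow> f x = f' x"
  shows "f = f'"
  using assms by (auto simp: carrier_V intro: PiE_ext)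

lemma H_carrier: "h \<in> H \<Longrightarrow> h \<in> carrier G"
  using H by (rule subgroup.mem_carrier)

lemma finite_L: "finite L"
  using lcosets_subset_PowG[OF H] finite_G finite_subset by blast

lemma L_cases:
  assumes "A \<in> L" obtains g where "g \<in> carrier G" "A = g <#\<^bsub>G\<^esub> H"
  using assms by (auto simp: LCOSETS_def)

lemma L_I: "g \<in> carrier G \<Longrightarrow> g <#\<^bsub>G\<^esub> H \<in> L"
  by (auto simp: LCOSETS_def)

lemma L_nonempty: "A \<in> L \<Longrightarrow> (SOME x. x \<in> A) \<in> A"
  by (metis L_cases H lcos_self someI)

lemma L_subset: "A \<in> L \<Longrightarrow> x \<in> A \<Longrightarrow> x \<in> carrier G"
  using lcosets_subset_PowG[OF H] by blast

lemma L_eq: "A \<in> L \<Longrightarrow> x \<in> A \<Longrightarrow> A = x <#\<^bsub>G\<^esub> H"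
  by (metis L_cases H l_repr_independence)

lemma coset_value: "f \<in> carrier V \<Longrightarrow> A \<in> L \<Longrightarrow> x \<in> A \<Longrightarrow> coset_value f A = f x"
proof -
  assume f: "f \<in> carrier V" and A: "A \<in> L" "x \<in> A"
  have "(SOME x. x \<in> A) \<in> x <#\<^bsub>G\<^esub> H" using L_nonempty[OF A(1)] L_eq[OF A] by simp
  then obtain h where "h \<in> H" "(SOME x. x \<in> A) = x \<otimes> h" by (auto simp: l_coset_def)
  then show ?thesis using f L_subset[OF A] by (auto simp: coset_value_def carrier_V)
qed

lemma coset_value_closed: "f \<in> carrier V \<Longrightarrow> A \<in> L \<Longrightarrow> coset_value f A \<in> carrier K"
  unfolding coset_value_def using L_nonempty L_subset V_in_K by blast

lemma coset_value_self: "f \<in> carrier V \<Longrightarrow> x \<in> carrier G \<Longrightarrow> coset_value f (x <#\<^bsub>G\<^esub> H) = f x"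
  using coset_value[OF _ L_I] lcos_self[OF _ H] by blast

lemma V_eqI_cosets:
  assumes "f \<in> carrier V" "f' \<in> carrier V" "\<And>A. A \<in> L \<Longrightarrow> coset_value f A = coset_value f' A"
  shows "f = f'"
  using assms by (intro V_eqI) (auto simp flip: coset_value_self intro: L_I)

lemma coset_mult: "x \<in> carrier G \<Longrightarrow> h \<in> H \<Longrightarrow> A \<in> L \<Longrightarrow> x \<otimes> h \<in> A \<longleftrightarrow> x \<in> A"
proof -
  assume x: "x \<in> carrier G" "h \<in> H" and A: "A \<in> L"
  have xh: "x \<otimes> h \<in> x <#\<^bsub>G\<^esub> H" using x by (auto simp: l_coset_def)
  have "A = x <#\<^bsub>G\<^esub> H" if "x \<otimes> h \<in> A"
    using L_eq[OF A that] l_repr_independence[OF xh x(1) H] by simp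
  then show ?thesis using xh L_eq[OF A] lcos_self[OF x(1) H] by metis
qed

lemma indicator_in_V: "A \<in> L \<Longrightarrow> coset_indicator K G A \<in> carrier V"
  using H_carrier by (auto simp: carrier_V coset_indicator_def coset_mult)

lemma constant_one_in_V: "constant_one K G \<in> carrier V"
  using H_carrier by (auto simp: carrier_V constant_one_def)

lemma coset_value_indicator:
  assumes "A \<in> L" "A' \<in> L"
  shows "coset_value (coset_indicator K G A) A' = (if A = A' then \<one>\<^bsub>K\<^esub> else \<zero>\<^bsub>K\<^esub>)"
proof -
  define x where "x = (SOME x. x \<in> A')"
  have x: "x \<in> A'" unfolding x_def by (rule L_nonempty[OF assms(2)])
  have "x \<in> A \<longleftrightarrow> A = A'" using L_eq[OF assms(1)] L_eq[OF assms(2) x] x by metis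
  then show ?thesis
    using coset_value[OF indicator_in_V[OF assms(1)] assms(2) x] L_subset[OF assms(2) x]
    by (simp add: coset_indicator_def)
qed

text \<open>The indicator functions of the cosets span the module.\<close>
lemma V_induct [consumes 1, case_names zero add]:
  assumes f: "f \<in> carrier V" and zero: "P \<zero>\<^bsub>V\<^esub>"
    and add: "\<And>A a f. A \<in> L \<Longrightarrow> a \<in> carrier K \<Longrightarrow> f \<in> carrier V \<Longrightarrow> P f \<Longrightarrow>
      P (f \<oplus>\<^bsub>V\<^esub> (a \<odot>\<^bsub>V\<^esub> coset_indicator K G A))"
  shows "P f"
proof -
  have "P f" if "finite \<A>" "\<A> \<subseteq> L" "f \<in> carrier V" "\<And>x. x \<in> carrier G \<Longrightarrow> x \<notin> \<Union>\<A> \<Longrightarrow> f x = \<zero>\<^bsub>K\<^esub>" for \<A> f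
    using that
  proof (induction \<A> arbitrary: f rule: finite_induct)
    case empty
    then have "f = \<zero>\<^bsub>V\<^esub>" by (auto simp: carrier_V invariant_functions_simps intro!: PiE_ext)
    then show ?case using zero by simp
  next
    case (insert A \<A>)
    have A: "A \<in> L" using insert.prems by blast
    define f' where "f' = (\<lambda>x \<in> carrier G. if x \<in> A then \<zero>\<^bsub>K\<^esub> else f x)"
    have f': "f' \<in> carrier V"
      using insert.prems(2) coset_mult[OF _ _ A] H_carrier by (auto simp: carrier_V f'_def)
    have "P f'"
    proof (rule insert.IH[OF _ f'])
      show "\<A> \<subseteq> L" using insert.prems(1) by simp
      show "f' x = \<zero>\<^bsub>K\<^esub>" if "x \<in> carrier G" "x \<notin> \<Union>\<A>" for x
        using that insert.prems(3)[of x] by (simp add: f'_def)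
    qed
    then have "P (f' \<oplus>\<^bsub>V\<^esub> (coset_value f A \<odot>\<^bsub>V\<^esub> coset_indicator K G A))"
      using add[OF A] f' coset_value_closed[OF insert.prems(2) A] by blast
    moreover have "f = f' \<oplus>\<^bsub>V\<^esub> (coset_value f A \<odot>\<^bsub>V\<^esub> coset_indicator K G A)"
    proof (rule PiE_ext)
      show "f \<in> carrier G \<rightarrow>\<^sub>E carrier K" using insert.prems(2) by (simp add: carrier_V)
      show "f' \<oplus>\<^bsub>V\<^esub> (coset_value f A \<odot>\<^bsub>V\<^esub> coset_indicator K G A) \<in> carrier G \<rightarrow>\<^sub>E carrier K"
        using V_in_K[OF f'] coset_value_closed[OF insert.prems(2) A]
        by (auto simp: invariant_functions_simps coset_indicator_def)
      fix x assume x: "x \<in> carrier G"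
      show "f x = (f' \<oplus>\<^bsub>V\<^esub> (coset_value f A \<odot>\<^bsub>V\<^esub> coset_indicator K G A)) x"
        using x V_in_K[OF insert.prems(2) x] coset_value_closed[OF insert.prems(2) A]
          coset_value[OF insert.prems(2) A]
        by (simp add: invariant_functions_simps coset_indicator_def f'_def)
    qed
    ultimately show ?case by simp
  qed
  from this[of L f] show ?thesis
    using finite_L f lcosets_part_G[OF H] by simp
qed

lemma V_apply:
  assumes "x \<in> carrier G"
  shows "(f \<oplus>\<^bsub>V\<^esub> f') x = f x \<oplus>\<^bsub>K\<^esub> f' x" "\<zero>\<^bsub>V\<^esub> x = \<zero>\<^bsub>K\<^esub>" "(a \<odot>\<^bsub>V\<^esub> f) x = a \<otimes>\<^bsub>K\<^esub> f x"
    "act V g f x = f (inv g \<otimes> x)"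
  using assms by (simp_all add: invariant_functions_simps)

lemma V_closed:
  shows "f \<in> carrier V \<Longrightarrow> f' \<in> carrier V \<Longrightarrow> f \<oplus>\<^bsub>V\<^esub> f' \<in> carrier V" "\<zero>\<^bsub>V\<^esub> \<in> carrier V"
    "a \<in> carrier K \<Longrightarrow> f \<in> carrier V \<Longrightarrow> a \<odot>\<^bsub>V\<^esub> f \<in> carrier V"
    "g \<in> carrier G \<Longrightarrow> f \<in> carrier V \<Longrightarrow> act V g f \<in> carrier V"
proof -
  have ext: "f \<in> carrier V" if "f \<in> extensional (carrier G)" "\<And>x. x \<in> carrier G \<Longrightarrow> f x \<in> carrier K"
    "\<And>x h. x \<in> carrier G \<Longrightarrow> h \<in> H \<Longrightarrow> f (x \<otimes> h) = f x" for f
    using that by (auto simp: carrier_V PiE_def)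
  have inv: "f (x \<otimes> h) = f x" if "f \<in> carrier V" "x \<in> carrier G" "h \<in> H" for f x h
    using that by (simp add: carrier_V)
  show "f \<in> carrier V \<Longrightarrow> f' \<in> carrier V \<Longrightarrow> f \<oplus>\<^bsub>V\<^esub> f' \<in> carrier V"
    by (rule ext) (simp_all add: invariant_functions_simps(2) V_in_K inv H_carrier)
  show "\<zero>\<^bsub>V\<^esub> \<in> carrier V"
    by (rule ext) (simp_all add: invariant_functions_simps(3) H_carrier)
  show "a \<in> carrier K \<Longrightarrow> f \<in> carrier V \<Longrightarrow> a \<odot>\<^bsub>V\<^esub> f \<in> carrier V"
    by (rule ext) (simp_all add: invariant_functions_simps(4) V_in_K inv H_carrier)
  show "g \<in> carrier G \<Longrightarrow> f \<in> carrier V \<Longrightarrow> act V g f \<in> carrier V"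
    by (rule ext) (simp_all add: invariant_functions_simps(5) V_in_K inv H_carrier flip: m_assoc)
qed

lemma invariant_functions_module: "kG_module K G V"
proof -
  have ab: "abelian_group V"
  proof (rule abelian_groupI)
    show "\<exists>y\<in>carrier V. y \<oplus>\<^bsub>V\<^esub> f = \<zero>\<^bsub>V\<^esub>" if f: "f \<in> carrier V" for f
    proof
      show c: "(\<ominus>\<^bsub>K\<^esub> \<one>\<^bsub>K\<^esub>) \<odot>\<^bsub>V\<^esub> f \<in> carrier V" using f by (simp add: V_closed)
      show "(\<ominus>\<^bsub>K\<^esub> \<one>\<^bsub>K\<^esub>) \<odot>\<^bsub>V\<^esub> f \<oplus>\<^bsub>V\<^esub> f = \<zero>\<^bsub>V\<^esub>"
        by (rule V_eqI[OF V_closed(1)[OF c f] V_closed(2)]) (simp add: V_apply V_in_K[OF f] l_minus l_neg)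
    qed
    show "f \<oplus>\<^bsub>V\<^esub> f' \<in> carrier V" if "f \<in> carrier V" "f' \<in> carrier V" for f f'
      using that by (rule V_closed)
    show "\<zero>\<^bsub>V\<^esub> \<in> carrier V" by (rule V_closed)
    show "f \<oplus>\<^bsub>V\<^esub> f' \<oplus>\<^bsub>V\<^esub> f'' = f \<oplus>\<^bsub>V\<^esub> (f' \<oplus>\<^bsub>V\<^esub> f'')"
      if "f \<in> carrier V" "f' \<in> carrier V" "f'' \<in> carrier V" for f f' f''
      by (rule V_eqI) (simp_all add: that V_closed V_apply V_in_K a_assoc)
    show "f \<oplus>\<^bsub>V\<^esub> f' = f' \<oplus>\<^bsub>V\<^esub> f" if "f \<in> carrier V" "f' \<in> carrier V" for f f'
      by (rule V_eqI) (simp_all add: that V_closed V_apply V_in_K a_comm)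
    show "\<zero>\<^bsub>V\<^esub> \<oplus>\<^bsub>V\<^esub> f = f" if "f \<in> carrier V" for f
      by (rule V_eqI) (simp_all add: that V_closed V_apply V_in_K)
  qed
  have mod: "module K V"
  proof (rule moduleI[OF is_cring ab])
    show "a \<odot>\<^bsub>V\<^esub> f \<in> carrier V" if "a \<in> carrier K" "f \<in> carrier V" for a f
      using that by (rule V_closed)
    show "(a \<oplus>\<^bsub>K\<^esub> b) \<odot>\<^bsub>V\<^esub> f = a \<odot>\<^bsub>V\<^esub> f \<oplus>\<^bsub>V\<^esub> b \<odot>\<^bsub>V\<^esub> f"
      if "a \<in> carrier K" "b \<in> carrier K" "f \<in> carrier V" for a b f
      by (rule V_eqI) (simp_all add: that V_closed V_apply V_in_K l_distr)
    show "a \<odot>\<^bsub>V\<^esub> (f \<oplus>\<^bsub>V\<^esub> f') = a \<odot>\<^bsub>V\<^esub> f \<oplus>\<^bsub>V\<^esub> a \<odot>\<^bsub>V\<^esub> f'"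
      if "a \<in> carrier K" "f \<in> carrier V" "f' \<in> carrier V" for a f f'
      by (rule V_eqI) (simp_all add: that V_closed V_apply V_in_K r_distr)
    show "(a \<otimes>\<^bsub>K\<^esub> b) \<odot>\<^bsub>V\<^esub> f = a \<odot>\<^bsub>V\<^esub> (b \<odot>\<^bsub>V\<^esub> f)"
      if "a \<in> carrier K" "b \<in> carrier K" "f \<in> carrier V" for a b f
      by (rule V_eqI) (simp_all add: that V_closed V_apply V_in_K K.m_assoc)
    show "\<one>\<^bsub>K\<^esub> \<odot>\<^bsub>V\<^esub> f = f" if "f \<in> carrier V" for f
      by (rule V_eqI) (simp_all add: that V_closed V_apply V_in_K)
  qed
  have "N = carrier V" if N: "kG_submodule K G V N" "coset_indicator K G ` L \<subseteq> N" for N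
  proof -
    interpret M: module K V by fact
    have s: "submodule N K V" using N by (simp add: kG_submodule_def)
    have "f \<in> N" if "f \<in> carrier V" for f
      using that
    proof (induction rule: V_induct)
      case zero
      then show ?case using subgroup.one_closed[OF submodule.axioms(1)[OF s]] by simp
    next
      case (add A a f)
      then show ?case using M.submoduleE(4,5)[OF s] N(2) by blast
    qed
    then show ?thesis using M.submoduleE(1)[OF s] by blast
  qed
  moreover have "coset_indicator K G ` L \<subseteq> carrier V" using indicator_in_V by blast
  ultimately have fg: "\<exists>A. finite A \<and> A \<subseteq> carrier V \<and> (\<forall>N. kG_submodule K G V N \<and> A \<subseteq> N \<longrightarrow> N = carrier V)"
    using finite_L by (intro exI[of _ "coset_indicator K G ` L"]) blast
  show ?thesis
  proof (intro kG_module.intro kG_module_axioms.intro)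
    show "field K" by unfold_locales
    show "group G" by unfold_locales
    show "module K V" by (fact mod)
    show "act V g f \<in> carrier V" if "g \<in> carrier G" "f \<in> carrier V" for g f
      using that by (rule V_closed)
    show "act V \<one> f = f" if f: "f \<in> carrier V" for f
      by (rule V_eqI) (simp_all add: f V_closed V_apply)
    show "act V (g \<otimes> h) f = act V g (act V h f)"
      if "g \<in> carrier G" "h \<in> carrier G" "f \<in> carrier V" for g h f
      by (rule V_eqI) (simp_all add: that V_closed V_apply inv_mult_group m_assoc)
    show "act V g (f \<oplus>\<^bsub>V\<^esub> f') = act V g f \<oplus>\<^bsub>V\<^esub> act V g f'"
      if "g \<in> carrier G" "f \<in> carrier V" "f' \<in> carrier V" for g f f'
      by (rule V_eqI) (simp_all add: that V_closed V_apply)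
    show "act V g (a \<odot>\<^bsub>V\<^esub> f) = a \<odot>\<^bsub>V\<^esub> act V g f"
      if "g \<in> carrier G" "a \<in> carrier K" "f \<in> carrier V" for g a f
      by (rule V_eqI) (simp_all add: that V_closed V_apply)
  qed (fact fg)
qed

end

sublocale permutation_module \<subseteq> V: kG_module K G "invariant_functions K G H"
  by (rule invariant_functions_module)

context permutation_module
begin

text \<open>
  The indicator functions form a basis, with \<open>coset_value f A\<close> as coordinates of \<open>f\<close>. The functional
  \<open>l\<close> is a mere function with linearity assumed on \<open>V\<close>; it is used for coordinates of endomorphisms.
\<close>
lemma functional_expansion:
  assumes closed: "\<And>f. f \<in> carrier V \<Longrightarrow> l f \<in> carrier K"
    and add: "\<And>f f'. f \<in> carrier V \<Longrightarrow> f' \<in> carrier V \<Longrightarrow> l (f \<oplus>\<^bsub>V\<^esub> f') = l f \<oplus>\<^bsub>K\<^esub> l f'"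
    and smult: "\<And>a f. a \<in> carrier K \<Longrightarrow> f \<in> carrier V \<Longrightarrow> l (a \<odot>\<^bsub>V\<^esub> f) = a \<otimes>\<^bsub>K\<^esub> l f"
    and f: "f \<in> carrier V"
  shows "l f = finsum K (\<lambda>A. coset_value f A \<otimes>\<^bsub>K\<^esub> l (coset_indicator K G A)) L"
  using f
proof (induction rule: V_induct)
  case zero
  have z: "\<zero>\<^bsub>V\<^esub> \<in> carrier V" by simp
  have "l \<zero>\<^bsub>V\<^esub> = l (\<zero>\<^bsub>K\<^esub> \<odot>\<^bsub>V\<^esub> \<zero>\<^bsub>V\<^esub>)" by simp
  also have "\<dots> = \<zero>\<^bsub>K\<^esub>" using smult[OF _ z, of "\<zero>\<^bsub>K\<^esub>"] closed[OF z] by simp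
  finally have lz: "l \<zero>\<^bsub>V\<^esub> = \<zero>\<^bsub>K\<^esub>" .
  have v: "coset_value \<zero>\<^bsub>V\<^esub> A = \<zero>\<^bsub>K\<^esub>" if "A \<in> L" for A
    using L_subset[OF that L_nonempty[OF that]] by (simp add: coset_value_def invariant_functions_simps)
  have "finsum K (\<lambda>A. coset_value \<zero>\<^bsub>V\<^esub> A \<otimes>\<^bsub>K\<^esub> l (coset_indicator K G A)) L = finsum K (\<lambda>_. \<zero>\<^bsub>K\<^esub>) L"
    using v closed[OF indicator_in_V] by (intro finsum_cong') auto
  then show ?case using lz by simp
next
  case (add A a f)
  let ?d = "\<lambda>A. l (coset_indicator K G A)"
  have d: "?d A' \<in> carrier K" if "A' \<in> L" for A' using closed[OF indicator_in_V[OF that]] .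
  have cv: "coset_value f A' \<in> carrier K" if "A' \<in> L" for A' using coset_value_closed[OF add.hyps(3) that] .
  have v: "coset_value (f \<oplus>\<^bsub>V\<^esub> a \<odot>\<^bsub>V\<^esub> coset_indicator K G A) A' =
      coset_value f A' \<oplus>\<^bsub>K\<^esub> (if A = A' then a else \<zero>\<^bsub>K\<^esub>)" if A': "A' \<in> L" for A'
    using L_subset[OF A' L_nonempty[OF A']] coset_value_indicator[OF add.hyps(1) A'] add.hyps(2)
    by (simp add: coset_value_def invariant_functions_simps)
  have "finsum K (\<lambda>A'. coset_value (f \<oplus>\<^bsub>V\<^esub> a \<odot>\<^bsub>V\<^esub> coset_indicator K G A) A' \<otimes>\<^bsub>K\<^esub> ?d A') L =
      finsum K (\<lambda>A'. coset_value f A' \<otimes>\<^bsub>K\<^esub> ?d A' \<oplus>\<^bsub>K\<^esub> (if A = A' then a \<otimes>\<^bsub>K\<^esub> ?d A' else \<zero>\<^bsub>K\<^esub>)) L"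
    by (intro finsum_cong') (use v d cv add.hyps in \<open>auto simp: l_distr\<close>)
  also have "\<dots> = finsum K (\<lambda>A'. coset_value f A' \<otimes>\<^bsub>K\<^esub> ?d A') L \<oplus>\<^bsub>K\<^esub>
      finsum K (\<lambda>A'. if A = A' then a \<otimes>\<^bsub>K\<^esub> ?d A' else \<zero>\<^bsub>K\<^esub>) L"
    by (intro finsum_addf) (use d cv add.hyps in auto)
  also have "finsum K (\<lambda>A'. if A = A' then a \<otimes>\<^bsub>K\<^esub> ?d A' else \<zero>\<^bsub>K\<^esub>) L = a \<otimes>\<^bsub>K\<^esub> ?d A"
    by (intro add.finprod_singleton[where f = "\<lambda>A'. a \<otimes>\<^bsub>K\<^esub> ?d A'"]) (use d finite_L add.hyps in auto)
  finally show ?case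
    using add.IH assms(2)[OF add.hyps(3) V.smult_closed[OF add.hyps(2) indicator_in_V[OF add.hyps(1)]]]
      smult[OF add.hyps(2) indicator_in_V[OF add.hyps(1)]] by simp
qed

lemma constant_if_fixed:
  assumes f: "f \<in> carrier V" and fixed: "\<And>g. g \<in> carrier G \<Longrightarrow> act V g f = f"
  shows "f = f \<one> \<odot>\<^bsub>V\<^esub> constant_one K G"
proof (rule V_eqI[OF f])
  show "f \<one> \<odot>\<^bsub>V\<^esub> constant_one K G \<in> carrier V"
    using V_in_K[OF f] constant_one_in_V by simp
  fix x assume x: "x \<in> carrier G"
  have "act V x f x = f x" using fixed[OF x] by simp
  then show "f x = (f \<one> \<odot>\<^bsub>V\<^esub> constant_one K G) x"
    using x V_in_K[OF f] by (simp add: invariant_functions_simps constant_one_def)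
qed

text \<open>
  The images of the basis vectors together with \<open>w\<close> are one more than the coordinates, so they satisfy
  a nontrivial linear relation. Injectivity makes the coefficient of \<open>w\<close> in it nonzero. The unknowns
  are indexed by \<open>None\<close> for \<open>w\<close> and by \<open>Some A\<close> for the image of the indicator function of \<open>A\<close>.
\<close>
lemma injective_endomorphism_surjective:
  assumes \<phi>: "\<phi> \<in> kG_hom K G V V" and inj: "inj_on \<phi> (carrier V)"
  shows "bij_betw \<phi> (carrier V) (carrier V)"
proof -
  note F = kG_homE[OF \<phi>]
  have V: "kG_module K G V" by unfold_locales
  have "w \<in> \<phi> ` carrier V" if w: "w \<in> carrier V" for w
  proof -
    let ?d = "coset_indicator K G"
    let ?Y = "insert None (Some ` L)"
    let ?c = "\<lambda>A y. case y of None \<Rightarrow> coset_value w A | Some A' \<Rightarrow> coset_value (\<phi> (?d A')) A"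
    have \<phi>d: "\<phi> (?d A) \<in> carrier V" if "A \<in> L" for A using F(1) indicator_in_V[OF that] by simp
    have ccl: "?c A y \<in> carrier K" if "A \<in> L" "y \<in> ?Y" for A y
      using that coset_value_closed[OF w] coset_value_closed[OF \<phi>d] by auto
    have cardY: "card L < card ?Y" using finite_L by (simp add: card_image)
    obtain v where v: "\<forall>y\<in>?Y. v y \<in> carrier K" "\<exists>y\<in>?Y. v y \<noteq> \<zero>\<^bsub>K\<^esub>"
      "\<forall>A\<in>L. finsum K (\<lambda>y. ?c A y \<otimes>\<^bsub>K\<^esub> v y) ?Y = \<zero>\<^bsub>K\<^esub>"
      using underdetermined_system[OF finite_L _ cardY, of ?c] ccl finite_L by auto
    define u where "u = (\<lambda>x \<in> carrier G. v (Some (x <#\<^bsub>G\<^esub> H)))"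
    have u: "u \<in> carrier V"
    proof -
      have "x \<otimes> h <#\<^bsub>G\<^esub> H = x <#\<^bsub>G\<^esub> H" if "x \<in> carrier G" "h \<in> H" for x h
        using l_repr_independence[of "x \<otimes> h" x H] that H by (auto simp: l_coset_def)
      then show ?thesis using v(1) L_I H_carrier by (auto simp: carrier_V u_def)
    qed
    have cu: "coset_value u A = v (Some A)" if A: "A \<in> L" for A
      using A coset_value_self[OF u] by (auto elim!: L_cases simp: u_def)
    have eq: "coset_value (\<phi> u) A \<oplus>\<^bsub>K\<^esub> coset_value w A \<otimes>\<^bsub>K\<^esub> v None = \<zero>\<^bsub>K\<^esub>" if A: "A \<in> L" for A
    proof -
      have AG: "(SOME x. x \<in> A) \<in> carrier G" using L_subset[OF A L_nonempty[OF A]] .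
      have "coset_value (\<phi> u) A = finsum K (\<lambda>A'. coset_value u A' \<otimes>\<^bsub>K\<^esub> coset_value (\<phi> (?d A')) A) L"
        by (rule functional_expansion[where l = "\<lambda>f. coset_value (\<phi> f) A"])
          (use F AG coset_value_closed[OF _ A] u in \<open>auto simp: coset_value_def invariant_functions_simps(2,4)\<close>)
      also have "\<dots> = finsum K (\<lambda>A'. ?c A (Some A') \<otimes>\<^bsub>K\<^esub> v (Some A')) L"
        by (intro finsum_cong') (use cu v(1) \<phi>d coset_value_closed[OF _ A] m_comm in auto)
      also have "\<dots> = finsum K (\<lambda>y. ?c A y \<otimes>\<^bsub>K\<^esub> v y) (Some ` L)"
        by (rule finsum_reindex[symmetric]) (use coset_value_closed[OF \<phi>d A] v(1) in auto)
      finally have s: "coset_value (\<phi> u) A = \<dots>" .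
      have "finsum K (\<lambda>y. ?c A y \<otimes>\<^bsub>K\<^esub> v y) ?Y =
          ?c A None \<otimes>\<^bsub>K\<^esub> v None \<oplus>\<^bsub>K\<^esub> finsum K (\<lambda>y. ?c A y \<otimes>\<^bsub>K\<^esub> v y) (Some ` L)"
        by (intro finsum_insert) (use finite_L coset_value_closed[OF w A] coset_value_closed[OF \<phi>d A] v(1) in auto)
      then have "\<zero>\<^bsub>K\<^esub> = coset_value w A \<otimes>\<^bsub>K\<^esub> v None \<oplus>\<^bsub>K\<^esub> coset_value (\<phi> u) A"
        using v(3) A s by simp
      then show ?thesis
        using coset_value_closed[OF w A] coset_value_closed[OF F(1)[OF u] A] v(1) by (simp add: a_comm)
    qed
    define a where "a = v None"
    have a: "a \<in> carrier K" using v(1) by (simp add: a_def)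
    have rel: "\<phi> u \<oplus>\<^bsub>V\<^esub> a \<odot>\<^bsub>V\<^esub> w = \<zero>\<^bsub>V\<^esub>"
    proof (rule V_eqI_cosets)
      show "\<phi> u \<oplus>\<^bsub>V\<^esub> a \<odot>\<^bsub>V\<^esub> w \<in> carrier V" using F(1)[OF u] a w by simp
      fix A assume A: "A \<in> L"
      show "coset_value (\<phi> u \<oplus>\<^bsub>V\<^esub> a \<odot>\<^bsub>V\<^esub> w) A = coset_value \<zero>\<^bsub>V\<^esub> A"
        using eq[OF A] L_subset[OF A L_nonempty[OF A]] coset_value_closed[OF w A] a
        by (simp add: coset_value_def invariant_functions_simps(2-4) a_def m_comm)
    qed simp
    have a0: "a \<noteq> \<zero>\<^bsub>K\<^esub>"
    proof
      assume z: "a = \<zero>\<^bsub>K\<^esub>"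
      then have "\<phi> u = \<phi> \<zero>\<^bsub>V\<^esub>" using rel w F(1)[OF u] V.hom_zero[OF V \<phi>] by simp
      then have "u = \<zero>\<^bsub>V\<^esub>" using inj_onD[OF inj] u by simp
      then have "v (Some A) = \<zero>\<^bsub>K\<^esub>" if "A \<in> L" for A
        using cu[OF that] L_subset[OF that L_nonempty[OF that]]
        by (simp add: coset_value_def invariant_functions_simps)
      then show False using v(2) z by (auto simp: a_def)
    qed
    define b where "b = inv\<^bsub>K\<^esub> a"
    have b: "b \<in> carrier K" "b \<otimes>\<^bsub>K\<^esub> a = \<one>\<^bsub>K\<^esub>" unfolding b_def using a a0 field_Units by auto
    have "\<phi> ((\<ominus>\<^bsub>K\<^esub> b) \<odot>\<^bsub>V\<^esub> u) = (\<ominus>\<^bsub>K\<^esub> b) \<odot>\<^bsub>V\<^esub> \<phi> u" using F(3) b u by simp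
    also have "\<phi> u = \<ominus>\<^bsub>V\<^esub> (a \<odot>\<^bsub>V\<^esub> w)" using rel F(1)[OF u] a w by (simp add: V.minus_equality)
    also have "(\<ominus>\<^bsub>K\<^esub> b) \<odot>\<^bsub>V\<^esub> \<ominus>\<^bsub>V\<^esub> (a \<odot>\<^bsub>V\<^esub> w) = (b \<otimes>\<^bsub>K\<^esub> a) \<odot>\<^bsub>V\<^esub> w"
      using a b(1) w by (simp add: V.smult_l_minus V.smult_r_minus V.smult_assoc1)
    also have "\<dots> = w" using b w by simp
    finally show ?thesis using b(1) u by (metis K.a_inv_closed V.smult_closed imageI)
  qed
  then show ?thesis using inj F(1) by (auto simp: bij_betw_def)
qed

end

section \<open>Induced modules\<close>

context permutation_module
begin

text \<open>
  The quotient of the group algebra by the balancing relations, realised on functions: it sends the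
  basis vector \<open>x\<close> to the indicator function of \<open>xH\<close>.
\<close>
definition coset_sum :: "('g \<Rightarrow> 'k) \<Rightarrow> 'g \<Rightarrow> 'k" where
  "coset_sum f = (\<lambda>x \<in> carrier G. finsum K (\<lambda>h. f (x \<otimes> h)) H)"

abbreviation "U \<equiv> invariant_functions K G {\<one>}"

lemma tensor_eq: "group_algebra_tensor G (trivial_gmodule K) = U"
proof -
  have "{f \<in> carrier G \<rightarrow>\<^sub>E carrier K. \<forall>x \<in> carrier G. \<forall>h\<in>{\<one>}. f (x \<otimes> h) = f x} =
      carrier G \<rightarrow>\<^sub>E carrier K" by auto
  then show ?thesis
    by (simp add: invariant_functions_def group_algebra_tensor_def trivial_gmodule_def)
qed

lemma permutation_module_U: "permutation_module K G {\<one>}"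
  by (intro permutation_module.intro permutation_module_axioms.intro field_axioms group_axioms finite_G triv_subgroup)

lemma finite_H: "finite H"
  using finite_subset[OF subgroup.subset[OF H] finite_G] .

lemma coset_sum_hom: "coset_sum \<in> kG_hom K G U V"
proof -
  interpret U: permutation_module K G "{\<one>}" by (rule permutation_module_U)
  have cl: "f (x \<otimes> h) \<in> carrier K" if "f \<in> carrier U" "x \<in> carrier G" "h \<in> H" for f x h
    using that U.V_in_K H_carrier by simp
  have app: "coset_sum f x = finsum K (\<lambda>h. f (x \<otimes> h)) H" if "x \<in> carrier G" for f x
    using that by (simp add: coset_sum_def)
  have clV: "coset_sum f \<in> carrier V" if f: "f \<in> carrier U" for f
  proof -
    have "coset_sum f (x \<otimes> k) = coset_sum f x" if x: "x \<in> carrier G" and k: "k \<in> H" for x k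
    proof -
      have kG: "k \<in> carrier G" using H_carrier[OF k] .
      have inj: "inj_on (\<lambda>h. k \<otimes> h) H" using kG H_carrier by (auto intro!: inj_onI)
      have im: "(\<lambda>h. k \<otimes> h) ` H = H"
      proof
        show "(\<lambda>h. k \<otimes> h) ` H \<subseteq> H" using subgroup.m_closed[OF H k] by blast
        show "H \<subseteq> (\<lambda>h. k \<otimes> h) ` H"
        proof
          fix h assume h: "h \<in> H"
          have "h = k \<otimes> (inv k \<otimes> h)" using kG H_carrier[OF h] by (simp flip: G.m_assoc)
          then show "h \<in> (\<lambda>h. k \<otimes> h) ` H"
            using subgroup.m_closed[OF H subgroup.m_inv_closed[OF H k] h] by blast
        qed
      qed
      have "coset_sum f x = finsum K (\<lambda>h. f (x \<otimes> h)) ((\<lambda>h. k \<otimes> h) ` H)"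
        using app[OF x] im by simp
      also have "\<dots> = finsum K (\<lambda>h. f (x \<otimes> (k \<otimes> h))) H"
        by (rule finsum_reindex) (use inj im cl[OF f x] in auto)
      also have "\<dots> = finsum K (\<lambda>h. f (x \<otimes> k \<otimes> h)) H"
      proof (rule finsum_cong'[OF refl])
        show "(\<lambda>h. f (x \<otimes> k \<otimes> h)) \<in> H \<rightarrow> carrier K" using cl[OF f, of "x \<otimes> k"] x kG by simp
        show "f (x \<otimes> (k \<otimes> h)) = f (x \<otimes> k \<otimes> h)" if "h \<in> H" for h
          using x kG H_carrier[OF that] by (simp add: G.m_assoc)
      qed
      also have "\<dots> = coset_sum f (x \<otimes> k)" using app x kG by simp
      finally show ?thesis by simp
    qed
    moreover have "coset_sum f \<in> carrier G \<rightarrow>\<^sub>E carrier K"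
      using cl[OF f] by (auto simp: coset_sum_def intro!: finsum_closed)
    ultimately show ?thesis by (simp add: carrier_V)
  qed
  show ?thesis
  proof (rule kG_homI)
    show "coset_sum f \<in> carrier V" if "f \<in> carrier U" for f using clV that .
  next
    fix f f' assume f: "f \<in> carrier U" "f' \<in> carrier U"
    show "coset_sum (f \<oplus>\<^bsub>U\<^esub> f') = coset_sum f \<oplus>\<^bsub>V\<^esub> coset_sum f'"
    proof (rule V_eqI)
      fix x assume x: "x \<in> carrier G"
      have "coset_sum (f \<oplus>\<^bsub>U\<^esub> f') x = finsum K (\<lambda>h. f (x \<otimes> h) \<oplus>\<^bsub>K\<^esub> f' (x \<otimes> h)) H"
        unfolding app[OF x]
        by (rule finsum_cong') (use f cl x H_carrier in \<open>auto simp: U.V_apply\<close>)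
      also have "\<dots> = coset_sum f x \<oplus>\<^bsub>K\<^esub> coset_sum f' x"
        unfolding app[OF x] by (rule finsum_addf) (use f cl x in auto)
      finally show "coset_sum (f \<oplus>\<^bsub>U\<^esub> f') x = (coset_sum f \<oplus>\<^bsub>V\<^esub> coset_sum f') x" using x by (simp add: V_apply)
    qed (use f clV in simp_all)
  next
    fix a f assume a: "a \<in> carrier K" and f: "f \<in> carrier U"
    show "coset_sum (a \<odot>\<^bsub>U\<^esub> f) = a \<odot>\<^bsub>V\<^esub> coset_sum f"
    proof (rule V_eqI)
      fix x assume x: "x \<in> carrier G"
      have "coset_sum (a \<odot>\<^bsub>U\<^esub> f) x = finsum K (\<lambda>h. a \<otimes>\<^bsub>K\<^esub> f (x \<otimes> h)) H"
        unfolding app[OF x]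
        by (rule finsum_cong') (use f cl x a H_carrier in \<open>auto simp: U.V_apply\<close>)
      also have "\<dots> = a \<otimes>\<^bsub>K\<^esub> coset_sum f x"
        unfolding app[OF x] by (rule finsum_rdistr[symmetric]) (use f cl x a finite_H in auto)
      finally show "coset_sum (a \<odot>\<^bsub>U\<^esub> f) x = (a \<odot>\<^bsub>V\<^esub> coset_sum f) x" using x by (simp add: V_apply)
    qed (use a f clV in simp_all)
  next
    fix g f assume g: "g \<in> carrier G" and f: "f \<in> carrier U"
    show "coset_sum (act U g f) = act V g (coset_sum f)"
    proof (rule V_eqI)
      fix x assume x: "x \<in> carrier G"
      have "coset_sum (act U g f) x = finsum K (\<lambda>h. f (inv g \<otimes> x \<otimes> h)) H"
        unfolding app[OF x]
      proof (rule finsum_cong'[OF refl])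
        show "(\<lambda>h. f (inv g \<otimes> x \<otimes> h)) \<in> H \<rightarrow> carrier K" using cl[OF f, of "inv g \<otimes> x"] x g by simp
        show "act U g f (x \<otimes> h) = f (inv g \<otimes> x \<otimes> h)" if "h \<in> H" for h
          using x g H_carrier[OF that] by (simp add: U.V_apply G.m_assoc)
      qed
      also have "\<dots> = coset_sum f (inv g \<otimes> x)" using app x g by simp
      finally show "coset_sum (act U g f) x = act V g (coset_sum f) x" using x by (simp add: V_apply)
    qed (use g f clV V_closed(4) U.V_closed(4) in simp_all)
  qed
qed

lemma coset_sum_apply: "x \<in> carrier G \<Longrightarrow> coset_sum f x = finsum K (\<lambda>h. f (x \<otimes> h)) H"
  by (simp add: coset_sum_def)

lemma pure_tensor_in_U: "v \<in> carrier K \<Longrightarrow> pure_tensor G (trivial_gmodule K) x v \<in> carrier U"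
  by (auto simp: invariant_functions_simps pure_tensor_def trivial_gmodule_def)

lemma pure_tensor_apply:
  "y \<in> carrier G \<Longrightarrow> pure_tensor G (trivial_gmodule K) x v y = (if y = x then v else \<zero>\<^bsub>K\<^esub>)"
  by (simp add: pure_tensor_def trivial_gmodule_def)

lemma coset_sum_pure_tensor:
  assumes z: "z \<in> carrier G" and v: "v \<in> carrier K" and y: "y \<in> carrier G"
  shows "coset_sum (pure_tensor G (trivial_gmodule K) z v) y = (if inv y \<otimes> z \<in> H then v else \<zero>\<^bsub>K\<^esub>)"
proof -
  have "coset_sum (pure_tensor G (trivial_gmodule K) z v) y =
      finsum K (\<lambda>h. if inv y \<otimes> z = h then v else \<zero>\<^bsub>K\<^esub>) H"
    unfolding coset_sum_apply[OF y]
  proof (rule finsum_cong'[OF refl])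
    fix h assume h: "h \<in> H"
    have "y \<otimes> h = z \<longleftrightarrow> inv y \<otimes> z = h" using y z H_carrier[OF h] by (auto simp: inv_solve_left')
    then show "pure_tensor G (trivial_gmodule K) z v (y \<otimes> h) = (if inv y \<otimes> z = h then v else \<zero>\<^bsub>K\<^esub>)"
      using y H_carrier[OF h] by (simp add: pure_tensor_apply)
  qed (use v in auto)
  also have "\<dots> = (if inv y \<otimes> z \<in> H then v else \<zero>\<^bsub>K\<^esub>)"
  proof (cases "inv y \<otimes> z \<in> H")
    case True
    then show ?thesis using K.add.finprod_singleton[OF True finite_H, of "\<lambda>_. v"] v by simp
  next
    case False
    have "finsum K (\<lambda>h. if inv y \<otimes> z = h then v else \<zero>\<^bsub>K\<^esub>) H = finsum K (\<lambda>_. \<zero>\<^bsub>K\<^esub>) H"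
      by (rule finsum_cong') (use False in auto)
    then show ?thesis using False by simp
  qed
  finally show ?thesis .
qed

text \<open>
  If the sums of \<open>f\<close> over all cosets of \<open>H\<close> vanish and \<open>f(x) \<noteq> 0\<close>, then \<open>f\<close> is nonzero at a second
  point \<open>xh\<close> of the coset of \<open>x\<close>. Moving the value \<open>f(x)\<close> from \<open>x\<close> to \<open>xh\<close> is the addition of a balancing
  relation and makes the support smaller.
\<close>
lemma balancing_subspace_eq:
  "balancing_subspace K G H (trivial_gmodule K) = {f \<in> carrier U. coset_sum f = \<zero>\<^bsub>V\<^esub>}"
proof -
  interpret U: permutation_module K G "{\<one>}" by (rule permutation_module_U)
  have Vm: "kG_module K G V" and Um: "kG_module K G U" by unfold_locales
  let ?pt = "pure_tensor G (trivial_gmodule K)"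
  let ?ker = "{f \<in> carrier U. coset_sum f = \<zero>\<^bsub>V\<^esub>}"
  let ?ok = "\<lambda>N. submodule N K U \<and>
        (\<forall>x \<in> carrier G. \<forall>h\<in>H. \<forall>v \<in> carrier K. ?pt (x \<otimes> h) v \<ominus>\<^bsub>U\<^esub> ?pt x v \<in> N)"
  have bal: "balancing_subspace K G H (trivial_gmodule K) = \<Inter> {N. ?ok N}"
    unfolding balancing_subspace_def tensor_eq by (simp add: trivial_gmodule_def)
  have diff: "?pt (x \<otimes> h) v \<ominus>\<^bsub>U\<^esub> ?pt x v \<in> ?ker"
    if xhv: "x \<in> carrier G" "h \<in> H" "v \<in> carrier K" for x h v
  proof -
    have xh: "x \<otimes> h \<in> carrier G" using xhv H_carrier by simp
    have "coset_sum (?pt (x \<otimes> h) v) = coset_sum (?pt x v)"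
    proof (rule V_eqI)
      fix y assume y: "y \<in> carrier G"
      have "inv y \<otimes> (x \<otimes> h) \<in> H \<longleftrightarrow> inv y \<otimes> x \<in> H"
      proof
        assume "inv y \<otimes> (x \<otimes> h) \<in> H"
        then have "inv y \<otimes> (x \<otimes> h) \<otimes> inv h \<in> H"
          using subgroup.m_closed[OF H _ subgroup.m_inv_closed[OF H xhv(2)]] by blast
        then show "inv y \<otimes> x \<in> H" using xhv y H_carrier[OF xhv(2)] by (simp add: G.m_assoc)
      next
        assume "inv y \<otimes> x \<in> H"
        then have "inv y \<otimes> x \<otimes> h \<in> H" using subgroup.m_closed[OF H _ xhv(2)] by blast
        then show "inv y \<otimes> (x \<otimes> h) \<in> H" using xhv y H_carrier[OF xhv(2)] by (simp add: G.m_assoc)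
      qed
      then show "coset_sum (?pt (x \<otimes> h) v) y = coset_sum (?pt x v) y"
        using coset_sum_pure_tensor[OF xh xhv(3) y] coset_sum_pure_tensor[OF xhv(1,3) y] by simp
    qed (use kG_homE(1)[OF coset_sum_hom] pure_tensor_in_U xhv in simp_all)
    then show ?thesis
      using U.V.hom_minus[OF Vm coset_sum_hom pure_tensor_in_U[OF xhv(3)] pure_tensor_in_U[OF xhv(3)], of "x \<otimes> h" x]
        pure_tensor_in_U[OF xhv(3)] kG_homE(1)[OF coset_sum_hom pure_tensor_in_U[OF xhv(3)]]
      by simp
  qed
  have "?ok ?ker"
    using U.V.kernel_submodule[OF Vm coset_sum_hom] diff by (simp add: kG_submodule_def)
  moreover have "?ker \<subseteq> N" if ok: "?ok N" for N
  proof
    have s: "submodule N K U" using ok by blast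
    note sE = U.V.submoduleE[OF s]
    fix f assume "f \<in> ?ker"
    then show "f \<in> N"
    proof (induction "card {x \<in> carrier G. f x \<noteq> \<zero>\<^bsub>K\<^esub>}" arbitrary: f rule: less_induct)
      case less
      have f: "f \<in> carrier U" "coset_sum f = \<zero>\<^bsub>V\<^esub>" using less.prems by auto
      show ?case
      proof (cases "\<forall>x \<in> carrier G. f x = \<zero>\<^bsub>K\<^esub>")
        case True
        then have "f = \<zero>\<^bsub>U\<^esub>" using f by (intro U.V_eqI) (simp_all add: U.V_apply)
        then show ?thesis using subgroup.one_closed[OF submodule.axioms(1)[OF s]] by simp
      next
        case False
        then obtain x where x: "x \<in> carrier G" "f x \<noteq> \<zero>\<^bsub>K\<^esub>" by blast
        have fK: "f y \<in> carrier K" if "y \<in> carrier G" for y using U.V_in_K[OF f(1) that] .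
        have "\<exists>h \<in> H. h \<noteq> \<one> \<and> f (x \<otimes> h) \<noteq> \<zero>\<^bsub>K\<^esub>"
        proof (rule ccontr)
          assume c: "\<not> ?thesis"
          have "finsum K (\<lambda>h. f (x \<otimes> h)) H = finsum K (\<lambda>h. if \<one> = h then f (x \<otimes> h) else \<zero>\<^bsub>K\<^esub>) H"
            by (rule finsum_cong') (use c fK x H_carrier in auto)
          also have "\<dots> = f (x \<otimes> \<one>)"
            by (rule K.add.finprod_singleton[where f = "\<lambda>h. f (x \<otimes> h)"])
              (use fK x H_carrier finite_H subgroup.one_closed[OF H] in auto)
          finally have "coset_sum f x = f x" using x(1) by (simp add: coset_sum_apply)
          then show False using f(2) x by (simp add: V_apply)
        qed
        then obtain h where h: "h \<in> H" "h \<noteq> \<one>" "f (x \<otimes> h) \<noteq> \<zero>\<^bsub>K\<^esub>" by blast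
        define y where "y = x \<otimes> h"
        have hG: "h \<in> carrier G" using H_carrier[OF h(1)] .
        have y: "y \<in> carrier G" "y \<noteq> x" "f y \<noteq> \<zero>\<^bsub>K\<^esub>"
          using x h hG by (auto simp: y_def)
        define d where "d = ?pt y (f x) \<ominus>\<^bsub>U\<^esub> ?pt x (f x)"
        have dN: "d \<in> N" and dker: "d \<in> ?ker"
          using ok diff[OF x(1) h(1) fK[OF x(1)]] x(1) h(1) fK[OF x(1)] by (auto simp: d_def y_def)
        have dU: "d \<in> carrier U" using dker by simp
        have d_app: "d z = (if z = y then f x else \<zero>\<^bsub>K\<^esub>) \<oplus>\<^bsub>K\<^esub> (\<ominus>\<^bsub>K\<^esub> (if z = x then f x else \<zero>\<^bsub>K\<^esub>))"
          if z: "z \<in> carrier G" for z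
        proof -
          have "\<ominus>\<^bsub>U\<^esub> ?pt x (f x) = (\<ominus>\<^bsub>K\<^esub> \<one>\<^bsub>K\<^esub>) \<odot>\<^bsub>U\<^esub> ?pt x (f x)"
            using pure_tensor_in_U[OF fK[OF x(1)]] by (simp add: U.V.smult_l_minus)
          then show ?thesis
            unfolding d_def a_minus_def using z fK[OF x(1)]
            by (simp add: U.V_apply pure_tensor_apply K.l_minus)
        qed
        define f' where "f' = f \<oplus>\<^bsub>U\<^esub> d"
        have f'U: "f' \<in> carrier U" unfolding f'_def using f(1) dU by simp
        have f'_app: "f' z = f z \<oplus>\<^bsub>K\<^esub> d z" if "z \<in> carrier G" for z
          using that by (simp add: f'_def U.V_apply)
        have f'x: "f' x = \<zero>\<^bsub>K\<^esub>" using f'_app[OF x(1)] d_app[OF x(1)] y(2) fK[OF x(1)] by (simp add: K.r_neg)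
        have f'z: "f' z = f z" if "z \<in> carrier G" "z \<noteq> x" "z \<noteq> y" for z
          using f'_app[OF that(1)] d_app[OF that(1)] that fK[OF that(1)] by simp
        have "{z \<in> carrier G. f' z \<noteq> \<zero>\<^bsub>K\<^esub>} \<subset> {z \<in> carrier G. f z \<noteq> \<zero>\<^bsub>K\<^esub>}"
        proof
          show "{z \<in> carrier G. f' z \<noteq> \<zero>\<^bsub>K\<^esub>} \<subseteq> {z \<in> carrier G. f z \<noteq> \<zero>\<^bsub>K\<^esub>}"
          proof clarify
            fix z assume z: "z \<in> carrier G" "f' z \<noteq> \<zero>\<^bsub>K\<^esub>" "f z = \<zero>\<^bsub>K\<^esub>"
            then have "z \<noteq> x" "z \<noteq> y" using x y by auto
            then show False using f'z[OF z(1)] z by simp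
          qed
          show "{z \<in> carrier G. f' z \<noteq> \<zero>\<^bsub>K\<^esub>} \<noteq> {z \<in> carrier G. f z \<noteq> \<zero>\<^bsub>K\<^esub>}"
            using x f'x by blast
        qed
        then have "card {z \<in> carrier G. f' z \<noteq> \<zero>\<^bsub>K\<^esub>} < card {z \<in> carrier G. f z \<noteq> \<zero>\<^bsub>K\<^esub>}"
          using finite_G by (intro psubset_card_mono) auto
        moreover have "f' \<in> ?ker"
          using f'U kG_homE(2)[OF coset_sum_hom f(1) dU] f(2) dker by (simp add: f'_def)
        ultimately have "f' \<in> N" using less.hyps by blast
        then have "f' \<ominus>\<^bsub>U\<^esub> d \<in> N" using sE(5)[OF _ sE(3)[OF dN]] by (simp add: a_minus_def)
        moreover have "f' \<ominus>\<^bsub>U\<^esub> d = f" unfolding f'_def a_minus_def using f(1) dU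
          by (simp add: U.V.M.a_assoc U.V.M.r_neg)
        ultimately show ?thesis by simp
      qed
    qed
  qed
  ultimately show ?thesis unfolding bal by blast
qed

text \<open>A preimage is the function \<open>c\<close> restricted to one representative of each coset and \<open>0\<close> elsewhere.\<close>
lemma coset_sum_surjective:
  assumes c: "c \<in> carrier V" obtains f where "f \<in> carrier U" "coset_sum f = c"
proof
  define r where "r x = (SOME z. z \<in> x <#\<^bsub>G\<^esub> H)" for x
  define f where "f = (\<lambda>x \<in> carrier G. if x = r x then c x else \<zero>\<^bsub>K\<^esub>)"
  show fU: "f \<in> carrier U"
    using V_in_K[OF c] by (auto simp: invariant_functions_simps f_def)
  show "coset_sum f = c"
  proof (rule V_eqI[OF kG_homE(1)[OF coset_sum_hom fU] c])
    fix x assume x: "x \<in> carrier G"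
    have r: "r x \<in> x <#\<^bsub>G\<^esub> H" unfolding r_def using L_nonempty[OF L_I[OF x]] .
    then obtain k where k: "k \<in> H" "r x = x \<otimes> k" by (auto simp: l_coset_def)
    have "finsum K (\<lambda>h. f (x \<otimes> h)) H = finsum K (\<lambda>h. if k = h then c x else \<zero>\<^bsub>K\<^esub>) H"
    proof (rule finsum_cong'[OF refl])
      fix h assume h: "h \<in> H"
      have "x \<otimes> h <#\<^bsub>G\<^esub> H = x <#\<^bsub>G\<^esub> H"
        using l_repr_independence[of "x \<otimes> h" x H] x h H by (auto simp: l_coset_def)
      then have "r (x \<otimes> h) = x \<otimes> k" by (simp add: r_def[of "x \<otimes> h"] k(2)[unfolded r_def])
      moreover have "x \<otimes> h = x \<otimes> k \<longleftrightarrow> k = h" using x H_carrier h k by auto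
      ultimately show "f (x \<otimes> h) = (if k = h then c x else \<zero>\<^bsub>K\<^esub>)"
        using x h H_carrier c by (auto simp: f_def carrier_V)
    qed (use V_in_K[OF c x] in auto)
    also have "\<dots> = c x"
      using K.add.finprod_singleton[OF k(1) finite_H, of "\<lambda>_. c x"] V_in_K[OF c x] by simp
    finally show "coset_sum f x = c x" using x by (simp add: coset_sum_apply)
  qed
qed

text \<open>
  The elements of the induced module are the cosets of the kernel of \<open>coset_sum\<close>, that is, its
  fibres; the isomorphism sends \<open>c\<close> to the fibre over \<open>c\<close>.
\<close>
lemma induced_module_isomorphic:
  "kG_isomorphic K G V (induced_module K G H (trivial_gmodule K))"
proof -
  interpret U: permutation_module K G "{\<one>}" by (rule permutation_module_U)
  have Vm: "kG_module K G V" by unfold_locales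
  note T = kG_homE[OF coset_sum_hom]
  let ?N = "{f \<in> carrier U. coset_sum f = \<zero>\<^bsub>V\<^esub>}"
  let ?I = "induced_module K G H (trivial_gmodule K)"
  have I: "?I = gmodule_quotient U ?N"
    by (simp add: induced_module_def balancing_subspace_eq tensor_eq)
  define \<eta> where "\<eta> c = {f \<in> carrier U. coset_sum f = c}" for c
  have fibre: "?N <+>\<^bsub>U\<^esub> Y = \<eta> c"
    if Y: "Y \<subseteq> carrier U" "y \<in> Y" and Yc: "\<And>f. f \<in> Y \<Longrightarrow> coset_sum f = c" for Y y c
  proof
    have cV: "c \<in> carrier V" using T(1) Y Yc by blast
    show "?N <+>\<^bsub>U\<^esub> Y \<subseteq> \<eta> c"
      using Y(1) Yc T(2) cV by (auto simp: set_add_def' \<eta>_def)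
    show "\<eta> c \<subseteq> ?N <+>\<^bsub>U\<^esub> Y"
    proof
      fix f assume "f \<in> \<eta> c"
      then have f: "f \<in> carrier U" "coset_sum f = c" by (auto simp: \<eta>_def)
      have y: "y \<in> carrier U" using Y by blast
      have "coset_sum (f \<ominus>\<^bsub>U\<^esub> y) = \<zero>\<^bsub>V\<^esub>"
        using U.V.hom_minus[OF Vm coset_sum_hom f(1) y] f(2) Yc[OF Y(2)] cV by simp
      then have "f \<ominus>\<^bsub>U\<^esub> y \<in> ?N" using f y by simp
      moreover have "f = (f \<ominus>\<^bsub>U\<^esub> y) \<oplus>\<^bsub>U\<^esub> y"
        using f y by (simp add: U.V.M.minus_eq U.V.M.a_assoc U.V.M.l_neg)
      ultimately show "f \<in> ?N <+>\<^bsub>U\<^esub> Y" using Y(2) by (auto simp: set_add_def')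
    qed
  qed
  have ne: "\<exists>f. f \<in> \<eta> c" if c: "c \<in> carrier V" for c
    by (rule coset_sum_surjective[OF c]) (auto simp: \<eta>_def)
  have coset: "?N +>\<^bsub>U\<^esub> f = \<eta> (coset_sum f)" if f: "f \<in> carrier U" for f
    using fibre[of "{f}" f "coset_sum f"] f by (simp add: a_r_coset_def' set_add_def')
  have carrI: "carrier ?I = \<eta> ` carrier V"
  proof -
    have "carrier ?I = (\<lambda>f. \<eta> (coset_sum f)) ` carrier U"
      unfolding I gmodule_quotient_def using coset by (auto simp: A_RCOSETS_def')
    also have "\<dots> = \<eta> ` carrier V"
    proof
      show "(\<lambda>f. \<eta> (coset_sum f)) ` carrier U \<subseteq> \<eta> ` carrier V" using T(1) by blast
      show "\<eta> ` carrier V \<subseteq> (\<lambda>f. \<eta> (coset_sum f)) ` carrier U"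
      proof clarify
        fix c assume "c \<in> carrier V"
        then obtain f where "f \<in> \<eta> c" using ne by blast
        then show "\<eta> c \<in> (\<lambda>f. \<eta> (coset_sum f)) ` carrier U"
          by (intro image_eqI[of _ _ f]) (auto simp: \<eta>_def)
      qed
    qed
    finally show ?thesis .
  qed
  have inj: "inj_on \<eta> (carrier V)"
  proof (rule inj_onI)
    fix c c' assume "c \<in> carrier V" "c' \<in> carrier V" "\<eta> c = \<eta> c'"
    then show "c = c'" using ne[of c] by (auto simp: \<eta>_def)
  qed
  have bij: "bij_betw \<eta> (carrier V) (carrier ?I)" using inj carrI by (simp add: bij_betw_def)
  have sub: "\<eta> c \<subseteq> carrier U" for c by (auto simp: \<eta>_def)
  have hom: "\<eta> \<in> kG_hom K G V ?I"
  proof (rule kG_homI)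
    show "\<eta> c \<in> carrier ?I" if "c \<in> carrier V" for c using carrI that by blast
  next
    fix c c' assume c: "c \<in> carrier V" "c' \<in> carrier V"
    have "\<eta> c <+>\<^bsub>U\<^esub> \<eta> c' = \<eta> (c \<oplus>\<^bsub>V\<^esub> c')"
    proof
      show "\<eta> c <+>\<^bsub>U\<^esub> \<eta> c' \<subseteq> \<eta> (c \<oplus>\<^bsub>V\<^esub> c')" using T(2) by (auto simp: set_add_def' \<eta>_def)
      show "\<eta> (c \<oplus>\<^bsub>V\<^esub> c') \<subseteq> \<eta> c <+>\<^bsub>U\<^esub> \<eta> c'"
      proof
        fix f assume "f \<in> \<eta> (c \<oplus>\<^bsub>V\<^esub> c')"
        then have f: "f \<in> carrier U" "coset_sum f = c \<oplus>\<^bsub>V\<^esub> c'" by (auto simp: \<eta>_def)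
        obtain y where y: "y \<in> carrier U" "coset_sum y = c'" using ne[OF c(2)] by (auto simp: \<eta>_def)
        have "coset_sum (f \<ominus>\<^bsub>U\<^esub> y) = c"
          using U.V.hom_minus[OF Vm coset_sum_hom f(1) y(1)] f(2) y(2) c
          by (simp add: V.M.minus_eq V.M.a_assoc V.M.r_neg)
        then have "f \<ominus>\<^bsub>U\<^esub> y \<in> \<eta> c" using f y by (simp add: \<eta>_def)
        moreover have "f = (f \<ominus>\<^bsub>U\<^esub> y) \<oplus>\<^bsub>U\<^esub> y"
          using f y by (simp add: U.V.M.minus_eq U.V.M.a_assoc U.V.M.l_neg)
        moreover have "y \<in> \<eta> c'" using y by (simp add: \<eta>_def)
        ultimately show "f \<in> \<eta> c <+>\<^bsub>U\<^esub> \<eta> c'" by (auto simp: set_add_def')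
      qed
    qed
    then show "\<eta> (c \<oplus>\<^bsub>V\<^esub> c') = \<eta> c \<oplus>\<^bsub>?I\<^esub> \<eta> c'" unfolding I by (simp add: gmodule_quotient_def)
  next
    fix a c assume a: "a \<in> carrier K" and c: "c \<in> carrier V"
    obtain y where y: "y \<in> \<eta> c" using ne[OF c] by blast
    have "?N <+>\<^bsub>U\<^esub> (\<lambda>v. a \<odot>\<^bsub>U\<^esub> v) ` \<eta> c = \<eta> (a \<odot>\<^bsub>V\<^esub> c)"
      by (rule fibre[of _ "a \<odot>\<^bsub>U\<^esub> y"]) (use a y T(3) in \<open>auto simp: \<eta>_def\<close>)
    then show "\<eta> (a \<odot>\<^bsub>V\<^esub> c) = a \<odot>\<^bsub>?I\<^esub> \<eta> c" unfolding I by (simp add: gmodule_quotient_def)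
  next
    fix g c assume g: "g \<in> carrier G" and c: "c \<in> carrier V"
    obtain y where y: "y \<in> \<eta> c" using ne[OF c] by blast
    have "?N <+>\<^bsub>U\<^esub> act U g ` \<eta> c = \<eta> (act V g c)"
      by (rule fibre[of _ "act U g y"]) (use g y T(4) U.V.act_closed in \<open>auto simp: \<eta>_def\<close>)
    then show "\<eta> (act V g c) = act ?I g (\<eta> c)" unfolding I by (simp add: gmodule_quotient_def)
  qed
  have "kG_module K G ?I"
    by (rule V.kG_module_transport[OF bij hom]) (simp add: I gmodule_quotient_def \<eta>_def)
  then show ?thesis unfolding kG_isomorphic_def using Vm bij hom by blast
qed

end

section \<open>Rigidity of permutation modules\<close>

text \<open>
  The last assumption says that \<open>M B\<close> contains all elements conjugating \<open>Q = B \<inter> M\<close> into \<open>M\<close>, or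
  equivalently, as \<open>B\<close> is normal, that it contains the normalizer of \<open>Q\<close>. In terms of cosets: those
  fixed by \<open>Q\<close> lie in the \<open>B\<close>-orbit of \<open>M\<close>.
\<close>
locale normal_p_subgroup_controls = permutation_module K G M + prime_char_field p K
  for p :: nat and K :: "'k ring" and G :: "'g monoid" (structure) and M :: "'g set" +
  fixes B :: "'g set" and n :: nat
  assumes B: "B \<lhd> G" "card B = p ^ n"
    and controls: "g \<in> carrier G \<Longrightarrow> (\<And>q. q \<in> B \<inter> M \<Longrightarrow> inv g \<otimes> q \<otimes> g \<in> M) \<Longrightarrow>
      \<exists>m\<in>M. \<exists>b\<in>B. g = m \<otimes> b"
begin

lemma B_subgroup: "subgroup B G"
  using B(1) by (rule normal_imp_subgroup)

lemma B_carrier: "b \<in> B \<Longrightarrow> b \<in> carrier G"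
  using B_subgroup by (rule subgroup.mem_carrier)

lemma B_fixed_apply:
  assumes "f \<in> carrier V" "\<And>b. b \<in> B \<Longrightarrow> act V b f = f" "b \<in> B" "x \<in> carrier G"
  shows "f (b \<otimes> x) = f x"
proof -
  have "act V (inv b) f x = f x" using assms(2)[of "inv b"] subgroup.m_inv_closed[OF B_subgroup assms(3)] by simp
  then show ?thesis using assms(4) B_carrier[OF assms(3)] by (simp add: V_apply)
qed

lemma finsum_Q_fixed_cosets:
  assumes h: "\<And>A. A \<in> L \<Longrightarrow> h A \<in> carrier K"
    and inv: "\<And>q A. q \<in> B \<inter> M \<Longrightarrow> A \<in> L \<Longrightarrow> h (q <#\<^bsub>G\<^esub> A) = h A"
  shows "finsum K h L = finsum K h {A \<in> L. \<forall>q \<in> B \<inter> M. q <#\<^bsub>G\<^esub> A = A}"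
proof -
  let ?Q = "G\<lparr>carrier := B \<inter> M\<rparr>"
  have Q: "subgroup (B \<inter> M) G" using B_subgroup H by (rule subgroups_Inter_pair)
  have sub: "A \<subseteq> carrier G" if "A \<in> L" for A using L_subset[OF that] by blast
  have QG: "q \<in> carrier G" if "q \<in> B \<inter> M" for q using that B_carrier by blast
  have "card (B \<inter> M) dvd p ^ n"
  proof -
    have "subgroup (B \<inter> M) (G\<lparr>carrier := B\<rparr>)"
      using Q B_subgroup by (intro subgroup_incl) auto
    then have "card (rcosets\<^bsub>G\<lparr>carrier := B\<rparr>\<^esub> (B \<inter> M)) * card (B \<inter> M) = order (G\<lparr>carrier := B\<rparr>)"
      using group.lagrange[OF subgroup_imp_group[OF B_subgroup]] by blast
    then have "card (rcosets\<^bsub>G\<lparr>carrier := B\<rparr>\<^esub> (B \<inter> M)) * card (B \<inter> M) = p ^ n"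
      using B(2) by (simp add: order_def)
    then show ?thesis by (rule dvdI[OF sym, OF trans[OF mult.commute]])
  qed
  then obtain k where k: "card (B \<inter> M) = p ^ k" using prime divides_primepow_nat by blast
  have "finsum K h L = finsum K h {A \<in> L. \<forall>q \<in> carrier ?Q. q <#\<^bsub>G\<^esub> A = A}"
  proof (rule finsum_fixed_points[where a = "\<lambda>q A. q <#\<^bsub>G\<^esub> A"])
    show "group ?Q" using subgroup_imp_group[OF Q] .
    show "order ?Q = p ^ k" using k by (simp add: order_def)
    show "q <#\<^bsub>G\<^esub> A \<in> L" if "q \<in> carrier ?Q" "A \<in> L" for q A
      using that QG L_I lcos_m_assoc[OF subgroup.subset[OF H]] by (auto elim!: L_cases)
    show "\<one>\<^bsub>?Q\<^esub> <#\<^bsub>G\<^esub> A = A" if "A \<in> L" for A using lcos_mult_one[OF sub[OF that]] by simp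
    show "(q \<otimes>\<^bsub>?Q\<^esub> r) <#\<^bsub>G\<^esub> A = q <#\<^bsub>G\<^esub> (r <#\<^bsub>G\<^esub> A)"
      if "q \<in> carrier ?Q" "r \<in> carrier ?Q" "A \<in> L" for q r A
      using that QG lcos_m_assoc[OF sub] by simp
  qed (use finite_L h inv in auto)
  then show ?thesis by simp
qed

text \<open>A coset \<open>gM\<close> fixed by \<open>Q\<close> means that \<open>g\<close> conjugates \<open>Q\<close> into \<open>M\<close>. As \<open>B\<close> is normal, \<open>g = mb\<close> gives \<open>gM = (m b m\<^sup>-\<^sup>1) M\<close>.\<close>
lemma fixed_coset_meets_B:
  assumes A: "A \<in> L" and fixed: "\<forall>q \<in> B \<inter> M. q <#\<^bsub>G\<^esub> A = A"
  obtains b where "b \<in> B" "b \<in> A"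
proof -
  obtain g where g: "g \<in> carrier G" "A = g <#\<^bsub>G\<^esub> M" using A by (rule L_cases)
  have "inv g \<otimes> q \<otimes> g \<in> M" if q: "q \<in> B \<inter> M" for q
  proof -
    have qG: "q \<in> carrier G" using q B_carrier by blast
    have "g \<in> A" using lcos_self[OF g(1) H] g(2) by simp
    then have "q \<otimes> g \<in> q <#\<^bsub>G\<^esub> A" by (auto simp: l_coset_def)
    then have "q \<otimes> g \<in> g <#\<^bsub>G\<^esub> M" using fixed q g(2) by blast
    then obtain m where m: "m \<in> M" "q \<otimes> g = g \<otimes> m" by (auto simp: l_coset_def)
    then have "inv g \<otimes> q \<otimes> g = m"
      using g(1) qG H_carrier[OF m(1)] by (simp add: m_assoc) (simp flip: m_assoc)
    then show ?thesis using m(1) by simp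
  qed
  then obtain m b where mb: "m \<in> M" "b \<in> B" "g = m \<otimes> b" using controls[OF g(1)] by blast
  let ?c = "m \<otimes> b \<otimes> inv m"
  have "?c \<in> B" using normal.inv_op_closed2[OF B(1) H_carrier[OF mb(1)] mb(2)] .
  moreover have "?c \<in> A"
    using mb g(2) subgroup.m_inv_closed[OF H mb(1)] by (auto simp: l_coset_def)
  ultimately show thesis using that by blast
qed

text \<open>
  By equivariance it suffices to compare values at \<open>1\<close>. The functional \<open>f \<mapsto> \<phi>(f)(1)\<close> is invariant
  under \<open>M\<close>, so for \<open>f\<close> fixed by \<open>B\<close> its expansion in coordinates is a sum of terms permuted by
  \<open>Q = B \<inter> M\<close>. Only the cosets fixed by \<open>Q\<close> remain, and there \<open>f\<close> has the value \<open>f(1)\<close>. So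
  \<open>\<phi>(f)(1)\<close> is \<open>f(1)\<close> times a sum that does not depend on \<open>f\<close>; it equals \<open>1\<close>, as is seen for the
  constant function \<open>1\<close>.
\<close>
lemma endomorphism_fixes_B_fixed:
  assumes \<phi>: "\<phi> \<in> kG_hom K G V V" and one: "\<phi> (constant_one K G) = constant_one K G"
    and f: "f \<in> carrier V" and fB: "\<And>b. b \<in> B \<Longrightarrow> act V b f = f"
  shows "\<phi> f = f"
proof -
  note \<Phi> = kG_homE[OF \<phi>]
  define l where "l = (\<lambda>f. \<phi> f \<one>)"
  define d where "d = (\<lambda>A. l (coset_indicator K G A))"
  have l: "l f \<in> carrier K" if "f \<in> carrier V" for f using V_in_K[OF \<Phi>(1)[OF that]] by (simp add: l_def)
  have d: "d A \<in> carrier K" if "A \<in> L" for A using l[OF indicator_in_V[OF that]] by (simp add: d_def)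
  let ?Fix = "{A \<in> L. \<forall>q \<in> B \<inter> M. q <#\<^bsub>G\<^esub> A = A}"
  have at_one: "l f = f \<one> \<otimes>\<^bsub>K\<^esub> finsum K d ?Fix"
    if f: "f \<in> carrier V" and fB: "\<And>b. b \<in> B \<Longrightarrow> act V b f = f" for f
  proof -
    have "l f = finsum K (\<lambda>A. coset_value f A \<otimes>\<^bsub>K\<^esub> l (coset_indicator K G A)) L"
      by (rule functional_expansion[OF _ _ _ f]) (use l \<Phi> in \<open>auto simp: l_def V_apply\<close>)
    also have "\<dots> = finsum K (\<lambda>A. coset_value f A \<otimes>\<^bsub>K\<^esub> l (coset_indicator K G A)) ?Fix"
    proof (rule finsum_Q_fixed_cosets)
      fix q A assume q: "q \<in> B \<inter> M" and A: "A \<in> L"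
      have qG: "q \<in> carrier G" using q B_carrier by blast
      have qA: "q <#\<^bsub>G\<^esub> A \<in> L"
        using qG A L_I lcos_m_assoc[OF subgroup.subset[OF H]] by (auto elim!: L_cases)
      define x where "x = (SOME x. x \<in> A)"
      have x: "x \<in> A" "x \<in> carrier G" using L_nonempty[OF A] L_subset[OF A] by (auto simp: x_def)
      have "coset_value f (q <#\<^bsub>G\<^esub> A) = f (q \<otimes> x)"
        by (rule coset_value[OF f qA]) (use x in \<open>auto simp: l_coset_def\<close>)
      also have "\<dots> = f x" using B_fixed_apply[OF f fB _ x(2)] q by simp
      also have "\<dots> = coset_value f A" by (rule coset_value[OF f A x(1), symmetric])
      finally have cv: "coset_value f (q <#\<^bsub>G\<^esub> A) = coset_value f A" .
      have "coset_indicator K G (q <#\<^bsub>G\<^esub> A) = act V q (coset_indicator K G A)"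
      proof (rule V_eqI[OF indicator_in_V[OF qA] V_closed(4)[OF qG indicator_in_V[OF A]]])
        fix y assume y: "y \<in> carrier G"
        have "y \<in> q <#\<^bsub>G\<^esub> A \<longleftrightarrow> inv q \<otimes> y \<in> A"
        proof
          assume "y \<in> q <#\<^bsub>G\<^esub> A"
          then obtain z where z: "z \<in> A" "y = q \<otimes> z" by (auto simp: l_coset_def)
          then show "inv q \<otimes> y \<in> A" using qG L_subset[OF A z(1)] by (simp flip: m_assoc)
        next
          assume "inv q \<otimes> y \<in> A"
          moreover have "y = q \<otimes> (inv q \<otimes> y)" using qG y by (simp flip: m_assoc)
          ultimately show "y \<in> q <#\<^bsub>G\<^esub> A" unfolding l_coset_def by blast
        qed
        then show "coset_indicator K G (q <#\<^bsub>G\<^esub> A) y = act V q (coset_indicator K G A) y"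
          using y qG by (simp add: V_apply coset_indicator_def)
      qed
      then have "l (coset_indicator K G (q <#\<^bsub>G\<^esub> A)) = \<phi> (coset_indicator K G A) (inv q)"
        using \<Phi>(4)[OF qG indicator_in_V[OF A]] qG by (simp add: l_def V_apply)
      also have "\<dots> = \<phi> (coset_indicator K G A) (\<one> \<otimes> inv q)" using qG by simp
      also have "\<dots> = \<phi> (coset_indicator K G A) \<one>"
        using \<Phi>(1)[OF indicator_in_V[OF A]] subgroup.m_inv_closed[OF H, of q] q
        by (simp add: carrier_V del: l_one)
      finally show "coset_value f (q <#\<^bsub>G\<^esub> A) \<otimes>\<^bsub>K\<^esub> l (coset_indicator K G (q <#\<^bsub>G\<^esub> A)) =
          coset_value f A \<otimes>\<^bsub>K\<^esub> l (coset_indicator K G A)" using cv by (simp add: l_def)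
    qed (use coset_value_closed[OF f] l indicator_in_V in auto)
    also have "\<dots> = finsum K (\<lambda>A. f \<one> \<otimes>\<^bsub>K\<^esub> d A) ?Fix"
    proof (rule finsum_cong'[OF refl])
      show "(\<lambda>A. f \<one> \<otimes>\<^bsub>K\<^esub> d A) \<in> ?Fix \<rightarrow> carrier K" using V_in_K[OF f] d by auto
      fix A assume A: "A \<in> ?Fix"
      then obtain b where b: "b \<in> B" "b \<in> A" using fixed_coset_meets_B by blast
      have "coset_value f A = f (b \<otimes> \<one>)" using coset_value[OF f _ b(2)] A B_carrier[OF b(1)] by simp
      also have "\<dots> = f \<one>" by (rule B_fixed_apply[OF f fB b(1)]) simp_all
      finally show "coset_value f A \<otimes>\<^bsub>K\<^esub> l (coset_indicator K G A) = f \<one> \<otimes>\<^bsub>K\<^esub> d A" by (simp add: d_def)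
    qed
    also have "\<dots> = f \<one> \<otimes>\<^bsub>K\<^esub> finsum K d ?Fix"
      by (rule finsum_rdistr[symmetric]) (use finite_L V_in_K[OF f] d in auto)
    finally show ?thesis .
  qed
  have sum: "finsum K d ?Fix = \<one>\<^bsub>K\<^esub>"
  proof -
    have "act V b (constant_one K G) = constant_one K G" if "b \<in> B" for b
      by (rule V_eqI) (use B_carrier[OF that] constant_one_in_V V_closed(4) in \<open>simp_all add: V_apply constant_one_def\<close>)
    from at_one[OF constant_one_in_V this]
    have "l (constant_one K G) = constant_one K G \<one> \<otimes>\<^bsub>K\<^esub> finsum K d ?Fix" by blast
    moreover have "finsum K d ?Fix \<in> carrier K" using d by (intro finsum_closed) auto
    moreover have "constant_one K G \<one> = \<one>\<^bsub>K\<^esub>" by (simp add: constant_one_def)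
    moreover have "l (constant_one K G) = constant_one K G \<one>" by (simp only: l_def one)
    ultimately show ?thesis by simp
  qed
  have eval: "l f = f \<one>" if "f \<in> carrier V" "\<And>b. b \<in> B \<Longrightarrow> act V b f = f" for f
    using at_one[OF that] sum V_in_K[OF that(1)] by simp
  show ?thesis
  proof (rule V_eqI[OF \<Phi>(1)[OF f] f])
    fix x assume x: "x \<in> carrier G"
    let ?f = "act V (inv x) f"
    have f': "?f \<in> carrier V" using x f by (simp add: V_closed)
    have "act V b ?f = ?f" if b: "b \<in> B" for b
    proof -
      have bG: "b \<in> carrier G" using B_carrier[OF b] .
      have c: "x \<otimes> b \<otimes> inv x \<in> B" using normal.inv_op_closed2[OF B(1) x b] .
      have "act V b ?f = act V (b \<otimes> inv x) f" using V.act_mult[OF bG _ f] x by simp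
      also have "b \<otimes> inv x = inv x \<otimes> (x \<otimes> b \<otimes> inv x)" using x bG by (simp flip: m_assoc)
      also have "act V \<dots> f = act V (inv x) (act V (x \<otimes> b \<otimes> inv x) f)"
        using V.act_mult[OF _ B_carrier[OF c] f] x by simp
      also have "\<dots> = ?f" using fB[OF c] by simp
      finally show ?thesis .
    qed
    then have "l ?f = ?f \<one>" using eval[OF f'] by blast
    then show "\<phi> f x = f x" using \<Phi>(4)[OF _ f, of "inv x"] x by (simp add: l_def V_apply)
  qed
qed

text \<open>A nonzero kernel would contain a nonzero vector fixed by \<open>B\<close>, on which \<open>\<phi>\<close> is the identity.\<close>
lemma endomorphism_bijective:
  assumes \<phi>: "\<phi> \<in> kG_hom K G V V" and one: "\<phi> (constant_one K G) = constant_one K G"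
  shows "bij_betw \<phi> (carrier V) (carrier V)"
proof (rule injective_endomorphism_surjective[OF \<phi>])
  have Vm: "kG_module K G V" by unfold_locales
  let ?N = "{f \<in> carrier V. \<phi> f = \<zero>\<^bsub>V\<^esub>}"
  have N: "kG_submodule K G V ?N" by (rule V.kernel_submodule[OF Vm \<phi>])
  have "?N = {\<zero>\<^bsub>V\<^esub>}"
  proof (rule ccontr)
    assume "?N \<noteq> {\<zero>\<^bsub>V\<^esub>}"
    then obtain f where "f \<in> ?N" "f \<noteq> \<zero>\<^bsub>V\<^esub>" "\<And>b. b \<in> B \<Longrightarrow> act V b f = f"
      using ex_fixed_vector[OF Vm B_subgroup B(2) N] by blast
    then show False using endomorphism_fixes_B_fixed[OF \<phi> one, of f] by simp
  qed
  then show "inj_on \<phi> (carrier V)"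
    by (intro V.hom_injective_if_trivial_kernel[OF Vm \<phi>]) blast
qed

end

section \<open>Summands of prime-to-p index\<close>

locale index_prime_to_p = permutation_module K G M + prime_char_field p K
  for p :: nat and K :: "'k ring" and G :: "'g monoid" (structure) and M :: "'g set" +
  fixes P :: "'g set"
  assumes P: "subgroup P G" "P \<subseteq> M"
    and index: "\<not> p dvd card (lcosets\<^bsub>G\<lparr>carrier := M\<rparr>\<^esub> P)"
begin

abbreviation "VP \<equiv> invariant_functions K G P"
abbreviation "LP \<equiv> lcosets\<^bsub>G\<lparr>carrier := M\<rparr>\<^esub> P"

text \<open>
  The relative trace from \<open>P\<close> to \<open>M\<close>, divided by the index; \<open>SOME\<close> picks coset representatives, and the
  value does not depend on them when \<open>f\<close> is right invariant under \<open>P\<close>.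
\<close>
definition averaging :: "('g \<Rightarrow> 'k) \<Rightarrow> 'g \<Rightarrow> 'k" where
  "averaging f = (\<lambda>x \<in> carrier G. inv\<^bsub>K\<^esub> ([card LP] \<cdot>\<^bsub>K\<^esub> \<one>\<^bsub>K\<^esub>) \<otimes>\<^bsub>K\<^esub>
     finsum K (\<lambda>A. f (x \<otimes> (SOME a. a \<in> A))) LP)"

lemma permutation_module_P: "permutation_module K G P"
  by (intro permutation_module.intro permutation_module_axioms.intro field_axioms group_axioms finite_G P)

lemma V_subset_VP: "f \<in> carrier V \<Longrightarrow> f \<in> carrier VP"
  using P(2) by (auto simp: invariant_functions_simps)

lemma finite_LP: "finite LP"
proof (rule finite_subset)
  show "LP \<subseteq> Pow (carrier G)"
    using P(1) H_carrier by (auto simp: LCOSETS_def l_coset_def dest: subgroup.mem_carrier)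
qed (simp add: finite_G)

lemma LP_I: "m \<in> M \<Longrightarrow> m <#\<^bsub>G\<^esub> P \<in> LP"
  by (auto simp: LCOSETS_def l_coset_def)

lemma LP_cases:
  assumes "A \<in> LP" obtains m where "m \<in> M" "A = m <#\<^bsub>G\<^esub> P"
  using assms by (auto simp: LCOSETS_def l_coset_def)

lemma LP_rep:
  assumes "A \<in> LP" shows "(SOME a. a \<in> A) \<in> A"
  by (metis LP_cases[OF assms] H_carrier P(1) lcos_self someI)

lemma LP_mem: "A \<in> LP \<Longrightarrow> a \<in> A \<Longrightarrow> a \<in> M"
  using subsetD[OF P(2)] subgroup.m_closed[OF H] by (auto elim!: LP_cases simp: l_coset_def)

lemma averaging_hom: "averaging \<in> kG_hom K G VP V"
proof -
  interpret P: permutation_module K G P by (rule permutation_module_P)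
  define c where "c = inv\<^bsub>K\<^esub> ([card LP] \<cdot>\<^bsub>K\<^esub> \<one>\<^bsub>K\<^esub>)"
  have "[card LP] \<cdot>\<^bsub>K\<^esub> \<one>\<^bsub>K\<^esub> \<noteq> \<zero>\<^bsub>K\<^esub>" using index add_pow_one_eq_zero_iff by blast
  then have c: "c \<in> carrier K" unfolding c_def using field_Units by auto
  define s where "s = (\<lambda>A :: 'g set. SOME a. a \<in> A)"
  have sM: "s A \<in> M" if "A \<in> LP" for A using LP_mem[OF that LP_rep[OF that]] by (simp add: s_def)
  have sG: "s A \<in> carrier G" if "A \<in> LP" for A using H_carrier[OF sM[OF that]] .
  have app: "averaging f x = c \<otimes>\<^bsub>K\<^esub> finsum K (\<lambda>A. f (x \<otimes> s A)) LP" if "x \<in> carrier G" for f x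
    using that by (simp add: averaging_def c_def s_def)
  have cl: "f (x \<otimes> s A) \<in> carrier K" if "f \<in> carrier VP" "x \<in> carrier G" "A \<in> LP" for f x A
    using that P.V_in_K sG by simp
  have sumcl: "finsum K (\<lambda>A. f (x \<otimes> s A)) LP \<in> carrier K" if "f \<in> carrier VP" "x \<in> carrier G" for f x
    using cl that by (intro finsum_closed) auto
  have clV: "averaging f \<in> carrier V" if f: "f \<in> carrier VP" for f
  proof -
    have "averaging f (x \<otimes> m) = averaging f x" if x: "x \<in> carrier G" and m: "m \<in> M" for x m
    proof -
      have mG: "m \<in> carrier G" using H_carrier[OF m] .
      have mA: "m <#\<^bsub>G\<^esub> A \<in> LP" if "A \<in> LP" for A
        using that lcos_m_assoc[OF subgroup.subset[OF P(1)] mG H_carrier] subgroup.m_closed[OF H m] LP_I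
        by (auto elim!: LP_cases)
      have sub: "A \<subseteq> carrier G" if "A \<in> LP" for A using LP_mem[OF that] H_carrier by blast
      have inj: "inj_on (\<lambda>A. m <#\<^bsub>G\<^esub> A) LP"
      proof (rule inj_onI)
        fix A A' assume A: "A \<in> LP" "A' \<in> LP" "m <#\<^bsub>G\<^esub> A = m <#\<^bsub>G\<^esub> A'"
        have "inv m <#\<^bsub>G\<^esub> (m <#\<^bsub>G\<^esub> A) = inv m <#\<^bsub>G\<^esub> (m <#\<^bsub>G\<^esub> A')" using A(3) by simp
        then show "A = A'" using lcos_m_assoc[OF sub] lcos_mult_one[OF sub] A(1,2) mG by simp
      qed
      have im: "(\<lambda>A. m <#\<^bsub>G\<^esub> A) ` LP = LP"
        using mA inj finite_LP by (intro endo_inj_surj) auto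
      have "finsum K (\<lambda>A. f (x \<otimes> s A)) LP = finsum K (\<lambda>A. f (x \<otimes> s A)) ((\<lambda>A. m <#\<^bsub>G\<^esub> A) ` LP)"
        using im by simp
      also have "\<dots> = finsum K (\<lambda>A. f (x \<otimes> s (m <#\<^bsub>G\<^esub> A))) LP"
        by (rule finsum_reindex) (use inj im cl[OF f x] in auto)
      also have "\<dots> = finsum K (\<lambda>A. f (x \<otimes> m \<otimes> s A)) LP"
      proof (rule finsum_cong'[OF refl])
        show "(\<lambda>A. f (x \<otimes> m \<otimes> s A)) \<in> LP \<rightarrow> carrier K" using cl[OF f, of "x \<otimes> m"] x mG by simp
        fix A assume A: "A \<in> LP"
        obtain k where k: "k \<in> M" "A = k <#\<^bsub>G\<^esub> P" using A by (rule LP_cases)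
        have kG: "k \<in> carrier G" using H_carrier[OF k(1)] .
        obtain u where u: "u \<in> P" "s A = k \<otimes> u" using LP_rep[OF A] k(2) by (auto simp: s_def l_coset_def)
        have "s (m <#\<^bsub>G\<^esub> A) \<in> (m \<otimes> k) <#\<^bsub>G\<^esub> P"
          using LP_rep[OF mA[OF A]] k(2) lcos_m_assoc[OF subgroup.subset[OF P(1)] mG kG] by (simp add: s_def)
        then obtain v where v: "v \<in> P" "s (m <#\<^bsub>G\<^esub> A) = m \<otimes> k \<otimes> v" by (auto simp: l_coset_def)
        have uv: "u \<in> carrier G" "v \<in> carrier G" using u v P.H_carrier by auto
        have fP: "f (y \<otimes> w) = f y" if "y \<in> carrier G" "w \<in> P" for y w using f that by (simp add: P.carrier_V)
        have "f (x \<otimes> s (m <#\<^bsub>G\<^esub> A)) = f (x \<otimes> m \<otimes> k \<otimes> v)" using v(2) x mG kG uv by (simp add: m_assoc)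
        also have "\<dots> = f (x \<otimes> m \<otimes> k \<otimes> u)" using fP[of "x \<otimes> m \<otimes> k"] u(1) v(1) x mG kG by simp
        also have "\<dots> = f (x \<otimes> m \<otimes> s A)" using u(2) x mG kG uv by (simp add: m_assoc)
        finally show "f (x \<otimes> s (m <#\<^bsub>G\<^esub> A)) = f (x \<otimes> m \<otimes> s A)" .
      qed
      finally show ?thesis using app x mG by simp
    qed
    moreover have "averaging f \<in> carrier G \<rightarrow>\<^sub>E carrier K"
    proof (rule PiE_I)
      show "averaging f x \<in> carrier K" if "x \<in> carrier G" for x using app[OF that] c sumcl[OF f that] by simp
      show "averaging f x = undefined" if "x \<notin> carrier G" for x using that by (simp add: averaging_def)
    qed
    ultimately show ?thesis by (simp add: carrier_V)
  qed
  show ?thesis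
  proof (rule kG_homI)
    show "averaging f \<in> carrier V" if "f \<in> carrier VP" for f using clV that .
  next
    fix f f' assume f: "f \<in> carrier VP" "f' \<in> carrier VP"
    show "averaging (f \<oplus>\<^bsub>VP\<^esub> f') = averaging f \<oplus>\<^bsub>V\<^esub> averaging f'"
    proof (rule V_eqI)
      fix x assume x: "x \<in> carrier G"
      have "finsum K (\<lambda>A. (f \<oplus>\<^bsub>VP\<^esub> f') (x \<otimes> s A)) LP = finsum K (\<lambda>A. f (x \<otimes> s A) \<oplus>\<^bsub>K\<^esub> f' (x \<otimes> s A)) LP"
        by (rule finsum_cong') (use f cl x sG in \<open>auto simp: P.V_apply\<close>)
      also have "\<dots> = finsum K (\<lambda>A. f (x \<otimes> s A)) LP \<oplus>\<^bsub>K\<^esub> finsum K (\<lambda>A. f' (x \<otimes> s A)) LP"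
        by (rule finsum_addf) (use f cl x in auto)
      finally show "averaging (f \<oplus>\<^bsub>VP\<^esub> f') x = (averaging f \<oplus>\<^bsub>V\<^esub> averaging f') x"
        using x c sumcl f by (simp add: V_apply app r_distr)
    qed (use f clV in simp_all)
  next
    fix a f assume a: "a \<in> carrier K" and f: "f \<in> carrier VP"
    show "averaging (a \<odot>\<^bsub>VP\<^esub> f) = a \<odot>\<^bsub>V\<^esub> averaging f"
    proof (rule V_eqI)
      fix x assume x: "x \<in> carrier G"
      have "finsum K (\<lambda>A. (a \<odot>\<^bsub>VP\<^esub> f) (x \<otimes> s A)) LP = finsum K (\<lambda>A. a \<otimes>\<^bsub>K\<^esub> f (x \<otimes> s A)) LP"
        by (rule finsum_cong') (use f cl x a sG in \<open>auto simp: P.V_apply\<close>)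
      also have "\<dots> = a \<otimes>\<^bsub>K\<^esub> finsum K (\<lambda>A. f (x \<otimes> s A)) LP"
        by (rule finsum_rdistr[symmetric]) (use f cl x a finite_LP in auto)
      finally show "averaging (a \<odot>\<^bsub>VP\<^esub> f) x = (a \<odot>\<^bsub>V\<^esub> averaging f) x"
        using x c a sumcl[OF f] by (simp add: V_apply app K.m_lcomm)
    qed (use a f clV in simp_all)
  next
    fix g f assume g: "g \<in> carrier G" and f: "f \<in> carrier VP"
    show "averaging (act VP g f) = act V g (averaging f)"
    proof (rule V_eqI)
      fix x assume x: "x \<in> carrier G"
      have "finsum K (\<lambda>A. act VP g f (x \<otimes> s A)) LP = finsum K (\<lambda>A. f (inv g \<otimes> x \<otimes> s A)) LP"
      proof (rule finsum_cong'[OF refl])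
        show "(\<lambda>A. f (inv g \<otimes> x \<otimes> s A)) \<in> LP \<rightarrow> carrier K" using cl[OF f, of "inv g \<otimes> x"] x g by simp
        show "act VP g f (x \<otimes> s A) = f (inv g \<otimes> x \<otimes> s A)" if "A \<in> LP" for A
          using x g sG[OF that] by (simp add: P.V_apply m_assoc)
      qed
      then show "averaging (act VP g f) x = act V g (averaging f) x" using x g by (simp add: V_apply app)
    qed (use g f clV V_closed(4) P.V_closed(4) in simp_all)
  qed
qed

lemma averaging_retracts: "f \<in> carrier V \<Longrightarrow> averaging f = f"
proof (rule V_eqI)
  assume f: "f \<in> carrier V"
  show "averaging f \<in> carrier V" by (rule kG_homE(1)[OF averaging_hom V_subset_VP[OF f]])
  fix x assume x: "x \<in> carrier G"
  let ?n = "[card LP] \<cdot>\<^bsub>K\<^esub> \<one>\<^bsub>K\<^esub>"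
  have n: "?n \<in> carrier K" "?n \<noteq> \<zero>\<^bsub>K\<^esub>" using index add_pow_one_eq_zero_iff[of "card LP"] by auto
  have u: "inv\<^bsub>K\<^esub> ?n \<in> carrier K" "inv\<^bsub>K\<^esub> ?n \<otimes>\<^bsub>K\<^esub> ?n = \<one>\<^bsub>K\<^esub>" using n field_Units by auto
  have "finsum K (\<lambda>A. f (x \<otimes> (SOME a. a \<in> A))) LP = ?n \<otimes>\<^bsub>K\<^esub> f x"
  proof (rule finsum_const[OF finite_LP _ V_in_K[OF f x]])
    fix A assume A: "A \<in> LP"
    show "f (x \<otimes> (SOME a. a \<in> A)) = f x" using f x LP_mem[OF A LP_rep[OF A]] by (simp add: carrier_V)
  qed
  then show "averaging f x = f x"
    using x u n V_in_K[OF f x] by (simp add: averaging_def flip: K.m_assoc)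
qed

end

lemma kG_isomorphic_trans:
  assumes "kG_isomorphic K G U V" "kG_isomorphic K G V W"
  shows "kG_isomorphic K G U W"
proof -
  obtain f g where "f \<in> kG_hom K G U V" "bij_betw f (carrier U) (carrier V)"
    "g \<in> kG_hom K G V W" "bij_betw g (carrier V) (carrier W)"
    using assms unfolding kG_isomorphic_def by blast
  then have "(\<lambda>u. g (f u)) \<in> kG_hom K G U W" "bij_betw (\<lambda>u. g (f u)) (carrier U) (carrier W)"
    using kG_hom_comp bij_betw_trans[of f _ _ g] by (auto simp: comp_def)
  then show ?thesis using assms unfolding kG_isomorphic_def by blast
qed

text \<open>
  The criterion of \<open>rigid_retract\<close> applies to the induced module from \<open>P\<close>, the permutation module of
  \<open>M\<close>, and the constant function \<open>1\<close>: the retraction is \<open>averaging\<close>, and the functions fixed by \<open>G\<close>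
  are the constant ones.
\<close>
theorem scott_module_isomorphic:
  assumes "normal_p_subgroup_controls p K G M B n" and "index_prime_to_p p K G M P"
  shows "kG_isomorphic K G (scott_module K G P) (induced_module K G M (trivial_gmodule K))"
proof -
  interpret normal_p_subgroup_controls p K G M B n by fact
  interpret index_prime_to_p p K G M P by fact
  interpret P: permutation_module K G P by (rule permutation_module_P)
  let ?I = "induced_module K G P (trivial_gmodule K)"
  have Im: "kG_module K G ?I" and Vm: "kG_module K G V" and VPm: "kG_module K G VP"
    using P.induced_module_isomorphic induced_module_isomorphic by (auto simp: kG_isomorphic_def)
  obtain e where e: "e \<in> kG_hom K G VP ?I" "bij_betw e (carrier VP) (carrier ?I)"
    using P.induced_module_isomorphic by (auto simp: kG_isomorphic_def)
  let ?d = "inv_into (carrier VP) e"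
  have d: "?d \<in> kG_hom K G ?I VP" by (rule P.V.kG_hom_inv_into[OF e])
  have de: "?d (e f) = f" if "f \<in> carrier VP" for f using e(2) that by (simp add: bij_betw_def)
  have incl: "(\<lambda>f. f) \<in> kG_hom K G V VP"
    by (rule kG_homI) (simp_all add: V_subset_VP invariant_functions_simps(2-5))
  have eh: "e \<in> kG_hom K G V ?I" using kG_hom_comp[OF incl e(1)] by simp
  have rh: "(\<lambda>v. averaging (?d v)) \<in> kG_hom K G ?I V" by (rule kG_hom_comp[OF d averaging_hom])
  have "rigid_retract K G ?I V e (\<lambda>v. averaging (?d v)) (constant_one K G)"
  proof (intro rigid_retract.intro rigid_retract_axioms.intro Im Vm eh rh constant_one_in_V)
    show "averaging (?d (e f)) = f" if "f \<in> carrier V" for f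
      using de[OF V_subset_VP[OF that]] averaging_retracts[OF that] by simp
    have "constant_one K G \<one>\<^bsub>G\<^esub> \<noteq> \<zero>\<^bsub>V\<^esub> \<one>\<^bsub>G\<^esub>"
      by (simp add: V_apply constant_one_def)
    then show "constant_one K G \<noteq> \<zero>\<^bsub>V\<^esub>" by metis
    show "act V g (constant_one K G) = constant_one K G" if "g \<in> carrier G" for g
      by (rule V_eqI) (use that constant_one_in_V V_closed(4) in \<open>simp_all add: V_apply constant_one_def\<close>)
    show "\<exists>a \<in> carrier K. v = a \<odot>\<^bsub>?I\<^esub> e (constant_one K G)"
      if v: "v \<in> carrier ?I" and fixed: "\<And>g. g \<in> carrier G \<Longrightarrow> act ?I g v = v" for v
    proof -
      obtain f where f: "f \<in> carrier VP" "v = e f" using v e(2) by (auto simp: bij_betw_def)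
      have "act VP g f = f" if g: "g \<in> carrier G" for g
      proof -
        have "e (act VP g f) = e f" using kG_homE(4)[OF e(1) g f(1)] fixed[OF g] f(2) by simp
        then show ?thesis using e(2) f(1) P.V_closed(4)[OF g f(1)] by (auto simp: bij_betw_def dest: inj_onD)
      qed
      then have "f = f \<one>\<^bsub>G\<^esub> \<odot>\<^bsub>VP\<^esub> constant_one K G" by (rule P.constant_if_fixed[OF f(1)])
      moreover have "f \<one>\<^bsub>G\<^esub> \<in> carrier K" using P.V_in_K[OF f(1)] by simp
      ultimately have "v = f \<one>\<^bsub>G\<^esub> \<odot>\<^bsub>?I\<^esub> e (constant_one K G)"
        using kG_homE(3)[OF e(1) _ P.constant_one_in_V] f(2) by metis
      then show ?thesis using \<open>f \<one>\<^bsub>G\<^esub> \<in> carrier K\<close> by blast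
    qed
    show "bij_betw \<alpha> (carrier V) (carrier V)"
      if "\<alpha> \<in> kG_hom K G V V" "\<alpha> (constant_one K G) = constant_one K G" for \<alpha>
      by (rule endomorphism_bijective[OF that])
  qed
  then interpret R: rigid_retract K G ?I V e "\<lambda>v. averaging (?d v)" "constant_one K G" .
  have "scott_summand K G ?I (SOME S. scott_summand K G ?I S)"
    using R.scott_summand_image by (rule someI)
  then have "kG_isomorphic K G (?I\<lparr>carrier := SOME S. scott_summand K G ?I S\<rparr>) V"
    by (rule R.scott_summand_isomorphic)
  then have "kG_isomorphic K G (scott_module K G P) V"
    by (simp add: scott_module_def scott_summand_def[abs_def] Let_def)
  then show ?thesis using induced_module_isomorphic by (rule kG_isomorphic_trans)
qed

section \<open>Park's group\<close>

lemma (in group) mult_inv_cancel: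
  assumes "x \<in> carrier G" "y \<in> carrier G"
  shows "x \<otimes> (inv x \<otimes> y) = y" "inv x \<otimes> (x \<otimes> y) = y"
  using assms by (simp_all flip: m_assoc)

locale park_model = group M + K: prime_char_field p K
  for p :: nat and K :: "'k ring" and P :: "'a monoid" and M :: "'a monoid" (structure) +
  assumes finite_M: "finite (carrier M)" and P: "subgroup (carrier P) M"
    and sylow: "card (carrier P) = p ^ multiplicity p (order M)"
    and constrained: "centralizer M (p_core p M) \<subseteq> p_core p M"
begin

abbreviation "G \<equiv> park_group P M"
abbreviation "\<iota> \<equiv> park_embedding M"

lemma P_carrier: "u \<in> carrier P \<Longrightarrow> u \<in> carrier M"
  using P by (rule subgroup.mem_carrier)

lemma carrier_G:
  "f \<in> carrier G \<longleftrightarrow> f \<in> Bij (carrier M) \<and>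
     (\<forall>m \<in> carrier M. \<forall>u \<in> carrier P. f (m \<otimes> u) = f m \<otimes> u)"
  by (simp add: park_group_def)

lemma G_closed: "f \<in> carrier G \<Longrightarrow> m \<in> carrier M \<Longrightarrow> f m \<in> carrier M"
  using Bij_imp_funcset by (auto simp: carrier_G)

lemma G_equivariant:
  "f \<in> carrier G \<Longrightarrow> m \<in> carrier M \<Longrightarrow> u \<in> carrier P \<Longrightarrow> f (m \<otimes> u) = f m \<otimes> u"
  by (simp add: carrier_G)

lemma subgroup_G: "subgroup (carrier G) (BijGroup (carrier M))"
proof (rule group.subgroupI[OF group_BijGroup])
  show "carrier G \<subseteq> carrier (BijGroup (carrier M))" by (auto simp: carrier_G BijGroup_def)
  have "(\<lambda>m \<in> carrier M. m) \<in> carrier G" using P_carrier by (simp add: carrier_G id_Bij)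
  then show "carrier G \<noteq> {}" by blast
next
  fix f assume f: "f \<in> carrier G"
  let ?g = "\<lambda>m \<in> carrier M. inv_into (carrier M) f m"
  have fB: "f \<in> Bij (carrier M)" using f by (simp add: carrier_G)
  then have bij: "bij_betw f (carrier M) (carrier M)" by (simp add: Bij_def)
  have "?g (m \<otimes> u) = ?g m \<otimes> u" if mu: "m \<in> carrier M" "u \<in> carrier P" for m u
  proof -
    have uM: "u \<in> carrier M" using mu P_carrier by blast
    have gm: "inv_into (carrier M) f m \<in> carrier M" using Bij_inv_into_mem[OF fB mu(1)] .
    have "f (inv_into (carrier M) f m \<otimes> u) = m \<otimes> u"
      using G_equivariant[OF f gm mu(2)] bij_betw_inv_into_right[OF bij mu(1)] by simp
    then show ?thesis
      using bij_betw_inv_into_left[OF bij, of "inv_into (carrier M) f m \<otimes> u"] gm uM mu(1) by simp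
  qed
  then have "?g \<in> carrier G" using restrict_inv_into_Bij[OF fB] unfolding carrier_G by blast
  then show "inv\<^bsub>BijGroup (carrier M)\<^esub> f \<in> carrier G" using inv_BijGroup[OF fB] by simp
next
  fix f g assume fg: "f \<in> carrier G" "g \<in> carrier G"
  then have "f \<otimes>\<^bsub>BijGroup (carrier M)\<^esub> g = compose (carrier M) f g"
    by (simp add: BijGroup_def carrier_G)
  moreover have "compose (carrier M) f g \<in> carrier G"
    unfolding carrier_G
  proof (intro conjI ballI)
    show "compose (carrier M) f g \<in> Bij (carrier M)" using fg by (simp add: carrier_G compose_Bij)
    show "compose (carrier M) f g (m \<otimes> u) = compose (carrier M) f g m \<otimes> u"
      if "m \<in> carrier M" "u \<in> carrier P" for m u
      using that fg P_carrier G_closed G_equivariant by (simp add: compose_def)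
  qed
  ultimately show "f \<otimes>\<^bsub>BijGroup (carrier M)\<^esub> g \<in> carrier G" by simp
qed

lemma G_eq: "G = BijGroup (carrier M)\<lparr>carrier := carrier G\<rparr>"
  by (simp add: park_group_def)

lemma group_G: "group G"
  using subgroup.subgroup_is_group[OF subgroup_G group_BijGroup] G_eq by simp

lemma G_mult: "f \<in> carrier G \<Longrightarrow> g \<in> carrier G \<Longrightarrow> m \<in> carrier M \<Longrightarrow> (f \<otimes>\<^bsub>G\<^esub> g) m = f (g m)"
  by (simp add: carrier_G) (simp add: park_group_def BijGroup_def compose_def)

lemma G_one: "m \<in> carrier M \<Longrightarrow> \<one>\<^bsub>G\<^esub> m = m"
  by (simp add: park_group_def BijGroup_def)

lemma G_eqI:
  assumes "f \<in> carrier G" "g \<in> carrier G" "\<And>m. m \<in> carrier M \<Longrightarrow> f m = g m" shows "f = g"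
  using assms by (auto simp: carrier_G Bij_def intro: extensionalityI)

end

sublocale park_model \<subseteq> G: group "park_group P M"
  by (rule group_G)

context park_model
begin

lemma G_inv: "f \<in> carrier G \<Longrightarrow> m \<in> carrier M \<Longrightarrow> f ((inv\<^bsub>G\<^esub> f) m) = m"
  using G_mult[of f "inv\<^bsub>G\<^esub> f" m] G_one by simp

lemma finite_carrier_G: "finite (carrier G)"
proof (rule finite_subset)
  show "carrier G \<subseteq> carrier M \<rightarrow>\<^sub>E carrier M"
  proof
    fix f assume f: "f \<in> carrier G"
    then have "f \<in> extensional (carrier M)" by (simp add: carrier_G Bij_imp_extensional)
    then show "f \<in> carrier M \<rightarrow>\<^sub>E carrier M" using G_closed[OF f] by (simp add: PiE_def)
  qed
  show "finite (carrier M \<rightarrow>\<^sub>E carrier M)" using finite_M by (simp add: finite_PiE)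
qed

lemma \<iota>_apply: "m \<in> carrier M \<Longrightarrow> \<iota> x m = x \<otimes> m"
  by (simp add: park_embedding_def)

lemma \<iota>_closed: "x \<in> carrier M \<Longrightarrow> \<iota> x \<in> carrier G"
proof -
  assume x: "x \<in> carrier M"
  have "bij_betw (\<lambda>m. x \<otimes> m) (carrier M) (carrier M)"
    by (rule bij_betwI[where g = "\<lambda>m. inv x \<otimes> m"]) (use x in \<open>auto simp flip: m_assoc\<close>)
  then have "\<iota> x \<in> Bij (carrier M)" by (simp add: park_embedding_def Bij_def)
  then show ?thesis using x P_carrier by (simp add: carrier_G \<iota>_apply m_assoc)
qed

lemma \<iota>_hom: "group_hom M G \<iota>"
proof (intro group_hom.intro group_hom_axioms.intro homI is_group group_G)
  show "\<iota> x \<in> carrier G" if "x \<in> carrier M" for x using \<iota>_closed[OF that] .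
  show "\<iota> (x \<otimes> y) = \<iota> x \<otimes>\<^bsub>G\<^esub> \<iota> y" if "x \<in> carrier M" "y \<in> carrier M" for x y
    by (rule G_eqI) (use that in \<open>simp_all add: \<iota>_closed G_mult \<iota>_apply m_assoc\<close>)
qed

lemma \<iota>_inj: "inj_on \<iota> (carrier M)"
proof (rule inj_onI)
  fix x y assume xy: "x \<in> carrier M" "y \<in> carrier M" and eq: "\<iota> x = \<iota> y"
  have "x = \<iota> x \<one>" using xy(1) by (simp add: \<iota>_apply)
  also have "\<dots> = \<iota> y \<one>" by (simp only: eq)
  also have "\<dots> = y" using xy(2) by (simp add: \<iota>_apply)
  finally show "x = y" .
qed

lemma \<iota>_subgroup: "subgroup H M \<Longrightarrow> subgroup (\<iota> ` H) G"
  using group_hom.subgroup_img_is_subgroup[OF \<iota>_hom] .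

section \<open>The base group\<close>

text \<open>
  The kernel of the action of \<open>G\<close> on the set of cosets of \<open>P\<close> in \<open>M\<close>. With \<open>G\<close> viewed as the wreath
  product of \<open>P\<close> with a symmetric group this is the base group, a direct power of \<open>P\<close>.
\<close>
definition base :: "('a \<Rightarrow> 'a) set" where
  "base = {f \<in> carrier G. \<forall>m \<in> carrier M. inv m \<otimes> f m \<in> carrier P}"

lemma base_iff: "f \<in> base \<longleftrightarrow> f \<in> carrier G \<and> (\<forall>m \<in> carrier M. \<exists>u \<in> carrier P. f m = m \<otimes> u)"
proof -
  have "inv m \<otimes> f m \<in> carrier P \<longleftrightarrow> (\<exists>u \<in> carrier P. f m = m \<otimes> u)"
    if fm: "f \<in> carrier G" "m \<in> carrier M" for f m
  proof
    assume "inv m \<otimes> f m \<in> carrier P"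
    moreover have "f m = m \<otimes> (inv m \<otimes> f m)" using fm G_closed by (simp flip: m_assoc)
    ultimately show "\<exists>u \<in> carrier P. f m = m \<otimes> u" by blast
  next
    assume "\<exists>u \<in> carrier P. f m = m \<otimes> u"
    then show "inv m \<otimes> f m \<in> carrier P" using fm P_carrier by (auto simp flip: m_assoc)
  qed
  then show ?thesis by (auto simp: base_def)
qed

lemma base_normal: "base \<lhd> G"
  unfolding G.normal_inv_iff
proof (intro conjI ballI)
  show "subgroup base G"
  proof (rule G.subgroupI)
    show "base \<subseteq> carrier G" by (auto simp: base_def)
    have "\<one>\<^bsub>G\<^esub> \<in> base" using subgroup.one_closed[OF P] by (auto simp: base_def G_one)
    then show "base \<noteq> {}" by blast
  next
    fix f assume f: "f \<in> base"
    then have fG: "f \<in> carrier G" by (simp add: base_def)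
    have "\<exists>u \<in> carrier P. (inv\<^bsub>G\<^esub> f) m = m \<otimes> u" if m: "m \<in> carrier M" for m
    proof -
      let ?x = "(inv\<^bsub>G\<^esub> f) m"
      have x: "?x \<in> carrier M" using G_closed[OF _ m] fG by simp
      obtain u where u: "u \<in> carrier P" "f ?x = ?x \<otimes> u" using f x unfolding base_iff by blast
      then have "m = ?x \<otimes> u" using G_inv[OF fG m] by simp
      then have "?x = m \<otimes> inv u" using x P_carrier[OF u(1)] by (metis inv_solve_right m)
      then show ?thesis using subgroup.m_inv_closed[OF P u(1)] by blast
    qed
    then show "inv\<^bsub>G\<^esub> f \<in> base" unfolding base_iff using fG by simp
  next
    fix f g assume f: "f \<in> base" and g: "g \<in> base"
    have G: "f \<in> carrier G" "g \<in> carrier G" using f g by (simp_all add: base_def)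
    have "\<exists>u \<in> carrier P. (f \<otimes>\<^bsub>G\<^esub> g) m = m \<otimes> u" if m: "m \<in> carrier M" for m
    proof -
      obtain u where u: "u \<in> carrier P" "g m = m \<otimes> u" using g m unfolding base_iff by blast
      obtain v where v: "v \<in> carrier P" "f m = m \<otimes> v" using f m unfolding base_iff by blast
      have "(f \<otimes>\<^bsub>G\<^esub> g) m = m \<otimes> (v \<otimes> u)"
        using G_mult[OF G m] G_equivariant[OF G(1) m u(1)] u v m P_carrier by (simp add: m_assoc)
      then show ?thesis using subgroup.m_closed[OF P v(1) u(1)] by blast
    qed
    then show "f \<otimes>\<^bsub>G\<^esub> g \<in> base" unfolding base_iff using G by simp
  qed
next
  fix g f assume g: "g \<in> carrier G" and f: "f \<in> base"
  have fG: "f \<in> carrier G" using f by (simp add: base_def)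
  have "\<exists>u \<in> carrier P. (g \<otimes>\<^bsub>G\<^esub> f \<otimes>\<^bsub>G\<^esub> inv\<^bsub>G\<^esub> g) m = m \<otimes> u" if m: "m \<in> carrier M" for m
  proof -
    let ?x = "(inv\<^bsub>G\<^esub> g) m"
    have x: "?x \<in> carrier M" using G_closed[OF _ m] g by simp
    obtain u where u: "u \<in> carrier P" "f ?x = ?x \<otimes> u" using f x unfolding base_iff by blast
    have "(g \<otimes>\<^bsub>G\<^esub> f \<otimes>\<^bsub>G\<^esub> inv\<^bsub>G\<^esub> g) m = g (f ?x)" using g fG m x by (simp add: G_mult)
    also have "\<dots> = m \<otimes> u" using u G_equivariant[OF g x u(1)] G_inv[OF g m] by simp
    finally show ?thesis using u(1) by blast
  qed
  then show "g \<otimes>\<^bsub>G\<^esub> f \<otimes>\<^bsub>G\<^esub> inv\<^bsub>G\<^esub> g \<in> base" unfolding base_iff using g fG by simp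
qed

text \<open>
  If \<open>f(m) = mu\<close> with \<open>u \<in> P\<close>, then the \<open>k\<close>-th power of \<open>f\<close> sends \<open>m\<close> to \<open>mu\<^sup>k\<close>. So the exponent
  of the base group divides the order of \<open>P\<close>.
\<close>
lemma base_order: "\<exists>n. card base = p ^ n"
proof -
  have B: "subgroup base G" using base_normal by (rule normal_imp_subgroup)
  let ?B = "G\<lparr>carrier := base\<rparr>"
  interpret B: group ?B using G.subgroup_imp_group[OF B] .
  have "\<exists>n. order ?B = p ^ n"
  proof (rule B.order_is_prime_power[OF _ K.prime])
    show "finite (carrier ?B)"
      using finite_subset[OF subgroup.subset[OF B] finite_carrier_G] by simp
    fix f assume "f \<in> carrier ?B"
    then have f: "f \<in> base" by simp
    then have fG: "f \<in> carrier G" by (simp add: base_def)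
    have pow: "(f [^]\<^bsub>G\<^esub> k) m = m \<otimes> u [^]\<^bsub>M\<^esub> k"
      if m: "m \<in> carrier M" and u: "u \<in> carrier P" "f m = m \<otimes> u" for m u and k :: nat
    proof (induction k)
      case 0 then show ?case using m by (simp add: G_one)
    next
      case (Suc k)
      have uM: "u \<in> carrier M" using P_carrier[OF u(1)] .
      have "(f [^]\<^bsub>G\<^esub> Suc k) m = (f [^]\<^bsub>G\<^esub> k) (m \<otimes> u)"
        using G_mult[OF G.nat_pow_closed[OF fG] fG m] u(2) by simp
      also have "\<dots> = (f [^]\<^bsub>G\<^esub> k) m \<otimes> u"
        by (rule G_equivariant[OF G.nat_pow_closed[OF fG] m u(1)])
      also have "\<dots> = m \<otimes> u [^]\<^bsub>M\<^esub> Suc k" using Suc m uM by (simp add: m_assoc)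
      finally show ?case .
    qed
    let ?k = "p ^ multiplicity p (order M)"
    have "f [^]\<^bsub>G\<^esub> ?k = \<one>\<^bsub>G\<^esub>"
    proof (rule G_eqI[OF G.nat_pow_closed[OF fG] G.one_closed])
      fix m assume m: "m \<in> carrier M"
      obtain u where u: "u \<in> carrier P" "f m = m \<otimes> u" using f m unfolding base_iff by blast
      have "u [^]\<^bsub>M\<lparr>carrier := carrier P\<rparr>\<^esub> order (M\<lparr>carrier := carrier P\<rparr>) = \<one>"
        using group.pow_order_eq_1[OF subgroup_imp_group[OF P], of u] u(1) by simp
      then have "u [^]\<^bsub>M\<^esub> ?k = \<one>"
        using nat_pow_consistent[of u ?k "carrier P"] sylow by (simp add: order_def)
      then show "(f [^]\<^bsub>G\<^esub> ?k) m = \<one>\<^bsub>G\<^esub> m" using pow[OF m u] m by (simp add: G_one)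
    qed
    then show "f [^]\<^bsub>?B\<^esub> ?k = \<one>\<^bsub>?B\<^esub>" using G.nat_pow_consistent[of f ?k base] by simp
  qed
  then show ?thesis by (simp add: order_def)
qed

section \<open>The normal core of the Sylow subgroup\<close>

definition core :: "'a set" where
  "core = {x \<in> carrier M. \<forall>m \<in> carrier M. inv m \<otimes> x \<otimes> m \<in> carrier P}"

lemma core_subset_P: "core \<subseteq> carrier P"
proof
  fix x assume x: "x \<in> core"
  then have "inv \<one> \<otimes> x \<otimes> \<one> \<in> carrier P" unfolding core_def by blast
  then show "x \<in> carrier P" using x by (simp add: core_def)
qed

lemma core_conj:
  assumes x: "x \<in> core" and g: "g \<in> carrier M" shows "g \<otimes> x \<otimes> inv g \<in> core"
  unfolding core_def
proof (intro CollectI conjI ballI)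
  have xM: "x \<in> carrier M" using x by (simp add: core_def)
  then show "g \<otimes> x \<otimes> inv g \<in> carrier M" using g by simp
  fix m assume m: "m \<in> carrier M"
  have "inv (inv g \<otimes> m) \<otimes> x \<otimes> (inv g \<otimes> m) \<in> carrier P"
    using x g m by (simp add: core_def)
  then show "inv m \<otimes> (g \<otimes> x \<otimes> inv g) \<otimes> m \<in> carrier P"
    using g m xM by (simp add: inv_mult_group m_assoc)
qed

lemma core_normal: "core \<lhd> M"
  unfolding normal_inv_iff
proof (intro conjI ballI core_conj)
  show "subgroup core M"
  proof (rule subgroupI)
    show "core \<subseteq> carrier M" by (auto simp: core_def)
    have "\<one> \<in> core" using subgroup.one_closed[OF P] by (simp add: core_def)
    then show "core \<noteq> {}" by blast
  next
    fix x assume x: "x \<in> core"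
    then have xM: "x \<in> carrier M" by (simp add: core_def)
    have "inv m \<otimes> inv x \<otimes> m \<in> carrier P" if m: "m \<in> carrier M" for m
    proof -
      have "inv (inv m \<otimes> x \<otimes> m) \<in> carrier P"
        by (rule subgroup.m_inv_closed[OF P]) (use x m in \<open>simp add: core_def\<close>)
      then show ?thesis using m xM by (simp add: inv_mult_group m_assoc)
    qed
    then show "inv x \<in> core" using xM by (simp add: core_def)
  next
    fix x y assume x: "x \<in> core" and y: "y \<in> core"
    then have M: "x \<in> carrier M" "y \<in> carrier M" by (simp_all add: core_def)
    have "inv m \<otimes> (x \<otimes> y) \<otimes> m \<in> carrier P" if m: "m \<in> carrier M" for m
    proof -
      have "(inv m \<otimes> x \<otimes> m) \<otimes> (inv m \<otimes> y \<otimes> m) \<in> carrier P"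
        by (rule subgroup.m_closed[OF P]) (use x y m in \<open>simp_all add: core_def\<close>)
      then show ?thesis using m M by (simp add: m_assoc mult_inv_cancel)
    qed
    then show "x \<otimes> y \<in> core" using M by (simp add: core_def)
  qed
qed

lemma index_P: "\<not> p dvd card (lcosets\<^bsub>M\<^esub> (carrier P))"
proof
  assume d: "p dvd card (lcosets\<^bsub>M\<^esub> (carrier P))"
  have "card (lcosets\<^bsub>M\<^esub> (carrier P)) * card (carrier P) = order M"
    by (rule l_lagrange[OF finite_M P])
  then have "p ^ Suc (multiplicity p (order M)) dvd order M"
    using d sylow by (metis mult_dvd_mono dvd_refl power_Suc)
  moreover have "order M \<noteq> 0" using finite_M order_gt_0_iff_finite by simp
  moreover have "\<not> is_unit p" using K.prime not_prime_unit by blast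
  ultimately show False by (simp add: power_dvd_iff_le_multiplicity del: power_Suc)
qed

text \<open>
  The number of cosets of \<open>P\<close> is prime to \<open>p\<close>, so the \<open>p\<close>-group \<open>N\<close> fixes one of them, say \<open>gP\<close>. Then
  \<open>N\<close> is contained in the conjugate of \<open>P\<close> by \<open>g\<close>, and in \<open>P\<close> because \<open>N\<close> is normal.
\<close>
lemma normal_p_subgroup_in_P:
  assumes N: "N \<lhd> M" and pN: "p_group p (M\<lparr>carrier := N\<rparr>)"
  shows "N \<subseteq> carrier P"
proof -
  have Ns: "subgroup N M" using N by (rule normal_imp_subgroup)
  have NM: "n \<in> carrier M" if "n \<in> N" for n using subgroup.mem_carrier[OF Ns that] .
  let ?X = "lcosets\<^bsub>M\<^esub> (carrier P)"
  have sub: "A \<subseteq> carrier M" if "A \<in> ?X" for A using lcosets_subset_PowG[OF P] that by blast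
  obtain k where k: "order (M\<lparr>carrier := N\<rparr>) = p ^ k" using pN by (auto simp: p_group_def)
  have "p dvd card ?X \<longleftrightarrow> p dvd card {A \<in> ?X. \<forall>n \<in> carrier (M\<lparr>carrier := N\<rparr>). n <#\<^bsub>M\<^esub> A = A}"
  proof (rule K.card_fixed_points[where a = "l_coset M", OF _ k])
    show "group (M\<lparr>carrier := N\<rparr>)" using subgroup_imp_group[OF Ns] .
    show "finite ?X" using lcosets_subset_PowG[OF P] finite_M finite_subset by blast
    show "n <#\<^bsub>M\<^esub> A \<in> ?X" if "n \<in> carrier (M\<lparr>carrier := N\<rparr>)" "A \<in> ?X" for n A
      using that NM lcos_m_assoc[OF subgroup.subset[OF P]] by (auto simp: LCOSETS_def)
    show "\<one>\<^bsub>M\<lparr>carrier := N\<rparr>\<^esub> <#\<^bsub>M\<^esub> A = A" if "A \<in> ?X" for A using lcos_mult_one[OF sub[OF that]] by simp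
    show "(n \<otimes>\<^bsub>M\<lparr>carrier := N\<rparr>\<^esub> n') <#\<^bsub>M\<^esub> A = n <#\<^bsub>M\<^esub> (n' <#\<^bsub>M\<^esub> A)"
      if "n \<in> carrier (M\<lparr>carrier := N\<rparr>)" "n' \<in> carrier (M\<lparr>carrier := N\<rparr>)" "A \<in> ?X" for n n' A
      using that NM lcos_m_assoc[OF sub] by simp
  qed
  then have "\<not> p dvd card {A \<in> ?X. \<forall>n \<in> N. n <#\<^bsub>M\<^esub> A = A}" using index_P by simp
  then have "{A \<in> ?X. \<forall>n \<in> N. n <#\<^bsub>M\<^esub> A = A} \<noteq> {}" by (metis card.empty dvd_0_right)
  then obtain g where g: "g \<in> carrier M" "\<And>n. n \<in> N \<Longrightarrow> n <#\<^bsub>M\<^esub> (g <#\<^bsub>M\<^esub> carrier P) = g <#\<^bsub>M\<^esub> carrier P"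
    by (auto simp: LCOSETS_def)
  show ?thesis
  proof
    fix n assume n: "n \<in> N"
    let ?c = "g \<otimes> n \<otimes> inv g"
    have c: "?c \<in> N" using normal.inv_op_closed2[OF N g(1) n] .
    have "g \<in> g <#\<^bsub>M\<^esub> carrier P" by (rule lcos_self[OF g(1) P])
    then have "?c \<otimes> g \<in> ?c <#\<^bsub>M\<^esub> (g <#\<^bsub>M\<^esub> carrier P)"
      unfolding l_coset_def[of M ?c] by blast
    then have "?c \<otimes> g \<in> g <#\<^bsub>M\<^esub> carrier P" using g(2)[OF c] by simp
    then obtain u where u: "u \<in> carrier P" "?c \<otimes> g = g \<otimes> u" by (auto simp: l_coset_def)
    have "?c \<otimes> g = g \<otimes> n" using g(1) NM[OF n] by (simp add: m_assoc)
    then have "n = u" using u g(1) NM[OF n] P_carrier by simp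
    then show "n \<in> carrier P" using u by simp
  qed
qed

text \<open>A normal \<open>p\<close>-subgroup lies in \<open>P\<close>, hence in every conjugate of \<open>P\<close>.\<close>
lemma p_core_eq: "p_core p M = core"
  unfolding p_core_def
proof (rule Greatest_equality)
  have core: "subgroup core M" using core_normal by (rule normal_imp_subgroup)
  have "card core dvd p ^ multiplicity p (order M)"
  proof -
    have "subgroup core (M\<lparr>carrier := carrier P\<rparr>)"
      using core P core_subset_P by (intro subgroup_incl) auto
    then have "card (rcosets\<^bsub>M\<lparr>carrier := carrier P\<rparr>\<^esub> core) * card core = card (carrier P)"
      using group.lagrange[OF subgroup_imp_group[OF P]] by (simp add: order_def)
    then show ?thesis using sylow by (metis dvd_triv_right)
  qed
  then have "\<exists>n. card core = p ^ n" using K.prime divides_primepow_nat by blast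
  then show "core \<lhd> M \<and> p_group p (M\<lparr>carrier := core\<rparr>)"
    using core_normal subgroup_imp_group[OF core] by (simp add: p_group_def order_def)
  fix N assume N: "N \<lhd> M \<and> p_group p (M\<lparr>carrier := N\<rparr>)"
  then have "N \<subseteq> carrier P" using normal_p_subgroup_in_P by blast
  moreover have "N \<lhd> M" using N by blast
  ultimately show "N \<subseteq> core"
    using normal.inv_op_closed1[of N M] subgroup.subset[OF normal_imp_subgroup, of N M]
    unfolding core_def by auto
qed

lemma commutes_with_core_imp_core:
  assumes "z \<in> carrier M" "\<And>y. y \<in> core \<Longrightarrow> z \<otimes> y = y \<otimes> z"
  shows "z \<in> core"
  using assms constrained by (auto simp: p_core_eq centralizer_def)

lemma base_Int_image: "base \<inter> \<iota> ` carrier M = \<iota> ` core"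
proof -
  have "\<iota> x \<in> base \<longleftrightarrow> x \<in> core" if x: "x \<in> carrier M" for x
    using x \<iota>_closed[OF x] by (simp add: base_def core_def \<iota>_apply m_assoc)
  moreover have "core \<subseteq> carrier M" by (auto simp: core_def)
  ultimately show ?thesis by blast
qed

text \<open>
  Put \<open>a = g(1)\<close> and \<open>Q = core\<close>. Comparing the values at \<open>1\<close> shows that the automorphism of \<open>Q\<close> induced
  by \<open>g\<close> is conjugation by \<open>a\<close>. So \<open>b(x) = a\<^sup>-\<^sup>1 g(x)\<close> commutes with left multiplication by
  \<open>Q\<close>. It also commutes with right multiplication by \<open>x\<^sup>-\<^sup>1 y x\<close> for \<open>y \<in> Q\<close>, and
  \<open>y x = x (x\<^sup>-\<^sup>1 y x)\<close>; together these say that \<open>b(x) x\<^sup>-\<^sup>1\<close> centralizes \<open>Q\<close>.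
\<close>
lemma base_controls:
  assumes g: "g \<in> carrier G"
    and conj: "\<And>q. q \<in> base \<inter> \<iota> ` carrier M \<Longrightarrow> inv\<^bsub>G\<^esub> g \<otimes>\<^bsub>G\<^esub> q \<otimes>\<^bsub>G\<^esub> g \<in> \<iota> ` carrier M"
  shows "\<exists>m \<in> \<iota> ` carrier M. \<exists>b \<in> base. g = m \<otimes>\<^bsub>G\<^esub> b"
proof -
  define a where "a = g \<one>"
  have a: "a \<in> carrier M" using G_closed[OF g] by (simp add: a_def)
  have coreM: "x \<in> carrier M" if "x \<in> core" for x using that by (simp add: core_def)
  have key: "a \<otimes> y \<otimes> inv a \<otimes> g x = g x \<otimes> (inv x \<otimes> y \<otimes> x)"
    if y: "y \<in> core" and x: "x \<in> carrier M" for x y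
  proof -
    define q where "q = a \<otimes> y \<otimes> inv a"
    have q: "q \<in> core" unfolding q_def using core_conj[OF y a] .
    have yM: "y \<in> carrier M" and qM: "q \<in> carrier M" using coreM y q by auto
    have \<iota>q: "\<iota> q \<in> base \<inter> \<iota> ` carrier M" using q base_Int_image by blast
    let ?c = "inv\<^bsub>G\<^esub> g \<otimes>\<^bsub>G\<^esub> \<iota> q \<otimes>\<^bsub>G\<^esub> g"
    have "?c \<in> base" using normal.inv_op_closed1[OF base_normal g] \<iota>q by blast
    then have "?c \<in> \<iota> ` core" using conj[OF \<iota>q] base_Int_image by blast
    then obtain w where w: "w \<in> core" "?c = \<iota> w" by blast
    have wM: "w \<in> carrier M" using coreM[OF w(1)] .
    have wP: "w \<in> carrier P" using w(1) core_subset_P by blast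
    have "g \<otimes>\<^bsub>G\<^esub> ?c = \<iota> q \<otimes>\<^bsub>G\<^esub> g"
      using g \<iota>_closed[OF qM] by (simp flip: G.m_assoc)
    then have rel: "g (w \<otimes> z) = q \<otimes> g z" if "z \<in> carrier M" for z
      using G_mult[OF g \<iota>_closed[OF wM] that] G_mult[OF \<iota>_closed[OF qM] g that] w(2)
        \<iota>_apply that G_closed[OF g that] by simp
    have "a \<otimes> w = q \<otimes> a"
      using rel[of "\<one>"] G_equivariant[OF g _ wP, of "\<one>"] wM by (simp add: a_def)
    also have "\<dots> = a \<otimes> y" using a yM by (simp add: q_def m_assoc)
    finally have wy: "w = y" using a wM yM by simp
    have xyx: "inv x \<otimes> y \<otimes> x \<in> carrier P" using y x by (simp add: core_def)
    have "q \<otimes> g x = g (y \<otimes> x)" using rel[OF x] wy by simp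
    also have "y \<otimes> x = x \<otimes> (inv x \<otimes> y \<otimes> x)" using x yM by (simp flip: m_assoc)
    also have "g \<dots> = g x \<otimes> (inv x \<otimes> y \<otimes> x)" by (rule G_equivariant[OF g x xyx])
    finally show ?thesis by (simp add: q_def)
  qed
  define b where "b = \<iota> (inv a) \<otimes>\<^bsub>G\<^esub> g"
  have ia: "\<iota> (inv a) \<in> carrier G" using \<iota>_closed a by simp
  have bG: "b \<in> carrier G" unfolding b_def using ia g by simp
  have b_app: "b x = inv a \<otimes> g x" if "x \<in> carrier M" for x
    unfolding b_def using G_mult[OF ia g that] \<iota>_apply[OF G_closed[OF g that]] by simp
  have "inv x \<otimes> b x \<in> carrier P" if x: "x \<in> carrier M" for x
  proof -
    have gx: "g x \<in> carrier M" using G_closed[OF g x] .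
    define z where "z = inv a \<otimes> g x \<otimes> inv x"
    have zM: "z \<in> carrier M" unfolding z_def using a gx x by simp
    have "z \<in> core"
    proof (rule commutes_with_core_imp_core[OF zM])
      fix y assume y: "y \<in> core"
      have yM: "y \<in> carrier M" using coreM[OF y] .
      have "z \<otimes> y = inv a \<otimes> (g x \<otimes> (inv x \<otimes> y \<otimes> x)) \<otimes> inv x"
        unfolding z_def using a gx x yM by (simp add: m_assoc)
      also have "\<dots> = inv a \<otimes> (a \<otimes> y \<otimes> inv a \<otimes> g x) \<otimes> inv x"
        using key[OF y x] by simp
      also have "\<dots> = y \<otimes> z"
        unfolding z_def using a gx x yM by (simp add: m_assoc mult_inv_cancel)
      finally show "z \<otimes> y = y \<otimes> z" .
    qed
    then have "inv x \<otimes> z \<otimes> x \<in> carrier P" using x by (simp add: core_def)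
    moreover have "inv x \<otimes> z \<otimes> x = inv x \<otimes> b x"
      unfolding z_def b_app[OF x] using a gx x by (simp add: m_assoc)
    ultimately show ?thesis by simp
  qed
  then have "b \<in> base" using bG by (simp add: base_def)
  moreover have "g = \<iota> a \<otimes>\<^bsub>G\<^esub> b"
    by (rule G_eqI)
      (use g bG a \<iota>_closed[OF a] G_closed[OF g] in \<open>simp_all add: G_mult b_app \<iota>_apply flip: m_assoc\<close>)
  ultimately show ?thesis using a by blast
qed

lemma permutation_module_image: "permutation_module K G (\<iota> ` carrier M)"
  by (intro permutation_module.intro permutation_module_axioms.intro K.field_axioms group_G
      finite_carrier_G \<iota>_subgroup subgroup_self)

lemma normal_p_subgroup_controls_base:
  assumes "card base = p ^ n"
  shows "normal_p_subgroup_controls p K G (\<iota> ` carrier M) base n"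
proof (intro normal_p_subgroup_controls.intro normal_p_subgroup_controls_axioms.intro
    permutation_module_image base_normal assms)
  show "prime_char_field p K" by unfold_locales
  show "\<exists>m \<in> \<iota> ` carrier M. \<exists>b \<in> base. g = m \<otimes>\<^bsub>G\<^esub> b"
    if "g \<in> carrier G"
      "\<And>q. q \<in> base \<inter> \<iota> ` carrier M \<Longrightarrow> inv\<^bsub>G\<^esub> g \<otimes>\<^bsub>G\<^esub> q \<otimes>\<^bsub>G\<^esub> g \<in> \<iota> ` carrier M" for g
    using that by (rule base_controls)
qed

lemma index_prime_to_p_image: "index_prime_to_p p K G (\<iota> ` carrier M) (\<iota> ` carrier P)"
proof (intro index_prime_to_p.intro index_prime_to_p_axioms.intro permutation_module_image)
  show "prime_char_field p K" by unfold_locales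
  show sub: "subgroup (\<iota> ` carrier P) G" using \<iota>_subgroup[OF P] .
  show PM: "\<iota> ` carrier P \<subseteq> \<iota> ` carrier M" using P_carrier by blast
  let ?N = "G\<lparr>carrier := \<iota> ` carrier M\<rparr>"
  have M: "subgroup (\<iota> ` carrier M) G" using \<iota>_subgroup[OF subgroup_self] .
  have "card (lcosets\<^bsub>?N\<^esub> (\<iota> ` carrier P)) * card (\<iota> ` carrier P) = order ?N"
    by (rule group.l_lagrange[OF G.subgroup_imp_group[OF M]])
      (use finite_M M PM sub in \<open>auto intro!: G.subgroup_incl\<close>)
  moreover have "card (\<iota> ` carrier P) = card (carrier P)"
    using inj_on_subset[OF \<iota>_inj subgroup.subset[OF P]] by (rule card_image)
  moreover have "order ?N = order M" using card_image[OF \<iota>_inj] by (simp add: order_def)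
  ultimately have "card (lcosets\<^bsub>?N\<^esub> (\<iota> ` carrier P)) * card (carrier P) =
      card (lcosets\<^bsub>M\<^esub> (carrier P)) * card (carrier P)"
    using l_lagrange[OF finite_M P] by simp
  moreover have "card (carrier P) \<noteq> 0" using sylow K.prime by auto
  ultimately show "\<not> p dvd card (lcosets\<^bsub>?N\<^esub> (\<iota> ` carrier P))" using index_P by simp
qed

end

theorem theorem3p4:
  fixes p :: nat and K :: "'k ring"
    and P M :: "'a monoid" and F :: "'a fusion"
    and G :: "('a \<Rightarrow> 'a) monoid" and \<iota> :: "'a \<Rightarrow> 'a \<Rightarrow> 'a"
  assumes "Factorial_Ring.prime p"
    and "algebraically_closed K" and "ring_char K = p"
    and "constrained_fusion_system p P F"
    and "fusion_model p P F M"
    and "G = park_group P M" and "\<iota> = park_embedding M"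
  shows "kG_isomorphic K G
    (scott_module K G (\<iota> ` carrier P))
    (induced_module K G (\<iota> ` carrier M) (trivial_gmodule K))"
proof -
  have "park_model p K P M"
    using assms(1-3,5) algebraically_closed.axioms(1)
    by (intro park_model.intro prime_char_field.intro prime_char_field_axioms.intro
        park_model_axioms.intro)
      (auto simp: fusion_model_def strictly_p_constrained_def sylow_subgroup_def)
  then interpret park_model p K P M .
  obtain n where "card base = p ^ n" using base_order by blast
  then show ?thesis
    unfolding assms(6,7)
    by (intro scott_module_isomorphic[OF normal_p_subgroup_controls_base index_prime_to_p_image])
qed

end
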